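(* Let $\Omega\subset\mathbb{R}^d$, $d\ge2$, be a bounded domain with smooth boundary, let $T>0$, and let $\{(u^\nu,p^\nu)\}_{\nu>0}$ be a sequence of Leray--Hopf solutions to the incompressible Navier--Stokes system with viscosity $\nu$ such that $u^\nu,p^\nu\in C^\infty(\overline\Omega\times(0,T])$ for every $\nu>0$. Assume that, as $\nu\to0^+$, (i) $u^\nu\to u$ strongly in $L^3(\Omega\times(0,T))$ and $p^\nu\rightharpoonup p$ weakly in $L^{3/2}(\Omega\times(0,T))$; (ii) $\nu|\nabla u^\nu|^2\rightharpoonup\mu\in\mathcal{M}(\overline\Omega\times(0,T])$ and $|u^\nu(\cdot,T)|^2\rightharpoonup\lambda\in\mathcal{M}(\overline\Omega)$ in the sense of measures. Then $(u,p)$ is a weak solution to the incompressible Euler system with positive boundary extendable dissipation $\overline\varepsilon[u]$. Moreover, $$\overline\varepsilon[u]=\mu+\frac{\lambda}{2}\otimes\delta_T,$$ with $\delta_T\in\mathcal{M}([0,T])$ the Dirac delta at $t=T$.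
   Context: Navier--Stokes system: $\partial_tu^\nu+(u^\nu\cdot\nabla)u^\nu=-\nabla p^\nu+\nu\Delta u^\nu$, $\operatorname{div}u^\nu=0$ in $\Omega\times(0,T)$, $u^\nu=0$ on $\partial\Omega\times(0,T)$. A Leray--Hopf solution is a distributional solution in $L^\infty(0,T;L^2(\Omega))\cap L^2(0,T;H^1(\Omega))$ with zero boundary trace attaining an $L^2$ divergence-free initial datum and satisfying the global energy inequality. Euler system: $\partial_t u+(u\cdot\nabla)u=-\nabla p$, $\operatorname{div}u=0$ in $\Omega\times(0,T)$, $u\cdot n=0$ on $\partial\Omega\times(0,T)$ ($n$ the outward unit normal). A weak solution satisfies the first two equations in the sense of distributions on $\Omega\times(0,T)$ and the boundary condition in the weak sense, i.e. $\int_0^T\int_\Omega u\cdot\nabla\varphi\,dx\,dt=0$ for all $\varphi\in C^1_c(\overline\Omega\times(0,T))$. Boundary extendable dissipation: a solution $u\in L^3(\Omega\times(0,T))$, $p\in L^{3/2}(\Omega\times(0,T))$ of the Euler system has a positive boundary extendable dissipation if there is a positive measure $\overline\varepsilon[u]\in\mathcal{M}_{\rm loc}(\overline\Omega\times(0,T])$ such that $\int_0^T\int_\Omega\big[\frac{|u|^2}{2}\partial_t\varphi+\big(\frac{|u|^2}{2}+p\big)u\cdot\nabla\varphi\big]dx\,dt=\int_{\overline\Omega\times(0,T]}\varphi\,d\overline\varepsilon[u]$ for all $\varphi\in C^1_c(\overline\Omega\times(0,T])$. $\mathcal{M}(X)$ (resp. $\mathcal{M}_{\rm loc}(X)$) denotes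 finite (resp. locally finite) Borel measures on $X$. Convergence in the sense of measures on $X$ means convergence of integrals against every function in $C_c(X)$, functions being identified with the measures having them as Lebesgue densities (here $X=\overline\Omega\times(0,T]$ and $X=\overline\Omega$ respectively). *)

theory Defs
  imports "HOL-Probability.Probability"
begin

section \<open>Differentiability up to the boundary\<close>

definition pd :: "'a::real_normed_vector \<Rightarrow> ('a \<Rightarrow> 'b::real_normed_vector) \<Rightarrow> 'a \<Rightarrow> 'b" where
  "pd v f z = frechet_derivative f (at z) v"

text \<open>\<open>Ck k U X f\<close>, for \<open>U\<close> open and \<open>U \<subseteq> X \<subseteq> closure U\<close>: \<open>f\<close> is of class \<open>C^k\<close> in \<open>U\<close>, and \<open>f\<close>
  together with all its partial derivatives of order at most \<open>k\<close> extends continuously from \<open>U\<close>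
  to \<open>X\<close>.  The function \<open>g\<close> below is the continuous extension of a partial derivative; the values
  of \<open>f\<close> off \<open>X\<close> are irrelevant.  For \<open>X = U\<close> this is the usual class \<open>C^k(U)\<close>.\<close>

primrec Ck :: "nat \<Rightarrow> 'a::euclidean_space set \<Rightarrow> 'a set \<Rightarrow> ('a \<Rightarrow> 'b::real_normed_vector) \<Rightarrow> bool" where
  "Ck 0 U X f \<longleftrightarrow> continuous_on X f"
| "Ck (Suc k) U X f \<longleftrightarrow> continuous_on X f \<and> (\<forall>z\<in>U. f differentiable (at z)) \<and>
     (\<forall>v\<in>Basis. \<exists>g. Ck k U X g \<and> (\<forall>z\<in>U. g z = pd v f z))"

definition smooth_upto :: "'a::euclidean_space set \<Rightarrow> 'a set \<Rightarrow> ('a \<Rightarrow> 'b::real_normed_vector) \<Rightarrow> bool" where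
  "smooth_upto U X f \<longleftrightarrow> (\<forall>k. Ck k U X f)"

definition compact_support_in :: "'a::topological_space set \<Rightarrow> ('a \<Rightarrow> 'b::zero) \<Rightarrow> bool" where
  "compact_support_in X f \<longleftrightarrow> (\<exists>K. compact K \<and> K \<subseteq> X \<and> (\<forall>x\<in>X - K. f x = 0))"

definition C1c :: "'a::euclidean_space set \<Rightarrow> 'a set \<Rightarrow> ('a \<Rightarrow> 'b::real_normed_vector) set" where
  "C1c U X = {f. Ck 1 U X f \<and> compact_support_in X f}"

definition test_functions :: "'a::euclidean_space set \<Rightarrow> ('a \<Rightarrow> 'b::real_normed_vector) set" where
  "test_functions U = {f. smooth_upto U U f \<and> compact_support_in U f}"

section \<open>Domains\<close>

text \<open>Near each boundary point, \<open>\<Omega>\<close> is the part of a ball lying above the graph of a smooth function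
  in the direction of some unit vector \<open>e\<close>; the graph function only sees the component
  orthogonal to \<open>e\<close>.\<close>

definition smooth_bounded_domain :: "'a::euclidean_space set \<Rightarrow> bool" where
  "smooth_bounded_domain \<Omega> \<longleftrightarrow> open \<Omega> \<and> connected \<Omega> \<and> \<Omega> \<noteq> {} \<and> bounded \<Omega> \<and>
     (\<forall>x0\<in>frontier \<Omega>. \<exists>r>0. \<exists>e \<gamma>. norm e = 1 \<and> smooth_upto UNIV UNIV (\<gamma> :: 'a \<Rightarrow> real) \<and>
        \<Omega> \<inter> ball x0 r = {x \<in> ball x0 r. \<gamma> (x - (x \<bullet> e) *\<^sub>R e) < x \<bullet> e})"

section \<open>Function spaces\<close>

definition Lp :: "real \<Rightarrow> 'a::euclidean_space set \<Rightarrow> ('a \<Rightarrow> 'b::euclidean_space) set" where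
  "Lp q S = {f \<in> borel_measurable (lebesgue_on S). integrable (lebesgue_on S) (\<lambda>x. norm (f x) powr q)}"

definition tendsto_Lp ::
  "real \<Rightarrow> 'a::euclidean_space set \<Rightarrow> ('i \<Rightarrow> 'a \<Rightarrow> 'b::euclidean_space) \<Rightarrow> ('a \<Rightarrow> 'b) \<Rightarrow> 'i filter \<Rightarrow> bool" where
  "tendsto_Lp q S f g F \<longleftrightarrow> g \<in> Lp q S \<and> (\<forall>\<^sub>F i in F. f i \<in> Lp q S) \<and>
     ((\<lambda>i. LINT x|lebesgue_on S. norm (f i x - g x) powr q) \<longlongrightarrow> 0) F"

text \<open>Weak convergence in \<open>L^q\<close>, \<open>1 < q < \<infinity>\<close>, tested against the dual space with exponent \<open>q / (q - 1)\<close>.\<close>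

definition weak_tendsto_Lp ::
  "real \<Rightarrow> 'a::euclidean_space set \<Rightarrow> ('i \<Rightarrow> 'a \<Rightarrow> 'b::euclidean_space) \<Rightarrow> ('a \<Rightarrow> 'b) \<Rightarrow> 'i filter \<Rightarrow> bool" where
  "weak_tendsto_Lp q S f g F \<longleftrightarrow> g \<in> Lp q S \<and> (\<forall>\<^sub>F i in F. f i \<in> Lp q S) \<and>
     (\<forall>h \<in> Lp (q / (q - 1)) S.
        ((\<lambda>i. LINT x|lebesgue_on S. f i x \<bullet> h x) \<longlongrightarrow> (LINT x|lebesgue_on S. g x \<bullet> h x)) F)"

text \<open>Integrability on the part in \<open>U\<close> of every compact subset of \<open>X\<close>, where \<open>U \<subseteq> X \<subseteq> closure U\<close>.\<close>

definition loc_integrable ::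
  "'a::euclidean_space set \<Rightarrow> 'a set \<Rightarrow> ('a \<Rightarrow> 'b::euclidean_space) \<Rightarrow> bool" where
  "loc_integrable U X f \<longleftrightarrow> (\<forall>K. compact K \<and> K \<subseteq> X \<longrightarrow> integrable (lebesgue_on (K \<inter> U)) f)"

text \<open>\<open>f \<in> H^1(\<Omega>)\<close> with weak partial derivatives \<open>G b\<close>.\<close>

definition H1 ::
  "'a::euclidean_space set \<Rightarrow> ('a \<Rightarrow> 'b::euclidean_space) \<Rightarrow> ('a \<Rightarrow> 'a \<Rightarrow> 'b) \<Rightarrow> bool" where
  "H1 \<Omega> f G \<longleftrightarrow> f \<in> Lp 2 \<Omega> \<and> (\<forall>b\<in>Basis. G b \<in> Lp 2 \<Omega> \<and>
     (\<forall>\<phi> \<in> test_functions \<Omega>.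
        (LINT x|lebesgue_on \<Omega>. pd b \<phi> x *\<^sub>R f x) = - (LINT x|lebesgue_on \<Omega>. (\<phi> x :: real) *\<^sub>R G b x)))"

text \<open>Zero boundary trace, i.e. membership in the \<open>H^1\<close>-closure of the test functions.\<close>

definition H1_zero_trace ::
  "'a::euclidean_space set \<Rightarrow> ('a \<Rightarrow> 'b::euclidean_space) \<Rightarrow> ('a \<Rightarrow> 'a \<Rightarrow> 'b) \<Rightarrow> bool" where
  "H1_zero_trace \<Omega> f G \<longleftrightarrow> H1 \<Omega> f G \<and>
     (\<exists>\<psi>. (\<forall>n. \<psi> n \<in> test_functions \<Omega>) \<and> tendsto_Lp 2 \<Omega> \<psi> f sequentially \<and>
        (\<forall>b\<in>Basis. tendsto_Lp 2 \<Omega> (\<lambda>n. pd b (\<psi> n)) (G b) sequentially))"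

section \<open>Measures\<close>

definition borel_measure_on :: "'a::topological_space set \<Rightarrow> 'a measure \<Rightarrow> bool" where
  "borel_measure_on X m \<longleftrightarrow> sets m = sets (restrict_space borel X)"

definition locally_finite_on :: "'a::topological_space set \<Rightarrow> 'a measure \<Rightarrow> bool" where
  "locally_finite_on X m \<longleftrightarrow> (\<forall>K. compact K \<and> K \<subseteq> X \<longrightarrow> emeasure m K < \<infinity>)"

text \<open>Convergence of the measures on \<open>X\<close> with Lebesgue densities \<open>f i\<close> to \<open>m\<close>.  The densities are only
  used on \<open>U \<subseteq> X\<close>, where \<open>X - U\<close> is a Lebesgue null set.\<close>

definition tendsto_measures ::
  "'a::euclidean_space set \<Rightarrow> 'a set \<Rightarrow> ('i \<Rightarrow> 'a \<Rightarrow> real) \<Rightarrow> 'a measure \<Rightarrow> 'i filter \<Rightarrow> bool" where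
  "tendsto_measures U X f m F \<longleftrightarrow>
     (\<forall>\<phi>. continuous_on X \<phi> \<and> compact_support_in X \<phi> \<longrightarrow>
        ((\<lambda>i. LINT z|lebesgue_on U. \<phi> z * f i z) \<longlongrightarrow> (LINT z|m. \<phi> z)) F)"

section \<open>Differential operators on space-time\<close>

definition dt :: "('a::euclidean_space \<times> real \<Rightarrow> 'b::real_normed_vector) \<Rightarrow> 'a \<times> real \<Rightarrow> 'b" where
  "dt f = pd (0, 1) f"

definition dx :: "'a::euclidean_space \<Rightarrow> ('a \<times> real \<Rightarrow> 'b::real_normed_vector) \<Rightarrow> 'a \<times> real \<Rightarrow> 'b" where
  "dx b f = pd (b, 0) f"

definition grad :: "('a::euclidean_space \<times> real \<Rightarrow> real) \<Rightarrow> 'a \<times> real \<Rightarrow> 'a" where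
  "grad f z = (\<Sum>b\<in>Basis. dx b f z *\<^sub>R b)"

definition divg :: "('a::euclidean_space \<times> real \<Rightarrow> 'a) \<Rightarrow> 'a \<times> real \<Rightarrow> real" where
  "divg f z = (\<Sum>b\<in>Basis. dx b f z \<bullet> b)"

definition laplace :: "('a::euclidean_space \<times> real \<Rightarrow> 'b::real_normed_vector) \<Rightarrow> 'a \<times> real \<Rightarrow> 'b" where
  "laplace f z = (\<Sum>b\<in>Basis. dx b (dx b f) z)"

definition grad_norm_sq :: "('a::euclidean_space \<times> real \<Rightarrow> 'a) \<Rightarrow> 'a \<times> real \<Rightarrow> real" where
  "grad_norm_sq f z = (\<Sum>b\<in>Basis. (norm (dx b f z))\<^sup>2)"

section \<open>Fluid equations\<close>

text \<open>The momentum equation and the incompressibility constraint in the sense of distributions on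
  \<open>\<Omega> \<times> (0,T)\<close>: Navier--Stokes for \<open>\<nu> > 0\<close>, Euler for \<open>\<nu> = 0\<close>.  The convective term is written in
  the divergence form \<open>div (u \<otimes> u)\<close>.\<close>

definition distributional_solution ::
  "'a::euclidean_space set \<Rightarrow> real \<Rightarrow> real \<Rightarrow> ('a \<times> real \<Rightarrow> 'a) \<Rightarrow> ('a \<times> real \<Rightarrow> real) \<Rightarrow> bool" where
  "distributional_solution \<Omega> T \<nu> u p \<longleftrightarrow>
     (let Q = \<Omega> \<times> {0<..<T} in
       loc_integrable Q Q u \<and> loc_integrable Q Q (\<lambda>z. (norm (u z))\<^sup>2) \<and> loc_integrable Q Q p \<and>
       (\<forall>\<phi> \<in> test_functions Q.
          (LINT z|lebesgue_on Q. u z \<bullet> dt \<phi> z + (\<Sum>b\<in>Basis. (u z \<bullet> b) * (u z \<bullet> dx b \<phi> z))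
             + p z * divg \<phi> z + \<nu> * (u z \<bullet> laplace \<phi> z)) = 0) \<and>
       (\<forall>\<phi> \<in> test_functions Q. (LINT z|lebesgue_on Q. u z \<bullet> grad \<phi> z) = 0))"

text \<open>\<open>G b\<close> is the weak partial derivative of \<open>u\<close> in the spatial direction \<open>b\<close>; the initial datum is
  attained weakly in \<open>L^2\<close> (together with the energy inequality this forces strong convergence).\<close>

definition leray_hopf ::
  "'a::euclidean_space set \<Rightarrow> real \<Rightarrow> real \<Rightarrow> ('a \<times> real \<Rightarrow> 'a) \<Rightarrow> ('a \<times> real \<Rightarrow> real) \<Rightarrow> bool" where
  "leray_hopf \<Omega> T \<nu> u p \<longleftrightarrow>
     distributional_solution \<Omega> T \<nu> u p \<and>
     (\<exists>C. AE t in lebesgue_on {0<..<T}. (\<lambda>x. u (x, t)) \<in> Lp 2 \<Omega> \<and>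
        (LINT x|lebesgue_on \<Omega>. (norm (u (x, t)))\<^sup>2) \<le> C) \<and>
     (\<exists>G u0.
        u \<in> Lp 2 (\<Omega> \<times> {0<..<T}) \<and> (\<forall>b\<in>Basis. G b \<in> Lp 2 (\<Omega> \<times> {0<..<T})) \<and>
        (AE t in lebesgue_on {0<..<T}. H1_zero_trace \<Omega> (\<lambda>x. u (x, t)) (\<lambda>b x. G b (x, t))) \<and>
        u0 \<in> Lp 2 \<Omega> \<and>
        (\<forall>\<phi> \<in> test_functions \<Omega>.
           (LINT x|lebesgue_on \<Omega>. u0 x \<bullet> (\<Sum>b\<in>Basis. pd b \<phi> x *\<^sub>R b)) = 0) \<and>
        weak_tendsto_Lp 2 \<Omega> (\<lambda>t x. u (x, t)) u0 (at_right 0) \<and>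
        (AE t in lebesgue_on {0<..<T}.
           (LINT x|lebesgue_on \<Omega>. (norm (u (x, t)))\<^sup>2) / 2
             + \<nu> * (LINT z|lebesgue_on (\<Omega> \<times> {0<..<t}). (\<Sum>b\<in>Basis. (norm (G b z))\<^sup>2))
           \<le> (LINT x|lebesgue_on \<Omega>. (norm (u0 x))\<^sup>2) / 2))"

definition euler_weak_solution ::
  "'a::euclidean_space set \<Rightarrow> real \<Rightarrow> ('a \<times> real \<Rightarrow> 'a) \<Rightarrow> ('a \<times> real \<Rightarrow> real) \<Rightarrow> bool" where
  "euler_weak_solution \<Omega> T u p \<longleftrightarrow>
     distributional_solution \<Omega> T 0 u p \<and>
     loc_integrable (\<Omega> \<times> {0<..<T}) (closure \<Omega> \<times> {0<..<T}) u \<and>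
     (\<forall>\<phi> \<in> C1c (\<Omega> \<times> {0<..<T}) (closure \<Omega> \<times> {0<..<T}).
        (LINT z|lebesgue_on (\<Omega> \<times> {0<..<T}). u z \<bullet> grad \<phi> z) = 0)"

text \<open>\<open>m\<close> is a positive boundary extendable dissipation of the Euler solution \<open>(u, p)\<close>.\<close>

definition boundary_extendable_dissipation ::
  "'a::euclidean_space set \<Rightarrow> real \<Rightarrow> ('a \<times> real \<Rightarrow> 'a) \<Rightarrow> ('a \<times> real \<Rightarrow> real) \<Rightarrow> ('a \<times> real) measure \<Rightarrow> bool" where
  "boundary_extendable_dissipation \<Omega> T u p m \<longleftrightarrow>
     (let Q = \<Omega> \<times> {0<..<T}; X = closure \<Omega> \<times> {0<..T} in
       euler_weak_solution \<Omega> T u p \<and> u \<in> Lp 3 Q \<and> p \<in> Lp (3/2) Q \<and>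
       borel_measure_on X m \<and> locally_finite_on X m \<and>
       (\<forall>\<phi> \<in> C1c Q X.
          (LINT z|lebesgue_on Q. (norm (u z))\<^sup>2 / 2 * dt \<phi> z
             + ((norm (u z))\<^sup>2 / 2 + p z) * (u z \<bullet> grad \<phi> z))
          = (LINT z|m. \<phi> z)))"

end

theory Submission
  imports Defs
begin

text \<open>
  For fixed viscosity the solution is smooth up to the boundary for positive times, so it satisfies the
  equations pointwise (\<open>div_free\<close>, \<open>momentum\<close>), and the momentum equation may be multiplied by \<open>\<phi> u\<close>
  with a test function \<open>\<phi>\<close> that is allowed to be nonzero on the lateral boundary and at the final time.
  Integrating by parts gives the local energy identity \<open>local_energy_identity\<close>
    \<open>\<integral>\<integral> |u|\<^sup>2/2 \<partial>\<^sub>t\<phi> + (|u|\<^sup>2/2 + p) u \<cdot> \<nabla>\<phi> = \<integral> \<phi>(T) |u(T)|\<^sup>2/2 + \<nu> \<integral>\<integral> \<phi> |\<nabla>u|\<^sup>2 + \<nu> \<integral>\<integral> \<nabla>\<phi> \<cdot> \<nabla>(|u|\<^sup>2/2)\<close>.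
  Every spatial boundary term contains a factor \<open>u\<close> and disappears, because \<open>u\<close> has zero trace; the only
  boundary that contributes is the final time, and this is where \<open>lam/2 \<otimes> \<delta>\<^sub>T\<close> comes from.  The zero trace
  is used in the form in which it is given, as approximability in \<open>H\<^sup>1\<close> by test functions
  (\<open>zero_trace_ibp\<close>): for these there is no boundary term, and the identity passes to the limit.

  Then the viscosity tends to zero.  The left-hand side converges by the strong \<open>L\<^sup>3\<close> convergence of the
  velocity, except for the work of the pressure, a product of a weakly and a strongly convergent
  sequence (\<open>pressure_work_tendsto\<close>).  On the right, the first two terms converge by hypothesis to the integrals
  of \<open>\<phi>\<close> against \<open>lam/2 \<otimes> \<delta>\<^sub>T\<close> and \<open>\<mu>\<close>, and the last is of the order of \<open>\<surd>\<nu>\<close> times energy and dissipation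
  (\<open>viscous_flux_tendsto_0\<close>).  The same convergences yield the Euler equations (\<open>euler_limit\<close>).  As the
  limit \<open>(u, p)\<close> is known in advance, it suffices to pass to the limit along one sequence of viscosities;
  it is chosen such that the velocities converge almost everywhere, with increments dominated in \<open>L\<^sup>3\<close>
  (\<open>summably_dominated_subsequence\<close>), which reduces the nonlinear limits to dominated convergence.

  Hence \<open>\<mu> + lam/2 \<otimes> \<delta>\<^sub>T\<close> is a boundary extendable dissipation.  Any other one has the same integrals
  against all admissible \<open>\<phi>\<close>; these approximate the indicators of boxes in positive time, so the two
  measures coincide (\<open>measure_determined_by_C1c\<close>).
\<close>

section \<open>Calculus up to the boundary\<close>

text \<open>The class \<open>Ck\<close> speaks of continuous extensions of derivatives.  The two notions below record such an
  extension for the function itself as well, so that they only depend on the values on the open set \<open>U\<close>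
  and apply to the literal derivatives \<open>pd v f\<close>, whose values on the boundary are arbitrary.\<close>

definition cont_ext :: "'a::euclidean_space set \<Rightarrow> 'a set \<Rightarrow> ('a \<Rightarrow> 'b::real_normed_vector) \<Rightarrow> bool" where
  "cont_ext U X f \<longleftrightarrow> (\<exists>g. continuous_on X g \<and> (\<forall>z\<in>U. g z = f z))"

definition C1_ext :: "'a::euclidean_space set \<Rightarrow> 'a set \<Rightarrow> ('a \<Rightarrow> 'b::real_normed_vector) \<Rightarrow> bool" where
  "C1_ext U X f \<longleftrightarrow> cont_ext U X f \<and> (\<forall>z\<in>U. f differentiable (at z)) \<and>
     (\<forall>v\<in>Basis. cont_ext U X (pd v f))"

lemma cont_extI: "continuous_on X f \<Longrightarrow> cont_ext U X f"
  unfolding cont_ext_def by blast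

lemma cont_ext_cong: "(\<And>z. z \<in> U \<Longrightarrow> f z = g z) \<Longrightarrow> cont_ext U X f \<longleftrightarrow> cont_ext U X g"
  unfolding cont_ext_def by auto

lemma cont_ext_subset: "cont_ext U X f \<Longrightarrow> V \<subseteq> U \<Longrightarrow> Y \<subseteq> X \<Longrightarrow> cont_ext V Y f"
  unfolding cont_ext_def using continuous_on_subset by blast

lemma cont_ext_continuous_on: "cont_ext U X f \<Longrightarrow> U \<subseteq> X \<Longrightarrow> continuous_on U f"
proof -
  assume "cont_ext U X f" "U \<subseteq> X"
  then obtain g where "continuous_on U g" "\<And>z. z \<in> U \<Longrightarrow> g z = f z"
    unfolding cont_ext_def using continuous_on_subset by blast
  then show ?thesis using continuous_on_cong[of U U g f] by simp
qed

lemma cont_ext_bounded: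
  fixes f :: "'a::euclidean_space \<Rightarrow> 'b::real_normed_vector"
  assumes "cont_ext U X f" "compact K" "K \<subseteq> X"
  obtains B where "0 \<le> B" "\<And>z. z \<in> U \<Longrightarrow> z \<in> K \<Longrightarrow> norm (f z) \<le> B"
proof -
  obtain g where g: "continuous_on X g" "\<And>z. z \<in> U \<Longrightarrow> g z = f z"
    using assms(1) unfolding cont_ext_def by blast
  have "compact (g ` K)"
    using assms by (intro compact_continuous_image continuous_on_subset[OF g(1)])
  then have "bounded (g ` K)" by (rule compact_imp_bounded)
  then obtain B where B: "\<And>z. z \<in> K \<Longrightarrow> norm (g z) \<le> B"
    unfolding bounded_iff by auto
  have "norm (f z) \<le> max 0 B" if "z \<in> U" "z \<in> K" for z
    using B[OF that(2)] g(2)[OF that(1)] by simp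
  then show ?thesis using that[of "max 0 B"] by simp
qed

lemma cont_ext_const [simp]: "cont_ext U X (\<lambda>z. c)"
  by (rule cont_extI) simp

lemma cont_ext_add: "cont_ext U X f \<Longrightarrow> cont_ext U X g \<Longrightarrow> cont_ext U X (\<lambda>z. f z + g z)"
proof -
  assume "cont_ext U X f" "cont_ext U X g"
  then obtain f' g' where "continuous_on X f'" "\<forall>z\<in>U. f' z = f z" "continuous_on X g'" "\<forall>z\<in>U. g' z = g z"
    unfolding cont_ext_def by blast
  then show ?thesis
    unfolding cont_ext_def by (intro exI[of _ "\<lambda>z. f' z + g' z"]) (auto intro: continuous_on_add)
qed

lemma cont_ext_bilinear:
  assumes "bounded_bilinear bp" "cont_ext U X f" "cont_ext U X g"
  shows "cont_ext U X (\<lambda>z. bp (f z) (g z))"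
proof -
  interpret bounded_bilinear bp by fact
  obtain f' g' where "continuous_on X f'" "\<forall>z\<in>U. f' z = f z" "continuous_on X g'" "\<forall>z\<in>U. g' z = g z"
    using assms(2,3) unfolding cont_ext_def by blast
  then show ?thesis
    unfolding cont_ext_def by (intro exI[of _ "\<lambda>z. bp (f' z) (g' z)"]) (auto intro: continuous_on)
qed

lemmas cont_ext_mult = cont_ext_bilinear[OF bounded_bilinear_mult]
  and cont_ext_scaleR = cont_ext_bilinear[OF bounded_bilinear_scaleR]
  and cont_ext_inner = cont_ext_bilinear[OF bounded_bilinear_inner]

lemma cont_ext_minus: "cont_ext U X f \<Longrightarrow> cont_ext U X (\<lambda>z. - f z)"
  using cont_ext_scaleR[of U X "\<lambda>_. -1::real" f] by simp

lemma cont_ext_diff: "cont_ext U X f \<Longrightarrow> cont_ext U X g \<Longrightarrow> cont_ext U X (\<lambda>z. f z - g z)"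
  using cont_ext_add[of U X f "\<lambda>z. - g z"] cont_ext_minus[of U X g] by simp

lemma cont_ext_sum:
  "(\<And>i. i \<in> I \<Longrightarrow> cont_ext U X (f i)) \<Longrightarrow> cont_ext U X (\<lambda>z. \<Sum>i\<in>I. f i z)"
  by (induction I rule: infinite_finite_induct) (simp_all add: cont_ext_add)

lemma cont_ext_power: "cont_ext U X f \<Longrightarrow> cont_ext U X (\<lambda>z. (f z :: real) ^ n)"
  by (induction n) (simp_all add: cont_ext_mult)

lemma cont_ext_norm: "cont_ext U X f \<Longrightarrow> cont_ext U X (\<lambda>z. norm (f z))"
proof -
  assume "cont_ext U X f"
  then obtain f' where "continuous_on X f'" "\<forall>z\<in>U. f' z = f z" unfolding cont_ext_def by blast
  then show ?thesis
    unfolding cont_ext_def by (intro exI[of _ "\<lambda>z. norm (f' z)"]) (auto intro: continuous_on_norm)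
qed

lemma pd_has_derivative: "f differentiable (at z) \<Longrightarrow> (f has_derivative (\<lambda>v. pd v f z)) (at z)"
  unfolding pd_def by (simp add: frechet_derivative_works)

lemma pd_eqI: "(f has_derivative f') (at z) \<Longrightarrow> pd v f z = f' v"
  unfolding pd_def by (simp add: frechet_derivative_at[symmetric])

lemma pd_cong:
  assumes "open U" "z \<in> U" "\<And>y. y \<in> U \<Longrightarrow> f y = g y"
  shows "pd v f z = pd v g z"
proof -
  have "(f has_derivative D) (at z) \<longleftrightarrow> (g has_derivative D) (at z)" for D
    using has_derivative_transform_within_open[of f D z UNIV U g]
      has_derivative_transform_within_open[of g D z UNIV U f] assms by metis
  then show ?thesis unfolding pd_def frechet_derivative_def by simp
qed

lemma differentiable_cong_open:
  assumes "open U" "z \<in> U" "\<And>y. y \<in> U \<Longrightarrow> f y = g y" "g differentiable (at z)"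
  shows "f differentiable (at z)"
proof -
  obtain D where "(g has_derivative D) (at z)" using assms(4) unfolding differentiable_def by blast
  then have "(f has_derivative D) (at z)"
    by (rule has_derivative_transform_within_open) (use assms in auto)
  then show ?thesis by (rule differentiableI)
qed

lemma pd_bilinear:
  assumes "bounded_bilinear bp" "f differentiable (at z)" "g differentiable (at z)"
  shows "pd v (\<lambda>z. bp (f z) (g z)) z = bp (f z) (pd v g z) + bp (pd v f z) (g z)"
    and "(\<lambda>z. bp (f z) (g z)) differentiable (at z)"
proof -
  interpret bounded_bilinear bp by fact
  have "((\<lambda>z. bp (f z) (g z)) has_derivative
      (\<lambda>v. bp (f z) (pd v g z) + bp (pd v f z) (g z))) (at z)"
    using FDERIV[OF pd_has_derivative[OF assms(2)] pd_has_derivative[OF assms(3)]] .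
  then show "pd v (\<lambda>z. bp (f z) (g z)) z = bp (f z) (pd v g z) + bp (pd v f z) (g z)"
    and "(\<lambda>z. bp (f z) (g z)) differentiable (at z)"
    by (auto intro: pd_eqI differentiableI)
qed

lemma pd_const [simp]: "pd v (\<lambda>z. c) z = 0"
  using pd_eqI[OF has_derivative_const] .

lemma pd_add:
  assumes "f differentiable (at z)" "g differentiable (at z)"
  shows "pd v (\<lambda>z. f z + g z) z = pd v f z + pd v g z"
  using has_derivative_add[OF assms[THEN pd_has_derivative]] by (rule pd_eqI)

lemmas pd_mult = pd_bilinear[OF bounded_bilinear_mult]
  and pd_inner = pd_bilinear[OF bounded_bilinear_inner]
  and pd_scaleR = pd_bilinear[OF bounded_bilinear_scaleR]

lemma Ck1_iff:
  "Ck 1 U X f \<longleftrightarrow> continuous_on X f \<and> (\<forall>z\<in>U. f differentiable (at z)) \<and> (\<forall>v\<in>Basis. cont_ext U X (pd v f))"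
  unfolding One_nat_def Ck.simps cont_ext_def by simp

lemma Ck_continuous: "Ck k U X f \<Longrightarrow> continuous_on X f"
  by (cases k) simp_all

lemma C1_extI: "Ck 1 U X f \<Longrightarrow> C1_ext U X f"
  unfolding Ck1_iff C1_ext_def by (simp add: cont_extI)

lemma C1_ext_cong:
  assumes "open U" "\<And>z. z \<in> U \<Longrightarrow> f z = g z" "C1_ext U X g"
  shows "C1_ext U X f"
  unfolding C1_ext_def
proof (intro conjI ballI)
  note d = assms(3)[unfolded C1_ext_def]
  show "cont_ext U X f" using d cont_ext_cong[of U f g X] assms(2) by blast
  show "f differentiable at z" if "z \<in> U" for z
    by (rule differentiable_cong_open[OF assms(1) that assms(2)]) (use d that in auto)
  show "cont_ext U X (pd v f)" if "v \<in> Basis" for v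
    using d that cont_ext_cong[of U "pd v f" "pd v g" X] pd_cong[of U _ f g, OF assms(1) _ assms(2)] by blast
qed

lemma C1_ext_subset: "C1_ext U X f \<Longrightarrow> V \<subseteq> U \<Longrightarrow> Y \<subseteq> X \<Longrightarrow> C1_ext V Y f"
  unfolding C1_ext_def by (blast intro: cont_ext_subset)

lemma C1_ext_D:
  assumes "C1_ext U X f"
  shows "cont_ext U X f" "\<And>z. z \<in> U \<Longrightarrow> f differentiable (at z)"
    "\<And>v. v \<in> Basis \<Longrightarrow> cont_ext U X (pd v f)"
  using assms unfolding C1_ext_def by simp_all

lemma C1_ext_bilinear:
  assumes "bounded_bilinear bp" "C1_ext U X f" "C1_ext U X g"
  shows "C1_ext U X (\<lambda>z. bp (f z) (g z))"
  unfolding C1_ext_def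
proof (intro conjI ballI)
  note d = C1_ext_D[OF assms(2)] C1_ext_D[OF assms(3)]
  show "cont_ext U X (\<lambda>z. bp (f z) (g z))"
    by (rule cont_ext_bilinear[OF assms(1) d(1) d(4)])
  show "(\<lambda>z. bp (f z) (g z)) differentiable at z" if "z \<in> U" for z
    by (rule pd_bilinear(2)[OF assms(1) d(2)[OF that] d(5)[OF that]])
  show "cont_ext U X (pd v (\<lambda>z. bp (f z) (g z)))" if "v \<in> Basis" for v
  proof -
    have "cont_ext U X (\<lambda>z. bp (f z) (pd v g z) + bp (pd v f z) (g z))"
      by (rule cont_ext_add[OF cont_ext_bilinear[OF assms(1) d(1) d(6)[OF that]]
            cont_ext_bilinear[OF assms(1) d(3)[OF that] d(4)]])
    then show ?thesis
      using cont_ext_cong[of U "pd v (\<lambda>z. bp (f z) (g z))", OF pd_bilinear(1)[OF assms(1) d(2) d(5)]]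
      by simp
  qed
qed

lemma C1_ext_const: "C1_ext U X (\<lambda>z. c)"
proof -
  have "pd v (\<lambda>z. c) = (\<lambda>z. 0)" for v :: 'a by (rule ext) simp
  then show ?thesis unfolding C1_ext_def by simp
qed

lemmas C1_ext_mult = C1_ext_bilinear[OF bounded_bilinear_mult]
  and C1_ext_inner = C1_ext_bilinear[OF bounded_bilinear_inner]

text \<open>Second derivatives of \<open>f\<close> are literally iterated \<open>pd\<close>, whereas \<open>Ck\<close> differentiates a continuous
  extension of the first derivative; on the open set \<open>U\<close> the two agree.\<close>

lemma smooth_upto_C1_ext: "smooth_upto U X f \<Longrightarrow> C1_ext U X f"
  unfolding smooth_upto_def using C1_extI by blast

lemma smooth_upto_C1_ext_pd:
  assumes "smooth_upto U X f" "open U" "v \<in> Basis"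
  shows "C1_ext U X (pd v f)"
proof -
  have "Ck (Suc 1) U X f" using assms unfolding smooth_upto_def by blast
  then obtain g where "Ck 1 U X g" "\<forall>z\<in>U. g z = pd v f z" using assms(3) unfolding Ck.simps(2) by blast
  then show ?thesis using C1_ext_cong[of U "pd v f" g X] assms(2) C1_extI[of U X g] by simp
qed

lemma Ck_SucD: "Ck (Suc k) U X f \<Longrightarrow> Ck k U X f"
proof (induction k arbitrary: f)
  case 0 then show ?case by simp
next
  case (Suc k)
  from Suc.prems have c: "continuous_on X f" and d: "\<forall>z\<in>U. f differentiable (at z)"
    and g: "\<forall>v\<in>Basis. \<exists>g. Ck (Suc k) U X g \<and> (\<forall>z\<in>U. g z = pd v f z)"
    unfolding Ck.simps(2)[of "Suc k"] by blast+
  have "\<exists>g. Ck k U X g \<and> (\<forall>z\<in>U. g z = pd v f z)" if "v \<in> Basis" for v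
    using g that Suc.IH by meson
  then show ?case using c d by simp
qed

lemma Ck_SucI:
  assumes "continuous_on X f" "\<And>z. z \<in> U \<Longrightarrow> f differentiable (at z)"
    "\<And>v. v \<in> Basis \<Longrightarrow> Ck k U X (g v)" "\<And>v z. v \<in> Basis \<Longrightarrow> z \<in> U \<Longrightarrow> g v z = pd v f z"
  shows "Ck (Suc k) U X f"
  unfolding Ck.simps using assms by blast

lemma Ck_SucE:
  assumes "Ck (Suc k) U X f"
  obtains g where "continuous_on X f" "\<And>z. z \<in> U \<Longrightarrow> f differentiable (at z)"
    "\<And>v. v \<in> Basis \<Longrightarrow> Ck k U X (g v)" "\<And>v z. v \<in> Basis \<Longrightarrow> z \<in> U \<Longrightarrow> g v z = pd v f z"
proof -
  from assms have "\<forall>v\<in>Basis. \<exists>g. Ck k U X g \<and> (\<forall>z\<in>U. g z = pd v f z)" by simp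
  then obtain g where "\<forall>v\<in>Basis. Ck k U X (g v) \<and> (\<forall>z\<in>U. g v z = pd v f z)"
    using bchoice by (metis (no_types, lifting))
  then show ?thesis using assms by (intro that[of g]) auto
qed

lemma Ck_add: "Ck k U X f \<Longrightarrow> Ck k U X g \<Longrightarrow> Ck k U X (\<lambda>z. f z + g z)"
proof (induction k arbitrary: f g)
  case 0 then show ?case by (auto intro: continuous_intros)
next
  case (Suc k)
  from Suc.prems(1) obtain f' where f: "continuous_on X f" "\<And>z. z \<in> U \<Longrightarrow> f differentiable (at z)"
    "\<And>v. v \<in> Basis \<Longrightarrow> Ck k U X (f' v)" "\<And>v z. v \<in> Basis \<Longrightarrow> z \<in> U \<Longrightarrow> f' v z = pd v f z"
    by (rule Ck_SucE) blast
  from Suc.prems(2) obtain g' where g: "continuous_on X g" "\<And>z. z \<in> U \<Longrightarrow> g differentiable (at z)"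
    "\<And>v. v \<in> Basis \<Longrightarrow> Ck k U X (g' v)" "\<And>v z. v \<in> Basis \<Longrightarrow> z \<in> U \<Longrightarrow> g' v z = pd v g z"
    by (rule Ck_SucE) blast
  show ?case
    by (rule Ck_SucI[where g="\<lambda>v z. f' v z + g' v z"])
      (simp_all add: f g pd_add Suc.IH continuous_on_add)
qed

lemma Ck_bilinear:
  assumes "bounded_bilinear bp"
  shows "Ck k U X f \<Longrightarrow> Ck k U X g \<Longrightarrow> Ck k U X (\<lambda>z. bp (f z) (g z))"
proof (induction k arbitrary: f g)
  case 0 then show ?case using bounded_bilinear.continuous_on[OF assms] by auto
next
  case (Suc k)
  from Suc.prems(1) obtain f' where f: "continuous_on X f" "\<And>z. z \<in> U \<Longrightarrow> f differentiable (at z)"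
    "\<And>v. v \<in> Basis \<Longrightarrow> Ck k U X (f' v)" "\<And>v z. v \<in> Basis \<Longrightarrow> z \<in> U \<Longrightarrow> f' v z = pd v f z"
    by (rule Ck_SucE) blast
  from Suc.prems(2) obtain g' where g: "continuous_on X g" "\<And>z. z \<in> U \<Longrightarrow> g differentiable (at z)"
    "\<And>v. v \<in> Basis \<Longrightarrow> Ck k U X (g' v)" "\<And>v z. v \<in> Basis \<Longrightarrow> z \<in> U \<Longrightarrow> g' v z = pd v g z"
    by (rule Ck_SucE) blast
  show ?case
    by (rule Ck_SucI[where g="\<lambda>v z. bp (f z) (g' v z) + bp (f' v z) (g z)"])
      (simp_all add: f g pd_bilinear[OF assms] Suc.IH Ck_add Ck_SucD[OF Suc.prems(1)]
        Ck_SucD[OF Suc.prems(2)] bounded_bilinear.continuous_on[OF assms])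
qed

lemma Ck_const: "Ck k U X (\<lambda>z. c)"
proof (induction k arbitrary: c)
  case (Suc k)
  show ?case by (rule Ck_SucI[where g="\<lambda>v z. 0"]) (simp_all add: Suc.IH)
qed simp

lemma Ck_prod: "(\<And>i. i \<in> I \<Longrightarrow> Ck k U X (f i)) \<Longrightarrow> Ck k U X (\<lambda>z. \<Prod>i\<in>I. f i z :: real)"
  by (induction I rule: infinite_finite_induct)
    (simp_all add: Ck_const Ck_bilinear[OF bounded_bilinear_mult])

lemma Ck_affine:
  fixes D :: "nat \<Rightarrow> real \<Rightarrow> real"
  assumes "\<And>n x. (D n has_field_derivative D (Suc n) x) (at x)"
  shows "Ck k U X (\<lambda>z::'a::euclidean_space. D n (c + z \<bullet> w))"
proof -
  have d: "((\<lambda>z::'a. D n (c + z \<bullet> w)) has_derivative (\<lambda>v. D (Suc n) (c + z \<bullet> w) * (v \<bullet> w))) (at z)" for z n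
  proof -
    have 1: "((\<lambda>z. c + z \<bullet> w) has_derivative (\<lambda>v. v \<bullet> w)) (at z)"
      by (auto intro!: derivative_eq_intros)
    have 2: "(D n has_derivative (*) (D (Suc n) (c + z \<bullet> w))) (at (c + z \<bullet> w))"
      using assms[of n "c + z \<bullet> w"] by (simp add: has_field_derivative_def)
    show ?thesis using has_derivative_compose[OF 1 2] .
  qed
  have c: "continuous_on X (\<lambda>z::'a. D n (c + z \<bullet> w))" for n
    using has_derivative_continuous[OF d] by (simp add: continuous_at_imp_continuous_on)
  show ?thesis
  proof (induction k arbitrary: n)
    case 0 show ?case using c by simp
  next
    case (Suc k)
    show ?case
      by (rule Ck_SucI[where g="\<lambda>v z. D (Suc n) (c + z \<bullet> w) * (v \<bullet> w)"])
        (simp_all only: c differentiableI[OF d] pd_eqI[OF d] Ck_const Suc.IH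
          Ck_bilinear[OF bounded_bilinear_mult])
  qed
qed


section \<open>Integrating derivatives of compactly supported functions\<close>

lemma lebesgue_on_eq_lborel:
  fixes f :: "'a::euclidean_space \<Rightarrow> 'b::euclidean_space"
  assumes "U \<in> sets borel" "(\<lambda>x. indicator U x *\<^sub>R f x) \<in> borel_measurable borel"
  shows "(LINT x|lebesgue_on U. f x) = (LINT x|lborel. indicator U x *\<^sub>R f x)"
    and "integrable (lebesgue_on U) f \<longleftrightarrow> integrable lborel (\<lambda>x. indicator U x *\<^sub>R f x)"
  using assms by (simp_all add: integral_restrict_space integrable_restrict_space integral_completion
      integrable_completion)

lemma integral_lborel_translation:
  fixes f :: "'a::euclidean_space \<Rightarrow> real"
  assumes [measurable]: "f \<in> borel_measurable borel" and f: "integrable lborel f"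
  shows "integrable lborel (\<lambda>z. f (z + c))" "(LINT z|lborel. f (z + c)) = (LINT z|lborel. f z)"
proof -
  have "integrable (distr lborel borel ((+) c)) f" using f by (simp add: lborel_distr_plus)
  then show "integrable lborel (\<lambda>z. f (z + c))"
    by (subst (asm) integrable_distr_eq) (simp_all add: add.commute)
  have "(LINT z|distr lborel borel ((+) c). f z) = (LINT z|lborel. f (c + z))"
    by (rule integral_distr) simp_all
  then show "(LINT z|lborel. f (z + c)) = (LINT z|lborel. f z)"
    by (simp add: lborel_distr_plus add.commute)
qed

text \<open>By translation invariance the difference quotients of \<open>F\<close> in direction \<open>v\<close> have integral zero, and
  they converge boundedly to the derivative.\<close>

lemma integral_pd_compact_support:
  fixes F :: "'a::euclidean_space \<Rightarrow> real"
  assumes U: "open U" and K: "compact K" "K \<subseteq> U" and zero: "\<And>z. z \<in> U - K \<Longrightarrow> F z = 0"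
    and diff: "\<And>z. z \<in> U \<Longrightarrow> F differentiable (at z)" and cont: "continuous_on U (pd v F)"
  shows "(LINT z|lebesgue_on U. pd v F z) = 0"
proof -
  define F0 where "F0 z = (if z \<in> U then F z else 0)" for z
  define D where "D = pd v F0"
  have oK: "open (- K)" using K(1) compact_imp_closed by blast
  have zK: "F0 z = 0" if "z \<in> - K" for z using zero that unfolding F0_def by simp
  have DU: "D z = pd v F z" if "z \<in> U" for z
    unfolding D_def by (rule pd_cong[OF U that]) (simp add: F0_def)
  have DK: "D z = 0" if "z \<in> - K" for z
    unfolding D_def using pd_cong[OF oK that, of F0 "\<lambda>_. 0" v] zK by simp
  have dF0: "F0 differentiable (at z)" for z
  proof (cases "z \<in> U")
    case True
    show ?thesis by (rule differentiable_cong_open[OF U True _ diff[OF True]]) (simp add: F0_def)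
  next
    case False
    then have "z \<in> - K" using K(2) by blast
    then show ?thesis by (rule differentiable_cong_open[OF oK, of _ _ "\<lambda>_. 0"]) (simp_all add: zK)
  qed
  have cF0: "continuous_on UNIV F0"
    using dF0 by (simp add: continuous_at_imp_continuous_on differentiable_imp_continuous_within)
  have "continuous_on (U \<union> - K) D"
  proof (rule continuous_on_open_Un[OF U oK])
    show "continuous_on U D" using cont DU by (simp cong: continuous_on_cong)
    show "continuous_on (- K) D"
      using continuous_on_cong[of "- K" "- K" D "\<lambda>_. 0"] DK by simp
  qed
  moreover have "U \<union> - K = UNIV" using K(2) by blast
  ultimately have cD: "continuous_on UNIV D" by simp
  have mF0[measurable]: "F0 \<in> borel_measurable borel" and mD[measurable]: "D \<in> borel_measurable borel"
    using cF0 cD by (auto intro: borel_measurable_continuous_onI)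
  have int: "integrable lborel F0"
  proof -
    have "integrable lborel (\<lambda>x. indicator K x *\<^sub>R F0 x)"
      by (rule borel_integrable_compact[OF K(1)]) (rule continuous_on_subset[OF cF0], simp)
    moreover have "(\<lambda>x. indicator K x *\<^sub>R F0 x) = F0" using zK by (auto simp: indicator_def fun_eq_iff)
    ultimately show ?thesis by simp
  qed
  obtain B where B: "\<And>z. \<bar>D z\<bar> \<le> B"
  proof -
    have "bounded (D ` K)"
      by (intro compact_imp_bounded compact_continuous_image continuous_on_subset[OF cD] K) simp
    then obtain B where B: "\<And>z. z \<in> K \<Longrightarrow> \<bar>D z\<bar> \<le> B" unfolding bounded_iff by auto
    have "\<bar>D z\<bar> \<le> max B 0" for z using B[of z] DK[of z] by (cases "z \<in> K") auto
    then show ?thesis by (rule that)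
  qed
  obtain R where R: "\<And>z. z \<in> K \<Longrightarrow> norm z \<le> R"
    using compact_imp_bounded[OF K(1)] unfolding bounded_iff by auto
  define h where "h n = 1 / real (Suc n)" for n
  have h: "0 < h n" "h n \<le> 1" for n unfolding h_def by auto
  define q where "q n z = (F0 (z + h n *\<^sub>R v) - F0 z) / h n" for n z
  have der: "((\<lambda>s. F0 (z + s *\<^sub>R v)) has_field_derivative D (z + s *\<^sub>R v)) (at s)" for z s
  proof -
    have 1: "((\<lambda>s. z + s *\<^sub>R v) has_derivative (\<lambda>r. r *\<^sub>R v)) (at s)"
      by (auto intro!: derivative_eq_intros)
    note 2 = has_derivative_compose[OF 1 pd_has_derivative[OF dF0]]
    interpret bounded_linear "\<lambda>w. pd w F0 (z + s *\<^sub>R v)"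
      using has_derivative_bounded_linear[OF pd_has_derivative[OF dF0]] .
    show ?thesis using 2 unfolding has_field_derivative_def D_def by (simp add: scaleR mult_commute_abs)
  qed
  have int_q: "(LINT z|lborel. q n z) = 0" for n
    unfolding q_def using integral_lborel_translation[OF mF0 int, of "h n *\<^sub>R v"] int by simp
  have h_eq: "h = (\<lambda>n. inverse (real (Suc n)))" unfolding h_def by (auto simp: inverse_eq_divide)
  have lim_h: "filterlim h (at 0) sequentially"
    unfolding filterlim_at using h(1) LIMSEQ_inverse_real_of_nat less_imp_neq
    by (fastforce simp: h_eq intro!: always_eventually)
  have "(\<lambda>n. LINT z|lborel. q n z) \<longlonglongrightarrow> (LINT z|lborel. D z)"
  proof (rule integral_dominated_convergence[where w="\<lambda>z. B * indicator (cball 0 (R + norm v)) z"])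
    show "q n \<in> borel_measurable lborel" for n unfolding q_def by measurable
    show "integrable lborel (\<lambda>z. B * indicator (cball 0 (R + norm v)) z)"
      by (intro integrable_mult_right) (auto intro!: integrable_real_indicator emeasure_bounded_finite)
    show "AE z in lborel. (\<lambda>n. q n z) \<longlonglongrightarrow> D z"
    proof (rule AE_I2)
      fix z
      have "((\<lambda>s. (F0 (z + s *\<^sub>R v) - F0 z) / s) \<longlongrightarrow> D z) (at 0)"
        using der[of z 0] unfolding DERIV_def by simp
      from filterlim_compose[OF this lim_h] show "(\<lambda>n. q n z) \<longlonglongrightarrow> D z" unfolding q_def .
    qed
    show "AE z in lborel. norm (q n z) \<le> B * indicator (cball 0 (R + norm v)) z" for n
    proof (rule AE_I2)
      fix z
      show "norm (q n z) \<le> B * indicator (cball 0 (R + norm v)) z"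
      proof (cases "z \<in> cball 0 (R + norm v)")
        case True
        have "\<exists>s>0. s < h n \<and> F0 (z + h n *\<^sub>R v) - F0 (z + 0 *\<^sub>R v) = (h n - 0) * D (z + s *\<^sub>R v)"
          by (rule MVT2[OF h(1)]) (rule der)
        then obtain s where "F0 (z + h n *\<^sub>R v) - F0 z = h n * D (z + s *\<^sub>R v)" by auto
        then have "q n z = D (z + s *\<^sub>R v)" unfolding q_def using h(1)[of n] by simp
        then show ?thesis using B True by simp
      next
        case False
        then have *: "R + norm v < norm z" by simp
        have "norm (h n *\<^sub>R v) \<le> norm v" using h[of n] by (simp add: mult_left_le_one_le)
        then have "R < norm (z + h n *\<^sub>R v)" using * norm_triangle_ineq4[of "z + h n *\<^sub>R v" "h n *\<^sub>R v"] by simp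
        moreover have "R < norm z" using * norm_ge_zero[of v] by linarith
        ultimately have "z \<notin> K" "z + h n *\<^sub>R v \<notin> K" using R by fastforce+
        then show ?thesis using zK False by (simp add: q_def)
      qed
    qed
  qed simp
  then have "(LINT z|lborel. D z) = 0" using int_q LIMSEQ_unique[of "\<lambda>_. 0::real"] by auto
  moreover have eq: "(\<lambda>z. indicator U z *\<^sub>R pd v F z) = D"
    using DU DK K(2) by (auto simp: indicator_def fun_eq_iff)
  ultimately show ?thesis using U by (subst lebesgue_on_eq_lborel) (simp_all add: eq)
qed

section \<open>Smooth bumps and the fundamental lemma\<close>

text \<open>The derivatives of \<open>exp (-1/x)\<close>, extended by \<open>0\<close> to \<open>x \<le> 0\<close>, have the form
  \<open>P (1/x) exp (-1/x)\<close> with polynomials \<open>P\<close> that obey the recursion below.\<close>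

primrec flat_poly :: "nat \<Rightarrow> real poly" where
  "flat_poly 0 = 1"
| "flat_poly (Suc n) = [:0, 0, 1:] * (flat_poly n - pderiv (flat_poly n))"

definition flat_exp :: "nat \<Rightarrow> real \<Rightarrow> real" where
  "flat_exp n x = (if 0 < x then poly (flat_poly n) (1 / x) * exp (- (1 / x)) else 0)"

lemma tendsto_poly_div_exp: "((\<lambda>x. poly p x / exp x) \<longlongrightarrow> (0::real)) at_top"
proof -
  have "((\<lambda>x. \<Sum>i\<le>degree p. coeff p i * (x ^ i / exp x)) \<longlongrightarrow> (\<Sum>i\<le>degree p. coeff p i * 0)) at_top"
    by (intro tendsto_sum tendsto_mult tendsto_const tendsto_power_div_exp_0)
  then show ?thesis by (simp add: poly_altdef sum_divide_distrib)
qed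

text \<open>Only \<open>x = 0\<close> needs an argument: there the exponential beats every power of \<open>1/x\<close>.\<close>

lemma flat_deriv: "(flat_exp n has_field_derivative flat_exp (Suc n) x) (at x)"
proof -
  consider "x < 0" | "x = 0" | "0 < x" by linarith
  then show ?thesis
  proof cases
    case 1
    show ?thesis
      by (rule has_field_derivative_transform_within_open[of "\<lambda>_. 0" _ _ "{..<0}"])
        (use 1 in \<open>auto simp: flat_exp_def\<close>)
  next
    case 3
    have "((\<lambda>x. poly (flat_poly n) (1 / x) * exp (- (1 / x))) has_field_derivative flat_exp (Suc n) x) (at x)"
      using 3
      by (auto intro!: derivative_eq_intros simp: flat_exp_def power2_eq_square field_simps)
    then show ?thesis
      by (rule has_field_derivative_transform_within_open[of _ _ _ "{0<..}"])
        (use 3 in \<open>auto simp: flat_exp_def\<close>)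
  next
    case 2
    have "((\<lambda>h. flat_exp n h / h) \<longlongrightarrow> 0) (at_left 0)"
      by (rule tendsto_eventually) (auto simp: flat_exp_def eventually_at_left_field intro!: exI[of _ "-1"])
    moreover have "((\<lambda>h. flat_exp n h / h) \<longlongrightarrow> 0) (at_right 0)"
    proof -
      have "((\<lambda>h. poly (pCons 0 (flat_poly n)) (inverse h) / exp (inverse h)) \<longlongrightarrow> 0) (at_right 0)"
        using filterlim_compose[OF tendsto_poly_div_exp filterlim_inverse_at_top_right] .
      moreover have "eventually (\<lambda>h. poly (pCons 0 (flat_poly n)) (inverse h) / exp (inverse h) = flat_exp n h / h) (at_right 0)"
        unfolding eventually_at_right_field
        by (intro exI[of _ 1]) (auto simp: flat_exp_def exp_minus field_simps inverse_eq_divide)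
      ultimately show ?thesis by (rule Lim_transform_eventually)
    qed
    ultimately have "((\<lambda>h. flat_exp n h / h) \<longlongrightarrow> 0) (at 0)" by (simp add: filterlim_at_split)
    then show ?thesis unfolding DERIV_def 2 by (simp add: flat_exp_def)
  qed
qed

text \<open>Multiplying the argument by \<open>n + 1\<close> replaces \<open>exp (-1/y)\<close> by one of its roots, which increase to \<open>1\<close>
  for \<open>y > 0\<close>, while the value for \<open>y \<le> 0\<close> stays \<open>0\<close>.  Hence the bumps tend to the indicator of the box,
  and all have their support in the same closed box.\<close>

definition bump :: "'a::euclidean_space \<Rightarrow> 'a \<Rightarrow> nat \<Rightarrow> 'a \<Rightarrow> real" where
  "bump l r n z = (\<Prod>b\<in>Basis. flat_exp 0 (real (Suc n) * ((z - l) \<bullet> b)) * flat_exp 0 (real (Suc n) * ((r - z) \<bullet> b)))"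

lemma flat_exp0: "0 \<le> flat_exp 0 x" "flat_exp 0 x \<le> 1" "x \<le> 0 \<Longrightarrow> flat_exp 0 x = 0"
  by (auto simp: flat_exp_def)

lemma bump_bounds: "0 \<le> bump l r n z" "bump l r n z \<le> 1"
  unfolding bump_def by (auto intro!: prod_nonneg prod_le_1 mult_nonneg_nonneg mult_le_one flat_exp0)

lemma bump_eq_0: "z \<notin> box l r \<Longrightarrow> bump l r n z = 0"
proof -
  assume "z \<notin> box l r"
  then obtain b where b: "b \<in> Basis" "z \<bullet> b \<le> l \<bullet> b \<or> r \<bullet> b \<le> z \<bullet> b"
    unfolding mem_box by (meson not_less)
  then have "flat_exp 0 (real (Suc n) * ((z - l) \<bullet> b)) * flat_exp 0 (real (Suc n) * ((r - z) \<bullet> b)) = 0"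
    by (auto simp: inner_diff_left simp del: of_nat_Suc intro!: flat_exp0(3) mult_nonneg_nonpos)
  then show ?thesis unfolding bump_def using b(1) by (intro prod_zero) auto
qed

lemma bump_tendsto: "(\<lambda>n. bump l r n (z::'a::euclidean_space)) \<longlonglongrightarrow> indicator (box l r) z"
proof (cases "z \<in> box l r")
  case True
  have lim: "(\<lambda>n. flat_exp 0 (real (Suc n) * y)) \<longlonglongrightarrow> 1" if "0 < y" for y
  proof -
    have "(\<lambda>n. exp (- (1 / y * inverse (real (Suc n))))) \<longlonglongrightarrow> exp (- (1 / y * 0))"
      by (intro tendsto_intros LIMSEQ_inverse_real_of_nat)
    moreover have "exp (- (1 / y * inverse (real (Suc n)))) = flat_exp 0 (real (Suc n) * y)" for n
      using that mult_pos_pos[OF that, of "real (Suc n)"]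
      by (simp add: flat_exp_def inverse_eq_divide mult.commute del: of_nat_Suc)
    ultimately show ?thesis by (simp del: of_nat_Suc)
  qed
  have "(\<lambda>n. bump l r n z) \<longlonglongrightarrow> (\<Prod>b\<in>(Basis::'a set). 1 * 1)"
    unfolding bump_def
    by (intro tendsto_prod tendsto_mult lim) (use True in \<open>auto simp: mem_box inner_diff_left\<close>)
  then show ?thesis using True by simp
next
  case False
  then show ?thesis by (simp add: bump_eq_0)
qed

lemma bump_Ck: "Ck k U X (bump l r n)"
proof -
  have a: "Ck k U X (\<lambda>z. flat_exp 0 (real (Suc n) * ((z - l) \<bullet> b)))" for b
    using Ck_affine[where D=flat_exp and n=0 and c="- (real (Suc n) * (l \<bullet> b))" and w="real (Suc n) *\<^sub>R b", OF flat_deriv]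
    by (simp add: inner_diff_left algebra_simps)
  have b: "Ck k U X (\<lambda>z. flat_exp 0 (real (Suc n) * ((r - z) \<bullet> b)))" for b
    using Ck_affine[where D=flat_exp and n=0 and c="real (Suc n) * (r \<bullet> b)" and w="- (real (Suc n) *\<^sub>R b)", OF flat_deriv]
    by (simp add: inner_diff_left algebra_simps)
  show ?thesis unfolding bump_def by (intro Ck_prod Ck_bilinear[OF bounded_bilinear_mult] a b)
qed

lemma bump_continuous: "continuous_on X (bump l r n)"
  using Ck_continuous[OF bump_Ck] .

lemma bump_compact_support: "compact (cbox l r \<inter> X) \<Longrightarrow> compact_support_in X (bump l r n)"
  unfolding compact_support_in_def
  by (rule exI[of _ "cbox l r \<inter> X"]) (use bump_eq_0 box_subset_cbox in blast)

lemma bump_test_function: "cbox l r \<subseteq> U \<Longrightarrow> (\<lambda>z. bump l r n z *\<^sub>R c) \<in> test_functions U"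
  unfolding test_functions_def smooth_upto_def compact_support_in_def
  by (auto intro!: exI[of _ "cbox l r"] Ck_bilinear[OF bounded_bilinear_scaleR] bump_Ck Ck_const)
    (use bump_eq_0 box_subset_cbox in blast)

lemma measure_eqI_boxes:
  fixes M N :: "'a::euclidean_space measure"
  assumes S: "sets M = sets borel" "sets N = sets borel"
    and eq: "\<And>l r. emeasure M (box l r) = emeasure N (box l r)" and fin: "\<And>l r. emeasure M (box l r) \<noteq> \<infinity>"
  shows "M = N"
proof (rule measure_eqI_generator_eq)
  let ?E = "range (\<lambda>(a, b). box a b::'a set)"
  show "Int_stable ?E" by (auto simp: Int_stable_def box_Int_box)
  show "?E \<subseteq> Pow UNIV" "sets M = sigma_sets UNIV ?E" "sets N = sigma_sets UNIV ?E"
    by (simp_all add: borel_eq_box S)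
  let ?A = "\<lambda>n::nat. box (- (real n *\<^sub>R One)) (real n *\<^sub>R One) :: 'a set"
  show "range ?A \<subseteq> ?E" "(\<Union>i. ?A i) = UNIV" unfolding UN_box_eq_UNIV by auto
  show "emeasure M (?A i) \<noteq> \<infinity>" for i by (rule fin)
  show "emeasure M Y = emeasure N Y" if "Y \<in> ?E" for Y using that eq by auto
qed

text \<open>The positive and the negative part of \<open>f\<close> are densities of two measures that agree on boxes.\<close>

lemma AE_zero_if_box_integrals_zero:
  fixes f :: "'a::euclidean_space \<Rightarrow> real"
  assumes f: "integrable lborel f" and zero: "\<And>l r. (LINT x|lborel. indicator (box l r) x * f x) = 0"
  shows "AE x in lborel. f x = 0"
proof -
  have [measurable]: "f \<in> borel_measurable borel" using f by auto
  define M where "M = density lborel (\<lambda>x. ennreal (f x))"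
  define N where "N = density lborel (\<lambda>x. ennreal (- f x))"
  have eq: "emeasure M (box l r) = emeasure N (box l r) \<and> emeasure M (box l r) \<noteq> \<infinity>" for l r
  proof -
    have i: "integrable lborel (\<lambda>x. indicator (box l r) x * f x)"
      using integrable_mult_indicator[OF _ f, of "box l r"] by simp
    have 1: "emeasure M (box l r) = (\<integral>\<^sup>+x. ennreal (indicator (box l r) x * f x) \<partial>lborel)"
      unfolding M_def by (subst emeasure_density) (auto intro!: nn_integral_cong split: split_indicator)
    have 2: "emeasure N (box l r) = (\<integral>\<^sup>+x. ennreal (- (indicator (box l r) x * f x)) \<partial>lborel)"
      unfolding N_def by (subst emeasure_density) (auto intro!: nn_integral_cong split: split_indicator)
    have fin: "emeasure M (box l r) \<noteq> \<infinity>" "emeasure N (box l r) \<noteq> \<infinity>"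
      using i unfolding 1 2 real_integrable_def by auto
    have "enn2real (emeasure M (box l r)) = enn2real (emeasure N (box l r))"
      using real_lebesgue_integral_def[OF i] zero[of l r] unfolding 1 2 by simp
    then have "emeasure M (box l r) = emeasure N (box l r)"
      using fin by (metis ennreal_enn2real infinity_ennreal_def top.not_eq_extremum)
    then show ?thesis using fin by simp
  qed
  have "M = N"
  proof (rule measure_eqI_boxes)
    show "emeasure M (box l r) = emeasure N (box l r)" "emeasure M (box l r) \<noteq> \<infinity>" for l r
      using eq by blast+
  qed (simp_all add: M_def N_def)
  then have "AE x in lborel. ennreal (f x) = ennreal (- f x)"
    unfolding M_def N_def by (intro sigma_finite_measure.density_unique lborel.sigma_finite_measure_axioms) auto
  then show ?thesis
    by eventually_elim (metis ennreal_eq_0_iff ennreal_neg linorder_le_cases neg_le_0_iff_le order_antisym)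
qed

text \<open>The bumps over a box inside \<open>U\<close> converge to its indicator, so \<open>f\<close> integrates to zero over every such
  box.  For the conclusion \<open>f\<close> is cut off to one box at a time, countably many of which cover \<open>U\<close>.\<close>

lemma fundamental_lemma:
  fixes f :: "'a::euclidean_space \<Rightarrow> real"
  assumes U: "open U" and f: "\<And>l r. cbox l r \<subseteq> U \<Longrightarrow> integrable (lebesgue_on (cbox l r)) f"
    and zero: "\<And>l r n. cbox l r \<subseteq> U \<Longrightarrow> (LINT x|lebesgue_on U. bump l r n x * f x) = 0"
  shows "AE x in lebesgue_on U. f x = 0"
proof -
  obtain \<D> where \<D>: "countable \<D>" "\<D> \<subseteq> Pow U" "\<And>X. X \<in> \<D> \<Longrightarrow> \<exists>a b. X = cbox a b" "\<Union>\<D> = U"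
    using open_countable_Union_open_cbox[OF U] by blast
  have "AE x in lebesgue. x \<in> C \<longrightarrow> f x = 0" if C: "C \<in> \<D>" for C
  proof -
    obtain a b where ab: "C = cbox a b" using \<D>(3)[OF C] by blast
    have CU: "cbox a b \<subseteq> U" using \<D>(2) C ab by blast
    define F where "F x = indicator (cbox a b) x * f x" for x
    have F: "integrable lebesgue F"
      using f[OF CU] unfolding F_def by (simp add: integrable_restrict_space)
    have box0: "(LINT x|lebesgue. indicator (box l r) x * F x) = 0" for l r
    proof -
      obtain l' r' where lr: "box l r \<inter> box a b = box l' r'" using box_Int_box by blast
      have sub: "cbox l' r' \<subseteq> cbox a b" if "box l' r' \<noteq> {}"
        using that lr by (metis Int_lower2 closure_box closure_cbox closure_mono box_eq_empty inf_le2
            closure_closed closed_cbox box_subset_cbox order_trans)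
      have z: "(LINT x|lebesgue. bump l' r' n x * F x) = 0" for n
      proof (cases "box l' r' = {}")
        case True
        then show ?thesis by (simp add: bump_eq_0)
      next
        case False
        have "(LINT x|lebesgue_on U. bump l' r' n x * f x) = 0"
          using zero sub[OF False] CU by blast
        then have "(LINT x|lebesgue. indicator U x *\<^sub>R (bump l' r' n x * f x)) = 0"
          using U by (simp add: integral_restrict_space)
        moreover have "indicator U x *\<^sub>R (bump l' r' n x * f x) = bump l' r' n x * F x" for x
          using bump_eq_0[of x l' r' n] sub[OF False] CU box_subset_cbox[of l' r']
          by (cases "x \<in> box l' r'") (auto simp: F_def indicator_def)
        ultimately show ?thesis by (simp only:)
      qed
      have "(\<lambda>n. LINT x|lebesgue. bump l' r' n x * F x) \<longlonglongrightarrow> (LINT x|lebesgue. indicator (box l' r') x * F x)"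
      proof (rule integral_dominated_convergence[where w="\<lambda>x. norm (F x)"])
        have "F \<in> borel_measurable lebesgue" using F by auto
        moreover have "(indicator (box l' r') :: 'a \<Rightarrow> real) \<in> borel_measurable lebesgue"
          by (intro measurable_completion) simp
        moreover have "bump l' r' n \<in> borel_measurable lebesgue" for n
          using borel_measurable_continuous_onI[OF bump_continuous] by (intro measurable_completion) simp
        ultimately show "(\<lambda>x. bump l' r' n x * F x) \<in> borel_measurable lebesgue"
          "(\<lambda>x. indicator (box l' r') x * F x) \<in> borel_measurable lebesgue" for n by auto
        show "integrable lebesgue (\<lambda>x. norm (F x))" using F by auto
        show "AE x in lebesgue. (\<lambda>n. bump l' r' n x * F x) \<longlonglongrightarrow> indicator (box l' r') x * F x"
          by (intro AE_I2 tendsto_mult bump_tendsto tendsto_const)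
        show "AE x in lebesgue. norm (bump l' r' n x * F x) \<le> norm (F x)" for n
          by (rule AE_I2) (simp add: abs_mult bump_bounds mult_left_le_one_le)
      qed
      then have "(LINT x|lebesgue. indicator (box l' r') x * F x) = 0"
        unfolding z using LIMSEQ_unique tendsto_const by metis
      moreover have "AE x in lebesgue. indicator (box l' r') x * F x = indicator (box l r) x * F x"
      proof -
        have "AE x in lebesgue. x \<notin> cbox a b - box a b"
          by (rule AE_not_in) (use negligible_frontier_interval negligible_iff_null_sets in blast)
        then show ?thesis by eventually_elim (auto simp: F_def lr[symmetric] indicator_def)
      qed
      moreover have "(\<lambda>x. indicator (box c d) x * F x) \<in> borel_measurable lebesgue" for c d
        using borel_measurable_integrable[OF integrable_mult_indicator[OF _ F, of "box c d"]] by simp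
      ultimately show ?thesis
        using integral_cong_AE[of "\<lambda>x. indicator (box l' r') x * F x" lebesgue "\<lambda>x. indicator (box l r) x * F x"]
        by simp
    qed
    have mi: "(\<lambda>x. indicator (box l r) x * k x) \<in> borel_measurable lebesgue"
      if "k \<in> borel_measurable lebesgue" for l r :: 'a and k :: "'a \<Rightarrow> real"
    proof -
      have "(indicator (box l r) :: 'a \<Rightarrow> real) \<in> borel_measurable lebesgue"
        by (intro measurable_completion) simp
      then show ?thesis using that by (rule borel_measurable_times)
    qed
    obtain g where g: "g \<in> borel_measurable lborel" "AE x in lborel. F x = g x"
      using completion_ex_borel_measurable_real[of F lborel] F by auto
    have ae: "AE x in lebesgue. F x = g x" using AE_completion[OF g(2)] .
    have mg: "g \<in> borel_measurable lebesgue" using g(1) by (rule measurable_completion)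
    have "AE x in lborel. g x = 0"
    proof (rule AE_zero_if_box_integrals_zero)
      have "integrable lebesgue g" by (rule integrable_cong_AE_imp[OF F mg]) (use ae in \<open>simp add: eq_commute\<close>)
      then show "integrable lborel g" using g(1) integrable_completion by blast
      fix l r :: 'a
      have "(LINT x|lborel. indicator (box l r) x * g x) = (LINT x|lebesgue. indicator (box l r) x * g x)"
        using g(1) by (subst integral_completion) auto
      also have "\<dots> = (LINT x|lebesgue. indicator (box l r) x * F x)"
        by (rule integral_cong_AE[OF mi[OF mg] mi[OF borel_measurable_integrable[OF F]]]) (use ae in auto)
      finally show "(LINT x|lborel. indicator (box l r) x * g x) = 0" using box0 by simp
    qed
    then have "AE x in lebesgue. g x = 0" by (rule AE_completion)
    with ae show ?thesis by eventually_elim (simp add: F_def ab indicator_def split: if_splits)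
  qed
  then have "AE x in lebesgue. \<forall>C\<in>\<D>. x \<in> C \<longrightarrow> f x = 0" unfolding AE_ball_countable[OF \<D>(1)] by blast
  then show ?thesis using U \<D>(4) by (subst AE_restrict_space_iff) (auto elim!: eventually_mono)
qed


section \<open>Integrability and convergence tools\<close>

lemma borel_measurable_indicator_continuous:
  fixes f :: "'a::euclidean_space \<Rightarrow> 'b::euclidean_space"
  assumes "open U" "continuous_on U f"
  shows "(\<lambda>z. indicator U z *\<^sub>R f z) \<in> borel_measurable borel"
  using borel_measurable_continuous_on_indicator[of U f] assms by simp

lemma continuous_on_measurable_lebesgue_on:
  fixes f :: "'a::euclidean_space \<Rightarrow> 'b::euclidean_space"
  assumes "open U" "continuous_on U f"
  shows "f \<in> borel_measurable (lebesgue_on U)"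
  using assms by (intro continuous_imp_measurable_on_sets_lebesgue) auto

lemma integrable_cont_ext:
  fixes f :: "'a::euclidean_space \<Rightarrow> 'b::euclidean_space"
  assumes U: "open U" "U \<subseteq> X" and f: "cont_ext U X f" and K: "compact K" "K \<subseteq> X"
    and zero: "\<And>z. z \<in> U - K \<Longrightarrow> f z = 0"
  shows "integrable (lebesgue_on U) f"
proof -
  obtain B where B: "0 \<le> B" "\<And>z. z \<in> U \<Longrightarrow> z \<in> K \<Longrightarrow> norm (f z) \<le> B"
    using cont_ext_bounded[OF f K] by blast
  have m: "(\<lambda>z. indicator U z *\<^sub>R f z) \<in> borel_measurable borel"
    by (rule borel_measurable_indicator_continuous[OF U(1) cont_ext_continuous_on[OF f U(2)]])
  have "integrable lborel (\<lambda>z. B * indicator K z :: real)"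
    using K(1) by (intro integrable_mult_right integrable_real_indicator)
      (use emeasure_bounded_finite[OF compact_imp_bounded[OF K(1)]] in \<open>simp_all add: borel_compact\<close>)
  then have "integrable lborel (\<lambda>z. indicator U z *\<^sub>R f z)"
    by (rule Bochner_Integration.integrable_bound)
      (use m B zero in \<open>auto simp: indicator_def\<close>)
  then show ?thesis using lebesgue_on_eq_lborel(2)[OF _ m] U(1) by simp
qed

lemma finite_measure_bounded_open:
  fixes U :: "'a::euclidean_space set"
  assumes "open U" "bounded U"
  shows "finite_measure (lebesgue_on U)"
  using lmeasurable_open[OF assms(2,1)] by (rule finite_measure_lebesgue_on)

text \<open>Integrated over a finite measure space, this bounds the \<open>L\<^sup>1\<close> norm by an arbitrarily small number plus
  a multiple of the \<open>q\<close>-th moment.\<close>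

lemma le_add_powr:
  fixes s q e :: real
  assumes "1 \<le> q" "0 < e" "0 \<le> s"
  shows "s \<le> e + e powr (1 - q) * s powr q"
proof (cases "s \<le> e")
  case True
  then show ?thesis by (intro add_increasing2) auto
next
  case False
  then have s: "e < s" "0 < s" using assms by auto
  have "s = e powr (1 - q) * (e powr (q - 1) * s)"
    using assms by (simp add: powr_add[symmetric] mult.assoc[symmetric])
  also have "\<dots> \<le> e powr (1 - q) * (s powr (q - 1) * s)"
    using s assms by (intro mult_left_mono mult_right_mono powr_mono2) auto
  also have "s powr (q - 1) * s = s powr q"
    using s by (simp add: powr_diff)
  finally show ?thesis using assms by simp
qed

lemma Lp_integrable:
  assumes "finite_measure (lebesgue_on S)" "f \<in> Lp q S" "1 \<le> q"
  shows "integrable (lebesgue_on S) f"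
proof -
  interpret finite_measure "lebesgue_on S" by fact
  have "integrable (lebesgue_on S) (\<lambda>x. 1 + norm (f x) powr q)"
    using assms(2) unfolding Lp_def by auto
  then show ?thesis
    by (rule Bochner_Integration.integrable_bound)
      (use assms(2) le_add_powr[OF assms(3), of 1] in \<open>auto simp: Lp_def\<close>)
qed

lemma Lp_diff:
  assumes "f \<in> Lp q S" "g \<in> Lp q S" "0 \<le> q"
  shows "(\<lambda>x. f x - g x) \<in> Lp q S"
proof -
  have m[measurable]: "f \<in> borel_measurable (lebesgue_on S)" "g \<in> borel_measurable (lebesgue_on S)"
    using assms unfolding Lp_def by auto
  have "integrable (lebesgue_on S) (\<lambda>x. 2 powr q * (norm (f x) powr q + norm (g x) powr q))"
    using assms unfolding Lp_def by auto
  then have "integrable (lebesgue_on S) (\<lambda>x. norm (f x - g x) powr q)"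
  proof (rule Bochner_Integration.integrable_bound)
    have "norm (f x - g x) powr q \<le> 2 powr q * (norm (f x) powr q + norm (g x) powr q)" for x
    proof -
      have "norm (f x - g x) powr q \<le> (2 * max (norm (f x)) (norm (g x))) powr q"
        using norm_triangle_ineq4[of "f x" "g x"] assms(3) by (intro powr_mono2) auto
      also have "\<dots> = 2 powr q * max (norm (f x)) (norm (g x)) powr q" by (simp add: powr_mult)
      also have "\<dots> \<le> 2 powr q * (norm (f x) powr q + norm (g x) powr q)"
        by (intro mult_left_mono) (auto simp: max_def)
      finally show ?thesis .
    qed
    then show "AE x in lebesgue_on S. norm (norm (f x - g x) powr q)
        \<le> norm (2 powr q * (norm (f x) powr q + norm (g x) powr q))"
      by (intro AE_I2) (simp add: abs_le_iff order_trans[OF _ abs_ge_self])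
  qed measurable
  then show ?thesis unfolding Lp_def by simp
qed

lemma tendsto_Lp_L1:
  assumes S: "finite_measure (lebesgue_on S)" and f: "tendsto_Lp q S f g F" and q: "1 \<le> q"
  shows "((\<lambda>i. LINT x|lebesgue_on S. norm (f i x - g x)) \<longlongrightarrow> 0) F"
proof (rule tendstoI)
  interpret finite_measure "lebesgue_on S" by fact
  fix e :: real assume "0 < e"
  define m where "m = measure (lebesgue_on S) (space (lebesgue_on S))"
  have "0 \<le> m" unfolding m_def by simp
  define d where "d = e / (2 * (m + 1))"
  have d: "0 < d" "d * m < e / 2" using \<open>0 < e\<close> \<open>0 \<le> m\<close> unfolding d_def by (auto simp: field_simps)
  have "((\<lambda>i. d powr (1 - q) * (LINT x|lebesgue_on S. norm (f i x - g x) powr q)) \<longlongrightarrow> d powr (1 - q) * 0) F"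
    using f unfolding tendsto_Lp_def by (intro tendsto_mult tendsto_const) blast
  then have "eventually (\<lambda>i. d powr (1 - q) * (LINT x|lebesgue_on S. norm (f i x - g x) powr q) < e / 2) F"
    using \<open>0 < e\<close> by (intro order_tendstoD) auto
  moreover have "eventually (\<lambda>i. f i \<in> Lp q S) F" using f unfolding tendsto_Lp_def by auto
  moreover have "eventually (\<lambda>i. g \<in> Lp q S) F" using f unfolding tendsto_Lp_def by auto
  ultimately show "eventually (\<lambda>i. dist (LINT x|lebesgue_on S. norm (f i x - g x)) 0 < e) F"
  proof eventually_elim
    case (elim i)
    have fg: "(\<lambda>x. f i x - g x) \<in> Lp q S" using elim q by (intro Lp_diff) auto
    have "(LINT x|lebesgue_on S. norm (f i x - g x))
        \<le> (LINT x|lebesgue_on S. d + d powr (1 - q) * norm (f i x - g x) powr q)"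
      using Lp_integrable[OF S fg q] fg le_add_powr[OF q d(1)]
      by (intro integral_mono) (auto simp: Lp_def)
    also have "\<dots> = d * m + d powr (1 - q) * (LINT x|lebesgue_on S. norm (f i x - g x) powr q)"
      using fg by (subst Bochner_Integration.integral_add) (auto simp: Lp_def m_def)
    also have "\<dots> < e" using elim d by linarith
    finally show ?case by (simp add: integral_nonneg_AE abs_of_nonneg)
  qed
qed

lemma tendsto_integral_inner_bounded:
  fixes f :: "'i \<Rightarrow> 'x \<Rightarrow> 'b::euclidean_space"
  assumes lim: "((\<lambda>i. LINT x|M. norm (f i x - g x)) \<longlongrightarrow> 0) F"
    and f: "eventually (\<lambda>i. integrable M (f i)) F" and g: "integrable M g"
    and h: "h \<in> borel_measurable M" "\<And>x. x \<in> space M \<Longrightarrow> norm (h x) \<le> B"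
  shows "((\<lambda>i. LINT x|M. f i x \<bullet> h x) \<longlongrightarrow> (LINT x|M. g x \<bullet> h x)) F"
proof -
  have int: "integrable M (\<lambda>x. k x \<bullet> h x)" if "integrable M k" for k
  proof (rule Bochner_Integration.integrable_bound)
    show "integrable M (\<lambda>x. \<bar>B\<bar> * norm (k x))" using that by auto
    show "(\<lambda>x. k x \<bullet> h x) \<in> borel_measurable M" using that h by measurable
    show "AE x in M. norm (k x \<bullet> h x) \<le> norm (\<bar>B\<bar> * norm (k x))"
    proof (rule AE_I2)
      fix x assume "x \<in> space M"
      have "norm (k x \<bullet> h x) \<le> norm (k x) * norm (h x)" using Cauchy_Schwarz_ineq2 by auto
      also have "\<dots> \<le> norm (k x) * \<bar>B\<bar>" using h(2)[OF \<open>x \<in> space M\<close>] by (intro mult_left_mono) auto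
      finally show "norm (k x \<bullet> h x) \<le> norm (\<bar>B\<bar> * norm (k x))" by (simp add: mult.commute)
    qed
  qed
  have "((\<lambda>i. (LINT x|M. f i x \<bullet> h x) - (LINT x|M. g x \<bullet> h x)) \<longlongrightarrow> 0) F"
  proof (rule Lim_null_comparison)
    show "((\<lambda>i. \<bar>B\<bar> * (LINT x|M. norm (f i x - g x))) \<longlongrightarrow> 0) F"
      using tendsto_mult[OF tendsto_const lim] by simp
    show "eventually (\<lambda>i. norm ((LINT x|M. f i x \<bullet> h x) - (LINT x|M. g x \<bullet> h x))
        \<le> \<bar>B\<bar> * (LINT x|M. norm (f i x - g x))) F"
      using f
    proof eventually_elim
      case (elim i)
      have "norm ((LINT x|M. f i x \<bullet> h x) - (LINT x|M. g x \<bullet> h x)) = norm (LINT x|M. (f i x - g x) \<bullet> h x)"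
        using int[OF elim] int[OF g] by (simp add: inner_diff_left)
      also have "\<dots> \<le> (LINT x|M. norm ((f i x - g x) \<bullet> h x))" by (rule integral_norm_bound)
      also have "\<dots> \<le> (LINT x|M. \<bar>B\<bar> * norm (f i x - g x))"
      proof (rule integral_mono)
        show "integrable M (\<lambda>x. norm ((f i x - g x) \<bullet> h x))" using int[of "\<lambda>x. f i x - g x"] elim g by auto
        show "integrable M (\<lambda>x. \<bar>B\<bar> * norm (f i x - g x))" using elim g by auto
        fix x assume "x \<in> space M"
        have "norm ((f i x - g x) \<bullet> h x) \<le> norm (f i x - g x) * norm (h x)"
          using Cauchy_Schwarz_ineq2 by auto
        also have "\<dots> \<le> norm (f i x - g x) * \<bar>B\<bar>" using h(2)[OF \<open>x \<in> space M\<close>] by (intro mult_left_mono) auto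
        finally show "norm ((f i x - g x) \<bullet> h x) \<le> \<bar>B\<bar> * norm (f i x - g x)" by (simp add: mult.commute)
      qed
      finally show ?case by simp
    qed
  qed
  then show ?thesis by (rule LIM_zero_cancel)
qed

section \<open>Integration by parts against functions with zero trace\<close>

lemma integral_ibp_compact_support:
  fixes f g :: "'a::euclidean_space \<Rightarrow> real"
  assumes U: "open U" and f: "C1_ext U U f" and g: "C1_ext U U g" and v: "v \<in> Basis"
    and K: "compact_support_in U f"
  shows "(LINT x|lebesgue_on U. pd v f x * g x) = - (LINT x|lebesgue_on U. f x * pd v g x)"
    and "integrable (lebesgue_on U) (\<lambda>x. pd v f x * g x)"
    and "integrable (lebesgue_on U) (\<lambda>x. f x * pd v g x)"
proof -
  obtain K where K: "compact K" "K \<subseteq> U" "\<And>x. x \<in> U - K \<Longrightarrow> f x = 0"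
    using K unfolding compact_support_in_def by blast
  have o: "open (U - K)" using U K(1) compact_imp_closed by blast
  have p0: "pd v f x = 0" if "x \<in> U - K" for x
    using pd_cong[OF o that, of f "\<lambda>_. 0" v] K(3) by simp
  note d = C1_ext_D[OF f] C1_ext_D[OF g]
  show 1: "integrable (lebesgue_on U) (\<lambda>x. pd v f x * g x)"
    by (rule integrable_cont_ext[OF U order_refl _ K(1,2)]) (auto intro: cont_ext_mult d v simp: p0)
  show 2: "integrable (lebesgue_on U) (\<lambda>x. f x * pd v g x)"
    by (rule integrable_cont_ext[OF U order_refl _ K(1,2)]) (auto intro: cont_ext_mult d v simp: K(3))
  have eq: "pd v (\<lambda>x. f x * g x) x = f x * pd v g x + pd v f x * g x" if "x \<in> U" for x
    using pd_mult(1) d(2)[OF that] d(5)[OF that] by blast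
  have "(LINT x|lebesgue_on U. pd v (\<lambda>x. f x * g x) x) = 0"
  proof (rule integral_pd_compact_support[OF U K(1,2)])
    show "continuous_on U (pd v (\<lambda>x. f x * g x))"
      using C1_ext_D(3)[OF C1_ext_mult[OF f g] v] by (rule cont_ext_continuous_on) simp
    show "(\<lambda>x. f x * g x) differentiable at z" if "z \<in> U" for z
      using C1_ext_D(2)[OF C1_ext_mult[OF f g] that] .
  qed (simp add: K(3))
  then have "(LINT x|lebesgue_on U. f x * pd v g x + pd v f x * g x) = 0"
    by (subst (asm) integral_cong_AE[where g="\<lambda>x. f x * pd v g x + pd v f x * g x"])
      (use eq 1 2 C1_ext_D(3)[OF C1_ext_mult[OF f g] v] in \<open>auto intro!: AE_I2
        continuous_on_measurable_lebesgue_on[OF U] cont_ext_continuous_on[of U U]\<close>)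
  then show "(LINT x|lebesgue_on U. pd v f x * g x) = - (LINT x|lebesgue_on U. f x * pd v g x)"
    using 1 2 by simp
qed


lemma integrable_lebesgue_on_subset:
  fixes f :: "'a::euclidean_space \<Rightarrow> 'b::euclidean_space"
  assumes "integrable (lebesgue_on S) f" "S \<in> sets lebesgue" "R \<in> sets lebesgue" "R \<subseteq> S"
  shows "integrable (lebesgue_on R) f"
  using set_integrable_subset[of lebesgue S f R] assms
  by (simp add: set_integrable_def integrable_restrict_space)

lemma pd_eq_0: "open V \<Longrightarrow> z \<in> V \<Longrightarrow> (\<And>y. y \<in> V \<Longrightarrow> f y = 0) \<Longrightarrow> pd v f z = 0"
  using pd_cong[of V z f "\<lambda>_. 0" v] by simp

lemma bump_C1_ext: "C1_ext U X (bump l r n)"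
  by (rule C1_extI[OF bump_Ck])

lemma weak_derivative_unique:
  fixes v :: "'a::euclidean_space \<Rightarrow> 'b::euclidean_space"
  assumes \<Omega>: "open \<Omega>" "bounded \<Omega>" and H: "H1 \<Omega> v G" and v: "C1_ext \<Omega> \<Omega> v" and b: "b \<in> Basis"
  shows "AE x in lebesgue_on \<Omega>. G b x = pd b v x"
proof -
  interpret finite_measure "lebesgue_on \<Omega>" by (rule finite_measure_bounded_open[OF \<Omega>])
  have vi: "integrable (lebesgue_on \<Omega>) v" and Gi: "integrable (lebesgue_on \<Omega>) (G b)"
    using H b unfolding H1_def by (auto intro!: Lp_integrable[of _ _ 2] finite_measure_axioms)
  have sc: "integrable (lebesgue_on \<Omega>) (\<lambda>x. k x *\<^sub>R w x)"
    if "continuous_on \<Omega> k" "\<And>x. x \<in> \<Omega> \<Longrightarrow> \<bar>k x\<bar> \<le> B" "integrable (lebesgue_on \<Omega>) w"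
    for k :: "'a \<Rightarrow> real" and w :: "'a \<Rightarrow> 'b" and B
  proof (rule Bochner_Integration.integrable_bound[where f="\<lambda>x. B * norm (w x)"])
    show "(\<lambda>x. k x *\<^sub>R w x) \<in> borel_measurable (lebesgue_on \<Omega>)"
      using continuous_on_measurable_lebesgue_on[OF \<Omega>(1) that(1)] that(3) by measurable
    show "AE x in lebesgue_on \<Omega>. norm (k x *\<^sub>R w x) \<le> norm (B * norm (w x))"
    proof (rule AE_I2)
      fix x assume "x \<in> space (lebesgue_on \<Omega>)"
      then have "\<bar>k x\<bar> \<le> \<bar>B\<bar>" using that(2)[of x] by simp
      then show "norm (k x *\<^sub>R w x) \<le> norm (B * norm (w x))" by (simp add: abs_mult mult_right_mono)
    qed
  qed (use that(3) in auto)
  have "AE x in lebesgue_on \<Omega>. (G b x - pd b v x) \<bullet> c = 0" if c: "c \<in> Basis" for c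
  proof (rule fundamental_lemma[OF \<Omega>(1)])
    fix l r :: 'a assume lr: "cbox l r \<subseteq> \<Omega>"
    have sub: "integrable (lebesgue_on (cbox l r)) (G b)"
      by (rule integrable_lebesgue_on_subset[OF Gi]) (use lr \<Omega>(1) in auto)
    have "continuous_on (cbox l r) (pd b v)"
      using C1_ext_D(3)[OF v b] lr cont_ext_continuous_on continuous_on_subset by blast
    then have "integrable (lebesgue_on (cbox l r)) (pd b v)"
      by (simp add: continuous_imp_integrable)
    with sub show "integrable (lebesgue_on (cbox l r)) (\<lambda>x. (G b x - pd b v x) \<bullet> c)" by simp
    fix n
    let ?\<phi> = "bump l r n"
    have \<phi>t: "?\<phi> \<in> test_functions \<Omega>" using bump_test_function[OF lr, of n "1::real"] by simp
    have cs: "compact_support_in \<Omega> ?\<phi>" by (rule bump_compact_support) (use lr in \<open>simp add: Int_absorb2\<close>)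
    have cv: "C1_ext \<Omega> \<Omega> (\<lambda>x. v x \<bullet> c)" by (rule C1_ext_inner[OF v C1_ext_const])
    note ibp = integral_ibp_compact_support[OF \<Omega>(1) bump_C1_ext cv b cs]
    have pdc: "pd b (\<lambda>x. v x \<bullet> c) x = pd b v x \<bullet> c" if "x \<in> \<Omega>" for x
      using pd_inner(1)[OF C1_ext_D(2)[OF v that] differentiable_const, of b c] by simp
    obtain B where B: "\<And>x. \<bar>pd b ?\<phi> x\<bar> \<le> B"
    proof -
      obtain B where "\<And>x. x \<in> cbox l r \<Longrightarrow> norm (pd b ?\<phi> x) \<le> B"
        using cont_ext_bounded[OF C1_ext_D(3)[OF bump_C1_ext[of UNIV UNIV l r n] b], of "cbox l r"] by auto
      moreover have "pd b ?\<phi> x = 0" if "x \<notin> cbox l r" for x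
      proof (rule pd_eq_0[of "- cbox l r"])
        show "?\<phi> y = 0" if "y \<in> - cbox l r" for y
          using that box_subset_cbox by (intro bump_eq_0) blast
      qed (use that in \<open>auto simp: open_Compl\<close>)
      ultimately have "\<bar>pd b ?\<phi> x\<bar> \<le> \<bar>B\<bar>" for x by (cases "x \<in> cbox l r") force+
      then show ?thesis by (rule that)
    qed
    have ip: "integrable (lebesgue_on \<Omega>) (\<lambda>x. pd b ?\<phi> x *\<^sub>R v x)"
      by (rule sc[where B=B]) (use B vi cont_ext_continuous_on[OF C1_ext_D(3)[OF bump_C1_ext b] order_refl] in auto)
    have ig: "integrable (lebesgue_on \<Omega>) (\<lambda>x. ?\<phi> x *\<^sub>R G b x)"
      by (rule sc[where B=1]) (use Gi in \<open>auto simp: bump_continuous bump_bounds\<close>)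
    have "(LINT x|lebesgue_on \<Omega>. pd b ?\<phi> x *\<^sub>R v x) = - (LINT x|lebesgue_on \<Omega>. ?\<phi> x *\<^sub>R G b x)"
      using H b \<phi>t unfolding H1_def by blast
    then have "(LINT x|lebesgue_on \<Omega>. pd b ?\<phi> x *\<^sub>R v x) \<bullet> c = - ((LINT x|lebesgue_on \<Omega>. ?\<phi> x *\<^sub>R G b x) \<bullet> c)"
      by simp
    then have e: "(LINT x|lebesgue_on \<Omega>. pd b ?\<phi> x * (v x \<bullet> c)) = - (LINT x|lebesgue_on \<Omega>. ?\<phi> x * (G b x \<bullet> c))"
      using integral_inner_left[OF ip, of c] integral_inner_left[OF ig, of c] by simp
    have i1: "integrable (lebesgue_on \<Omega>) (\<lambda>x. ?\<phi> x * (G b x \<bullet> c))"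
      using integrable_inner_left[OF ig, of c] by simp
    have "(LINT x|lebesgue_on \<Omega>. ?\<phi> x * (G b x \<bullet> c)) = (LINT x|lebesgue_on \<Omega>. ?\<phi> x * pd b (\<lambda>x. v x \<bullet> c) x)"
      using e ibp(1) by simp
    then have "(LINT x|lebesgue_on \<Omega>. ?\<phi> x * (G b x \<bullet> c) - ?\<phi> x * pd b (\<lambda>x. v x \<bullet> c) x) = 0"
      using i1 ibp(3) by simp
    moreover have "(LINT x|lebesgue_on \<Omega>. ?\<phi> x * ((G b x - pd b v x) \<bullet> c))
        = (LINT x|lebesgue_on \<Omega>. ?\<phi> x * (G b x \<bullet> c) - ?\<phi> x * pd b (\<lambda>x. v x \<bullet> c) x)"
      by (rule Bochner_Integration.integral_cong) (auto simp: pdc inner_diff_left right_diff_distrib)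
    ultimately show "(LINT x|lebesgue_on \<Omega>. ?\<phi> x * ((G b x - pd b v x) \<bullet> c)) = 0" by simp
  qed
  then have "AE x in lebesgue_on \<Omega>. \<forall>c\<in>Basis. (G b x - pd b v x) \<bullet> c = 0"
    by (subst AE_finite_all) auto
  then show ?thesis by eventually_elim (metis eq_iff_diff_eq_0 euclidean_all_zero_iff)
qed

text \<open>For the approximating test functions in place of \<open>v\<close> the identity is integration by parts without
  boundary.  In the limit their derivatives become the weak derivative \<open>G b\<close>, which is the classical one.\<close>

lemma zero_trace_ibp:
  fixes v :: "'a::euclidean_space \<Rightarrow> 'b::euclidean_space" and g :: "'a \<Rightarrow> real"
  assumes \<Omega>: "open \<Omega>" "bounded \<Omega>" and H: "H1_zero_trace \<Omega> v G"
    and v: "C1_ext \<Omega> (closure \<Omega>) v" and g: "C1_ext \<Omega> (closure \<Omega>) g" and b: "b \<in> Basis"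
  shows "(LINT x|lebesgue_on \<Omega>. (pd b v x \<bullet> c) * g x + (v x \<bullet> c) * pd b g x) = 0"
proof -
  interpret finite_measure "lebesgue_on \<Omega>" by (rule finite_measure_bounded_open[OF \<Omega>])
  note fin = finite_measure_axioms
  have cl: "compact (closure \<Omega>)" using \<Omega> by (simp add: compact_closure)
  have sub: "\<Omega> \<subseteq> closure \<Omega>" by (rule closure_subset)
  obtain \<psi> where \<psi>: "\<And>n. \<psi> n \<in> test_functions \<Omega>" "tendsto_Lp 2 \<Omega> \<psi> v sequentially"
    "tendsto_Lp 2 \<Omega> (\<lambda>n. pd b (\<psi> n)) (G b) sequentially"
    using H b unfolding H1_zero_trace_def by blast
  have vO: "C1_ext \<Omega> \<Omega> v" and gO: "C1_ext \<Omega> \<Omega> g" using C1_ext_subset v g sub by blast+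
  have Gv: "AE x in lebesgue_on \<Omega>. G b x = pd b v x"
    using weak_derivative_unique[OF \<Omega> _ vO b] H unfolding H1_zero_trace_def by blast
  have mg: "(\<lambda>x. g x *\<^sub>R c) \<in> borel_measurable (lebesgue_on \<Omega>)"
      "(\<lambda>x. pd b g x *\<^sub>R c) \<in> borel_measurable (lebesgue_on \<Omega>)"
    using C1_ext_D(1,3)[OF gO] b
    by (auto intro!: continuous_on_measurable_lebesgue_on \<Omega> cont_ext_continuous_on[OF cont_ext_scaleR])
  obtain B1 where B1: "\<And>x. x \<in> \<Omega> \<Longrightarrow> norm (g x) \<le> B1"
    using cont_ext_bounded[OF C1_ext_D(1)[OF g] cl] sub by (metis order_refl subsetD)
  obtain B2 where B2: "\<And>x. x \<in> \<Omega> \<Longrightarrow> norm (pd b g x) \<le> B2"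
    using cont_ext_bounded[OF C1_ext_D(3)[OF g b] cl] sub by (metis order_refl subsetD)
  have vi: "integrable (lebesgue_on \<Omega>) v" and Gi: "integrable (lebesgue_on \<Omega>) (G b)"
    using H b unfolding H1_zero_trace_def H1_def by (auto intro!: Lp_integrable[of _ _ 2] fin)
  have ei: "eventually (\<lambda>n. integrable (lebesgue_on \<Omega>) (f n)) sequentially"
    if "tendsto_Lp 2 \<Omega> f h sequentially" for f :: "nat \<Rightarrow> 'a \<Rightarrow> 'b" and h
    using that unfolding tendsto_Lp_def by (auto elim!: eventually_mono intro!: Lp_integrable[of _ _ 2] fin)
  have l1: "(\<lambda>n. LINT x|lebesgue_on \<Omega>. pd b (\<psi> n) x \<bullet> (g x *\<^sub>R c)) \<longlonglongrightarrow> (LINT x|lebesgue_on \<Omega>. G b x \<bullet> (g x *\<^sub>R c))"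
    by (rule tendsto_integral_inner_bounded[OF tendsto_Lp_L1[OF fin \<psi>(3)] ei[OF \<psi>(3)] Gi mg(1), of "B1 * norm c"])
      (use B1 in \<open>auto intro: mult_right_mono\<close>)
  have l2: "(\<lambda>n. LINT x|lebesgue_on \<Omega>. \<psi> n x \<bullet> (pd b g x *\<^sub>R c)) \<longlonglongrightarrow> (LINT x|lebesgue_on \<Omega>. v x \<bullet> (pd b g x *\<^sub>R c))"
    by (rule tendsto_integral_inner_bounded[OF tendsto_Lp_L1[OF fin \<psi>(2)] ei[OF \<psi>(2)] vi mg(2), of "B2 * norm c"])
      (use B2 in \<open>auto intro: mult_right_mono\<close>)
  have eq: "(LINT x|lebesgue_on \<Omega>. pd b (\<psi> n) x \<bullet> (g x *\<^sub>R c)) = - (LINT x|lebesgue_on \<Omega>. \<psi> n x \<bullet> (pd b g x *\<^sub>R c))" for n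
  proof -
    have t: "C1_ext \<Omega> \<Omega> (\<psi> n)" "compact_support_in \<Omega> (\<psi> n)"
      using \<psi>(1)[of n] unfolding test_functions_def by (auto intro: smooth_upto_C1_ext)
    have c: "C1_ext \<Omega> \<Omega> (\<lambda>x. \<psi> n x \<bullet> c)" by (rule C1_ext_inner[OF t(1) C1_ext_const])
    have s: "compact_support_in \<Omega> (\<lambda>x. \<psi> n x \<bullet> c)"
      using t(2) unfolding compact_support_in_def by (metis inner_zero_left)
    have "pd b (\<lambda>x. \<psi> n x \<bullet> c) x = pd b (\<psi> n) x \<bullet> c" if "x \<in> \<Omega>" for x
      using pd_inner(1)[OF C1_ext_D(2)[OF t(1) that] differentiable_const, of b c] by simp
    then have "(LINT x|lebesgue_on \<Omega>. pd b (\<psi> n) x \<bullet> (g x *\<^sub>R c)) = (LINT x|lebesgue_on \<Omega>. pd b (\<lambda>x. \<psi> n x \<bullet> c) x * g x)"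
      by (intro Bochner_Integration.integral_cong) auto
    then show ?thesis
      using integral_ibp_compact_support(1)[OF \<Omega>(1) c gO b s] by (simp add: mult.commute)
  qed
  have "(LINT x|lebesgue_on \<Omega>. G b x \<bullet> (g x *\<^sub>R c)) = - (LINT x|lebesgue_on \<Omega>. v x \<bullet> (pd b g x *\<^sub>R c))"
    using LIMSEQ_unique[OF l1[unfolded eq] tendsto_minus[OF l2]] .
  moreover have "(LINT x|lebesgue_on \<Omega>. G b x \<bullet> (g x *\<^sub>R c)) = (LINT x|lebesgue_on \<Omega>. pd b v x \<bullet> (g x *\<^sub>R c))"
  proof (rule integral_cong_AE)
    show "(\<lambda>x. G b x \<bullet> (g x *\<^sub>R c)) \<in> borel_measurable (lebesgue_on \<Omega>)"
      using borel_measurable_integrable[OF Gi] mg(1) by (rule borel_measurable_inner)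
    show "(\<lambda>x. pd b v x \<bullet> (g x *\<^sub>R c)) \<in> borel_measurable (lebesgue_on \<Omega>)"
      by (intro borel_measurable_inner mg continuous_on_measurable_lebesgue_on \<Omega>
          cont_ext_continuous_on[OF C1_ext_D(3)[OF vO b]] order_refl)
  qed (use Gv in auto)
  moreover have "integrable (lebesgue_on \<Omega>) (\<lambda>x. (pd b v x \<bullet> c) * g x)"
    by (rule integrable_cont_ext[OF \<Omega>(1) sub _ cl order_refl])
      (use sub in \<open>auto intro!: cont_ext_mult cont_ext_inner C1_ext_D[OF v] C1_ext_D[OF g] b\<close>)
  moreover have "integrable (lebesgue_on \<Omega>) (\<lambda>x. (v x \<bullet> c) * pd b g x)"
    by (rule integrable_cont_ext[OF \<Omega>(1) sub _ cl order_refl])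
      (use sub in \<open>auto intro!: cont_ext_mult cont_ext_inner C1_ext_D[OF v] C1_ext_D[OF g] b\<close>)
  ultimately show ?thesis by (simp add: mult.commute)
qed


section \<open>Slices of space-time functions\<close>

lemma Basis_spacetime: "b \<in> Basis \<Longrightarrow> (b, 0::real) \<in> Basis" "(0::'a::euclidean_space, 1::real) \<in> Basis"
  by (auto simp: Basis_prod_def)

lemma spacetime_slice:
  fixes f :: "'a::euclidean_space \<times> real \<Rightarrow> 'b::euclidean_space"
  assumes f: "C1_ext (\<Omega> \<times> {0<..<T}) (closure \<Omega> \<times> I) f" and t: "t \<in> {0<..<T}" "{0<..<T} \<subseteq> I"
  shows "x \<in> \<Omega> \<Longrightarrow> pd b (\<lambda>x. f (x, t)) x = dx b f (x, t)"
    and "C1_ext \<Omega> (closure \<Omega>) (\<lambda>x. f (x, t))"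
proof -
  have d: "((\<lambda>x. f (x, t)) has_derivative (\<lambda>h. pd (h, 0) f (x, t))) (at x)" if "x \<in> \<Omega>" for x
  proof -
    have 1: "((\<lambda>x. (x, t)) has_derivative (\<lambda>h. (h, 0))) (at x)"
      by (auto intro!: derivative_eq_intros)
    have "f differentiable (at (x, t))" using C1_ext_D(2)[OF f] that t by auto
    from has_derivative_compose[OF 1 pd_has_derivative[OF this]] show ?thesis .
  qed
  then show eq: "pd b (\<lambda>x. f (x, t)) x = dx b f (x, t)" if "x \<in> \<Omega>" for x b
    unfolding dx_def using that by (intro pd_eqI)
  have ce: "cont_ext \<Omega> (closure \<Omega>) (\<lambda>x. g (x, t))" if g: "cont_ext (\<Omega> \<times> {0<..<T}) (closure \<Omega> \<times> I) g"
    for g :: "'a \<times> real \<Rightarrow> 'b"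
  proof -
    obtain g' where g': "continuous_on (closure \<Omega> \<times> I) g'" "\<And>z. z \<in> \<Omega> \<times> {0<..<T} \<Longrightarrow> g' z = g z"
      using g unfolding cont_ext_def by blast
    have "continuous_on (closure \<Omega>) (\<lambda>x. g' (x, t))"
      by (rule continuous_on_compose2[OF g'(1)]) (use t in \<open>auto intro!: continuous_intros\<close>)
    then show ?thesis unfolding cont_ext_def using g'(2) t by auto
  qed
  show "C1_ext \<Omega> (closure \<Omega>) (\<lambda>x. f (x, t))"
    unfolding C1_ext_def
  proof (intro conjI ballI)
    show "cont_ext \<Omega> (closure \<Omega>) (\<lambda>x. f (x, t))" by (rule ce[OF C1_ext_D(1)[OF f]])
    show "(\<lambda>x. f (x, t)) differentiable at x" if "x \<in> \<Omega>" for x using d[OF that] by (rule differentiableI)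
    show "cont_ext \<Omega> (closure \<Omega>) (pd b (\<lambda>x. f (x, t)))" if b: "b \<in> Basis" for b
      using ce[OF C1_ext_D(3)[OF f Basis_spacetime(1)[OF b]]] eq
        cont_ext_cong[of \<Omega> "pd b (\<lambda>x. f (x, t))" "\<lambda>x. dx b f (x, t)"] by (simp add: dx_def)
  qed
qed

lemma spacetime_Fubini:
  fixes F :: "'a::euclidean_space \<times> real \<Rightarrow> real"
  assumes \<Omega>: "open \<Omega>" and F: "integrable (lebesgue_on (\<Omega> \<times> {0<..<T})) F"
    and cont: "continuous_on (\<Omega> \<times> {0<..<T}) F"
  shows "(LINT z|lebesgue_on (\<Omega> \<times> {0<..<T}). F z) = (LINT t|lebesgue_on {0<..<T}. LINT x|lebesgue_on \<Omega>. F (x, t))"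
    and "(LINT z|lebesgue_on (\<Omega> \<times> {0<..<T}). F z) = (LINT x|lebesgue_on \<Omega>. LINT t|lebesgue_on {0<..<T}. F (x, t))"
proof -
  let ?J = "{0<..<T}"
  define H where "H z = indicator (\<Omega> \<times> ?J) z *\<^sub>R F z" for z
  have Q: "open (\<Omega> \<times> ?J)" using \<Omega> by (simp add: open_Times)
  have m: "H \<in> borel_measurable borel"
    unfolding H_def by (rule borel_measurable_indicator_continuous[OF Q cont])
  have i: "integrable (lborel \<Otimes>\<^sub>M lborel) (\<lambda>(x, t). H (x, t))"
    using F lebesgue_on_eq_lborel(2)[of "\<Omega> \<times> ?J" F, folded H_def, OF _ m] Q unfolding lborel_prod by simp
  have e: "(LINT z|lebesgue_on (\<Omega> \<times> ?J). F z) = integral\<^sup>L (lborel \<Otimes>\<^sub>M lborel) (\<lambda>(x, t). H (x, t))"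
    using lebesgue_on_eq_lborel(1)[of "\<Omega> \<times> ?J" F, folded H_def, OF _ m] Q unfolding lborel_prod by simp
  have inner1: "(LINT x|lborel. H (x, t)) = indicator ?J t *\<^sub>R (LINT x|lebesgue_on \<Omega>. F (x, t))" for t
  proof (cases "t \<in> ?J")
    case True
    have "continuous_on \<Omega> (\<lambda>x. F (x, t))"
      by (rule continuous_on_compose2[OF cont]) (use True in \<open>auto intro!: continuous_intros\<close>)
    from lebesgue_on_eq_lborel(1)[OF _ borel_measurable_indicator_continuous[OF \<Omega> this]]
    have "(LINT x|lebesgue_on \<Omega>. F (x, t)) = (LINT x|lborel. indicator \<Omega> x *\<^sub>R F (x, t))" using \<Omega> by simp
    moreover have "H (x, t) = indicator \<Omega> x *\<^sub>R F (x, t)" for x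
      using True unfolding H_def by (simp add: indicator_times)
    ultimately show ?thesis using True by simp
  qed (simp add: H_def)
  have inner2: "(LINT t|lborel. H (x, t)) = indicator \<Omega> x *\<^sub>R (LINT t|lebesgue_on ?J. F (x, t))" for x
  proof (cases "x \<in> \<Omega>")
    case True
    have "continuous_on ?J (\<lambda>t. F (x, t))"
      by (rule continuous_on_compose2[OF cont]) (use True in \<open>auto intro!: continuous_intros\<close>)
    from lebesgue_on_eq_lborel(1)[OF _ borel_measurable_indicator_continuous[OF _ this]]
    have "(LINT t|lebesgue_on ?J. F (x, t)) = (LINT t|lborel. indicator ?J t *\<^sub>R F (x, t))" by simp
    moreover have "H (x, t) = indicator ?J t *\<^sub>R F (x, t)" for t
      using True unfolding H_def by (simp add: indicator_times)
    ultimately show ?thesis using True by simp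
  qed (simp add: H_def)
  have "(\<lambda>t. LINT x|lborel. H (x, t)) \<in> borel_measurable lborel"
    by (rule borel_measurable_integrable[OF lborel_pair.integrable_snd[OF i]])
  then have "(LINT t|lebesgue_on ?J. LINT x|lebesgue_on \<Omega>. F (x, t)) = (LINT t|lborel. LINT x|lborel. H (x, t))"
    unfolding inner1 by (subst lebesgue_on_eq_lborel(1)) auto
  then show "(LINT z|lebesgue_on (\<Omega> \<times> ?J). F z) = (LINT t|lebesgue_on ?J. LINT x|lebesgue_on \<Omega>. F (x, t))"
    using lborel_pair.integral_snd[OF i] e by simp
  have "(\<lambda>x. LINT t|lborel. H (x, t)) \<in> borel_measurable lborel"
    by (rule borel_measurable_integrable[OF lborel_pair.integrable_fst[OF i]])
  then have "(LINT x|lebesgue_on \<Omega>. LINT t|lebesgue_on ?J. F (x, t)) = (LINT x|lborel. LINT t|lborel. H (x, t))"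
    unfolding inner2 using \<Omega> by (subst lebesgue_on_eq_lborel(1)) auto
  then show "(LINT z|lebesgue_on (\<Omega> \<times> ?J). F z) = (LINT x|lebesgue_on \<Omega>. LINT t|lebesgue_on ?J. F (x, t))"
    using lborel_pair.integral_fst[OF i] e by simp
qed

lemma spacetime_zero_trace_ibp:
  fixes w :: "'a::euclidean_space \<times> real \<Rightarrow> 'b::euclidean_space" and g :: "'a \<times> real \<Rightarrow> real"
    and \<Omega> :: "'a set" and T :: real
  defines "Q \<equiv> \<Omega> \<times> {0<..<T}"
  assumes \<Omega>: "open \<Omega>" "bounded \<Omega>" and I: "{0<..<T} \<subseteq> I" and X: "X = closure \<Omega> \<times> I"
    and H: "AE t in lebesgue_on {0<..<T}. H1_zero_trace \<Omega> (\<lambda>x. w (x, t)) (G t)"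
    and w: "C1_ext Q X w" and g: "C1_ext Q X g"
    and K: "compact K" "K \<subseteq> X" "\<forall>z\<in>Q - K. g z = 0" and b: "b \<in> Basis"
  shows "(LINT z|lebesgue_on Q. (dx b w z \<bullet> c) * g z) = - (LINT z|lebesgue_on Q. (w z \<bullet> c) * dx b g z)"
    and "integrable (lebesgue_on Q) (\<lambda>z. (dx b w z \<bullet> c) * g z)"
    and "integrable (lebesgue_on Q) (\<lambda>z. (w z \<bullet> c) * dx b g z)"
proof -
  have Q: "open Q" using \<Omega> by (simp add: open_Times Q_def)
  have QX: "Q \<subseteq> X" using I closure_subset unfolding Q_def X by blast
  have o: "open (Q - K)" using Q K(1) compact_imp_closed by blast
  have g0: "dx b g z = 0" if "z \<in> Q - K" for z
    unfolding dx_def using o that by (rule pd_eq_0) (rule K(3)[rule_format])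
  note dxc = C1_ext_D(3)[OF w Basis_spacetime(1)[OF b], folded dx_def]
    C1_ext_D(3)[OF g Basis_spacetime(1)[OF b], folded dx_def]
  have c1: "cont_ext Q X (\<lambda>z. (dx b w z \<bullet> c) * g z)" and c2: "cont_ext Q X (\<lambda>z. (w z \<bullet> c) * dx b g z)"
    by (intro cont_ext_mult cont_ext_inner dxc C1_ext_D[OF w] C1_ext_D[OF g] cont_ext_const)+
  show i1: "integrable (lebesgue_on Q) (\<lambda>z. (dx b w z \<bullet> c) * g z)"
    by (rule integrable_cont_ext[OF Q QX c1 K(1,2)]) (simp add: K(3))
  show i2: "integrable (lebesgue_on Q) (\<lambda>z. (w z \<bullet> c) * dx b g z)"
    by (rule integrable_cont_ext[OF Q QX c2 K(1,2)]) (simp add: g0)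
  let ?F = "\<lambda>z. (dx b w z \<bullet> c) * g z + (w z \<bullet> c) * dx b g z"
  have "(LINT z|lebesgue_on Q. ?F z) = (LINT t|lebesgue_on {0<..<T}. LINT x|lebesgue_on \<Omega>. ?F (x, t))"
    unfolding Q_def
  proof (rule spacetime_Fubini(1)[OF \<Omega>(1)])
    show "integrable (lebesgue_on (\<Omega> \<times> {0<..<T})) ?F" using i1 i2 unfolding Q_def by simp
    show "continuous_on (\<Omega> \<times> {0<..<T}) ?F"
      using cont_ext_continuous_on[OF cont_ext_add[OF c1 c2] QX] unfolding Q_def .
  qed
  also have "\<dots> = 0"
  proof (rule integral_eq_zero_AE)
    have "AE t in lebesgue_on {0<..<T}. t \<in> {0<..<T}" by (rule AE_I2) simp
    with H show "AE t in lebesgue_on {0<..<T}. (LINT x|lebesgue_on \<Omega>. ?F (x, t)) = 0"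
    proof eventually_elim
      case (elim t)
      note sw = spacetime_slice[OF w[unfolded Q_def X] elim(2) I]
      note sg = spacetime_slice[OF g[unfolded Q_def X] elim(2) I]
      have "(LINT x|lebesgue_on \<Omega>. ?F (x, t)) = (LINT x|lebesgue_on \<Omega>.
          (pd b (\<lambda>x. w (x, t)) x \<bullet> c) * g (x, t) + (w (x, t) \<bullet> c) * pd b (\<lambda>x. g (x, t)) x)"
        by (rule Bochner_Integration.integral_cong) (simp_all add: sw(1) sg(1))
      also have "\<dots> = 0"
        by (rule zero_trace_ibp[OF \<Omega> elim(1) sw(2) sg(2) b])
      finally show ?case .
    qed
  qed
  finally show "(LINT z|lebesgue_on Q. (dx b w z \<bullet> c) * g z) = - (LINT z|lebesgue_on Q. (w z \<bullet> c) * dx b g z)"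
    using i1 i2 by simp
qed

lemma compact_in_positive_time:
  fixes K :: "('a::euclidean_space \<times> real) set"
  assumes "compact K" "K \<subseteq> A \<times> {0<..T}" "0 < T"
  obtains a where "0 < a" "a < T" "\<And>x t. (x, t) \<in> K \<Longrightarrow> a < t"
proof (cases "K = {}")
  case True
  then show ?thesis using that[of "T / 2"] assms(3) by simp
next
  case False
  have "compact (snd ` K)" using assms(1) by (intro compact_continuous_image continuous_intros)
  then obtain m where m: "m \<in> snd ` K" "\<And>t. t \<in> snd ` K \<Longrightarrow> m \<le> t"
    using compact_attains_inf[of "snd ` K"] False by blast
  have "0 < m" "m \<le> T" using m(1) assms(2) by auto
  moreover have "m / 2 < t" if "(x, t) \<in> K" for x t
    using m(2)[of t] that \<open>0 < m\<close> by force
  ultimately show ?thesis using that[of "m / 2"] by simp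
qed

text \<open>The fundamental theorem of calculus on each vertical line; \<open>h\<close> vanishes near \<open>t = 0\<close>, and
  the final time is reached by continuity.\<close>

lemma spacetime_time_integral:
  fixes h :: "'a::euclidean_space \<times> real \<Rightarrow> real" and \<Omega> :: "'a set" and T :: real
  defines "Q \<equiv> \<Omega> \<times> {0<..<T}" and "X \<equiv> closure \<Omega> \<times> {0<..T}"
  assumes \<Omega>: "open \<Omega>" "bounded \<Omega>" and T: "0 < T" and h: "C1_ext Q X h" "continuous_on X h"
    and K: "compact K" "K \<subseteq> X" "\<And>z. z \<in> X - K \<Longrightarrow> h z = 0"
  shows "integrable (lebesgue_on Q) (dt h)" "(LINT z|lebesgue_on Q. dt h z) = (LINT x|lebesgue_on \<Omega>. h (x, T))"
proof -
  have Q: "open Q" using \<Omega> by (simp add: open_Times Q_def)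
  have QX: "Q \<subseteq> X" using closure_subset unfolding Q_def X_def by fastforce
  have o: "open (Q - K)" using Q K(1) compact_imp_closed by blast
  have h0: "dt h z = 0" if "z \<in> Q - K" for z
    unfolding dt_def
  proof (rule pd_eq_0[OF o that])
    show "h y = 0" if "y \<in> Q - K" for y using K(3)[of y] QX that by auto
  qed
  have ce: "cont_ext Q X (dt h)" unfolding dt_def by (rule C1_ext_D(3)[OF h(1) Basis_spacetime(2)])
  show i: "integrable (lebesgue_on Q) (dt h)" by (rule integrable_cont_ext[OF Q QX ce K(1,2) h0])
  obtain a where a: "0 < a" "a < T" "\<And>x t. (x, t) \<in> K \<Longrightarrow> a < t"
    by (rule compact_in_positive_time[OF K(1) K(2)[unfolded X_def] T]) (rule that)
  have inner: "(LINT t|lebesgue_on {0<..<T}. dt h (x, t)) = h (x, T)" if x: "x \<in> \<Omega>" for x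
  proof -
    have xc: "x \<in> closure \<Omega>" using x closure_subset by blast
    have hz: "h (x, t) = 0" if "0 < t" "t \<le> a" for t
    proof -
      have "(x, t) \<notin> K" using a(3)[of x t] that by auto
      moreover have "(x, t) \<in> X" using xc that a(2) by (simp add: X_def)
      ultimately show ?thesis using K(3)[of "(x, t)"] by simp
    qed
    define k where "k t = (if t \<le> 0 then 0 else h (x, t))" for t
    have "continuous_on ({0..a} \<union> {a..T}) k"
    proof (rule continuous_on_closed_Un)
      show "continuous_on {0..a} k"
        by (rule continuous_on_eq[of _ "\<lambda>_. 0"]) (auto simp: k_def hz)
      have "continuous_on {a..T} (\<lambda>t. h (x, t))"
        by (rule continuous_on_compose2[OF h(2)]) (use a xc in \<open>auto simp: X_def intro!: continuous_intros\<close>)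
      then show "continuous_on {a..T} k"
        by (rule continuous_on_eq) (use a in \<open>auto simp: k_def\<close>)
    qed auto
    moreover have "{0..a} \<union> {a..T} = {0..T}" using a by auto
    ultimately have ck: "continuous_on {0..T} k" by simp
    have dk: "(k has_vector_derivative dt h (x, t)) (at t)" if t: "t \<in> {0<..<T}" for t
    proof -
      have 1: "((\<lambda>t. (x, t)) has_derivative (\<lambda>s. (0, s))) (at t)"
        by (auto intro!: derivative_eq_intros)
      have "h differentiable (at (x, t))" using C1_ext_D(2)[OF h(1)] x t unfolding Q_def by auto
      note D = pd_has_derivative[OF this]
      interpret L: bounded_linear "\<lambda>v. pd v h (x, t)" by (rule has_derivative_bounded_linear[OF D])
      have "pd (0, s) h (x, t) = s *\<^sub>R dt h (x, t)" for s
        using L.scaleR[of s "(0, 1)"] unfolding dt_def by simp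
      then have "((\<lambda>t. h (x, t)) has_vector_derivative dt h (x, t)) (at t)"
        using has_derivative_compose[OF 1 D] unfolding has_vector_derivative_def by simp
      then show ?thesis
        by (rule has_vector_derivative_transform_within_open[where S="{0<..}"])
          (use t in \<open>auto simp: k_def\<close>)
    qed
    have "((\<lambda>t. dt h (x, t)) has_integral (k T - k 0)) {0..T}"
      by (rule fundamental_theorem_of_calculus_interior[OF _ ck dk]) (use T in auto)
    then have 1: "((\<lambda>t. dt h (x, t)) has_integral h (x, T)) {0<..<T}"
      using T has_integral_open_interval[of "\<lambda>t. dt h (x, t)" "h (x, T)" 0 T] by (simp add: k_def)
    have "integrable (lebesgue_on {0<..<T}) (\<lambda>t. dt h (x, t))"
    proof (rule integrable_cont_ext[where X="{0<..T}" and K="{a..T}"])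
      obtain g where g: "continuous_on X g" "\<And>z. z \<in> Q \<Longrightarrow> g z = dt h z"
        using ce unfolding cont_ext_def by blast
      have "continuous_on {0<..T} (\<lambda>t. g (x, t))"
        by (rule continuous_on_compose2[OF g(1)]) (use xc in \<open>auto simp: X_def intro!: continuous_intros\<close>)
      then show "cont_ext {0<..<T} {0<..T} (\<lambda>t. dt h (x, t))"
        unfolding cont_ext_def using g(2) x by (intro exI[of _ "\<lambda>t. g (x, t)"]) (auto simp: Q_def)
      show "dt h (x, t) = 0" if t: "t \<in> {0<..<T} - {a..T}" for t
      proof -
        have "(x, t) \<notin> K" using a(3)[of x t] t by auto
        then show ?thesis using h0[of "(x, t)"] t x unfolding Q_def by simp
      qed
    qed (use a(1,2) in auto)
    then show ?thesis
      using has_integral_unique[OF has_integral_integral_lebesgue_on 1] by simp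
  qed
  have "(LINT z|lebesgue_on Q. dt h z) = (LINT x|lebesgue_on \<Omega>. LINT t|lebesgue_on {0<..<T}. dt h (x, t))"
    unfolding Q_def
    by (rule spacetime_Fubini(2)[OF \<Omega>(1) i[unfolded Q_def] cont_ext_continuous_on[OF ce QX, unfolded Q_def]])
  also have "\<dots> = (LINT x|lebesgue_on \<Omega>. h (x, T))"
    by (rule Bochner_Integration.integral_cong) (simp_all add: inner)
  finally show "(LINT z|lebesgue_on Q. dt h z) = (LINT x|lebesgue_on \<Omega>. h (x, T))" .
qed


section \<open>The local energy identity for smooth Navier--Stokes flows\<close>

lemma fundamental_lemma_continuous:
  fixes f :: "'a::euclidean_space \<Rightarrow> real"
  assumes U: "open U" and f: "continuous_on U f"
    and zero: "\<And>l r n. cbox l r \<subseteq> U \<Longrightarrow> (LINT x|lebesgue_on U. bump l r n x * f x) = 0"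
    and x: "x \<in> U"
  shows "f x = 0"
proof (rule ccontr)
  assume "f x \<noteq> 0"
  have "integrable (lebesgue_on (cbox l r)) f" if "cbox l r \<subseteq> U" for l r
    using continuous_on_subset[OF f that] by (simp add: continuous_imp_integrable)
  then have ae: "AE x in lebesgue_on U. f x = 0" by (rule fundamental_lemma[OF U _ zero])
  define V where "V = U \<inter> f -` (- {0})"
  have V: "open V" unfolding V_def by (rule continuous_open_preimage[OF f U]) auto
  have "AE x in lebesgue. x \<notin> V"
    using ae U by (subst (asm) AE_restrict_space_iff) (auto simp: V_def elim!: eventually_mono)
  then have "negligible V" using V by (simp add: negligible_iff_null_sets AE_iff_null_sets)
  moreover have "x \<in> V" using x \<open>f x \<noteq> 0\<close> unfolding V_def by simp
  ultimately show False using open_not_negligible[OF V] by blast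
qed

text \<open>\<open>G t\<close> is the weak gradient that comes with membership of \<open>u(\<cdot>, t)\<close> in \<open>H\<^sup>1\<close>.\<close>

locale smooth_navier_stokes =
  fixes \<Omega> :: "'a::euclidean_space set" and T \<nu> :: real
    and u :: "'a \<times> real \<Rightarrow> 'a" and p :: "'a \<times> real \<Rightarrow> real" and G :: "real \<Rightarrow> 'a \<Rightarrow> 'a \<Rightarrow> 'a"
  assumes dom: "open \<Omega>" "bounded \<Omega>" and T: "0 < T"
    and smooth_u: "smooth_upto (\<Omega> \<times> {0<..<T}) (closure \<Omega> \<times> {0<..T}) u"
    and smooth_p: "smooth_upto (\<Omega> \<times> {0<..<T}) (closure \<Omega> \<times> {0<..T}) p"
    and sol: "distributional_solution \<Omega> T \<nu> u p"
    and trace: "AE t in lebesgue_on {0<..<T}. H1_zero_trace \<Omega> (\<lambda>x. u (x, t)) (G t)"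
begin

abbreviation Q where "Q \<equiv> \<Omega> \<times> {0<..<T}"
abbreviation X where "X \<equiv> closure \<Omega> \<times> {0<..T}"

lemma open_Q: "open Q" using dom by (simp add: open_Times)
lemma Q_subset_X: "Q \<subseteq> X" using closure_subset by fastforce

lemma u_C1: "C1_ext Q X u" and p_C1: "C1_ext Q X p" and dx_u_C1: "b \<in> Basis \<Longrightarrow> C1_ext Q X (dx b u)"
  using smooth_upto_C1_ext[OF smooth_u] smooth_upto_C1_ext[OF smooth_p]
    smooth_upto_C1_ext_pd[OF smooth_u open_Q Basis_spacetime(1)] by (auto simp: dx_def)

lemma cont_ext_flow:
  "cont_ext Q X u" "cont_ext Q X p" "cont_ext Q X (dt u)"
  "b \<in> Basis \<Longrightarrow> cont_ext Q X (dx b u)" "b \<in> Basis \<Longrightarrow> cont_ext Q X (dx b p)"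
  "b \<in> Basis \<Longrightarrow> cont_ext Q X (dx b (dx b u))"
  unfolding dx_def dt_def
  by (intro C1_ext_D[OF u_C1] C1_ext_D[OF p_C1] C1_ext_D(3)[OF dx_u_C1, unfolded dx_def] Basis_spacetime;
      assumption)+

lemma differentiable_flow:
  assumes "z \<in> Q"
  shows "u differentiable (at z)" "p differentiable (at z)" "b \<in> Basis \<Longrightarrow> dx b u differentiable (at z)"
  using C1_ext_D(2)[OF u_C1] C1_ext_D(2)[OF p_C1] C1_ext_D(2)[OF dx_u_C1] assms by auto

text \<open>In \<open>bump_ibp\<close> and \<open>bump_ibp2\<close> all derivatives are moved from a bump to the flow; this turns the weak
  equations into pointwise ones by the fundamental lemma.\<close>

lemma bump_ibp:
  assumes lr: "cbox l r \<subseteq> Q" and g: "C1_ext Q X g" and v: "v \<in> Basis"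
  shows "(LINT z|lebesgue_on Q. pd v (bump l r n) z * g z) = - (LINT z|lebesgue_on Q. bump l r n z * pd v g z)"
    and "integrable (lebesgue_on Q) (\<lambda>z. pd v (bump l r n) z * g z)"
    and "integrable (lebesgue_on Q) (\<lambda>z. bump l r n z * pd v g z)"
proof -
  have "compact_support_in Q (bump l r n)"
    by (rule bump_compact_support) (use lr in \<open>simp add: Int_absorb2\<close>)
  note * = integral_ibp_compact_support[OF open_Q bump_C1_ext
      C1_ext_subset[OF g order_refl Q_subset_X] v this]
  show "(LINT z|lebesgue_on Q. pd v (bump l r n) z * g z) = - (LINT z|lebesgue_on Q. bump l r n z * pd v g z)"
    and "integrable (lebesgue_on Q) (\<lambda>z. pd v (bump l r n) z * g z)"
    and "integrable (lebesgue_on Q) (\<lambda>z. bump l r n z * pd v g z)"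
    using * .
qed

lemma bump_ibp2:
  assumes lr: "cbox l r \<subseteq> Q" and g: "C1_ext Q X g" "C1_ext Q X (pd v g)" and v: "v \<in> Basis"
  shows "(LINT z|lebesgue_on Q. pd v (pd v (bump l r n)) z * g z) = (LINT z|lebesgue_on Q. bump l r n z * pd v (pd v g) z)"
    and "integrable (lebesgue_on Q) (\<lambda>z. pd v (pd v (bump l r n)) z * g z)"
    and "integrable (lebesgue_on Q) (\<lambda>z. bump l r n z * pd v (pd v g) z)"
proof -
  have "smooth_upto Q Q (bump l r n)" unfolding smooth_upto_def by (simp add: bump_Ck)
  then have c: "C1_ext Q Q (pd v (bump l r n))" by (rule smooth_upto_C1_ext_pd[OF _ open_Q v])
  have "pd v (bump l r n) z = 0" if "z \<in> Q - cbox l r" for z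
  proof (rule pd_eq_0[of "- cbox l r"])
    show "bump l r n y = 0" if "y \<in> - cbox l r" for y
      using that box_subset_cbox by (intro bump_eq_0) blast
  qed (use that in \<open>auto simp: open_Compl\<close>)
  then have "compact_support_in Q (pd v (bump l r n))"
    unfolding compact_support_in_def using lr by (intro exI[of _ "cbox l r"]) auto
  note 1 = integral_ibp_compact_support[OF open_Q c C1_ext_subset[OF g(1) order_refl Q_subset_X] v this]
  note 2 = bump_ibp[OF lr g(2) v, of n]
  show "(LINT z|lebesgue_on Q. pd v (pd v (bump l r n)) z * g z) = (LINT z|lebesgue_on Q. bump l r n z * pd v (pd v g) z)"
    and "integrable (lebesgue_on Q) (\<lambda>z. pd v (pd v (bump l r n)) z * g z)"
    and "integrable (lebesgue_on Q) (\<lambda>z. bump l r n z * pd v (pd v g) z)"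
    using 1(1,2) 2(1,3) by simp_all
qed

lemma div_free:
  assumes "z \<in> Q" shows "divg u z = 0"
proof (rule fundamental_lemma_continuous[OF open_Q _ _ assms])
  show "continuous_on Q (divg u)"
    unfolding divg_def
    by (intro continuous_on_sum continuous_on_inner continuous_on_const
        cont_ext_continuous_on[OF cont_ext_flow(4) Q_subset_X])
  fix l r n assume lr: "cbox l r \<subseteq> Q"
  let ?\<phi> = "bump l r n"
  have cb: "C1_ext Q X (\<lambda>z. u z \<bullet> b)" for b by (rule C1_ext_inner[OF u_C1 C1_ext_const])
  have pb: "pd (b, 0) (\<lambda>z. u z \<bullet> b) z = dx b u z \<bullet> b" if "z \<in> Q" for z b
    using pd_inner(1)[OF differentiable_flow(1)[OF that] differentiable_const, of "(b, 0)" b] by (simp add: dx_def)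
  note i = bump_ibp[OF lr cb Basis_spacetime(1), of _ n]
  have "(LINT z|lebesgue_on Q. ?\<phi> z * divg u z)
      = (LINT z|lebesgue_on Q. (\<Sum>b\<in>Basis. ?\<phi> z * pd (b, 0) (\<lambda>z. u z \<bullet> b) z))"
    by (rule Bochner_Integration.integral_cong) (simp_all add: pb divg_def sum_distrib_left)
  also have "\<dots> = (\<Sum>b\<in>Basis. LINT z|lebesgue_on Q. ?\<phi> z * pd (b, 0) (\<lambda>z. u z \<bullet> b) z)"
    using i(3) by (intro Bochner_Integration.integral_sum)
  also have "\<dots> = (\<Sum>b\<in>Basis. - (LINT z|lebesgue_on Q. pd (b, 0) ?\<phi> z * (u z \<bullet> b)))"
    using i(1) by simp
  also have "\<dots> = - (LINT z|lebesgue_on Q. (\<Sum>b\<in>Basis. pd (b, 0) ?\<phi> z * (u z \<bullet> b)))"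
    using i(2) by (subst Bochner_Integration.integral_sum) (simp_all add: sum_negf)
  also have "(LINT z|lebesgue_on Q. (\<Sum>b\<in>Basis. pd (b, 0) ?\<phi> z * (u z \<bullet> b))) = (LINT z|lebesgue_on Q. u z \<bullet> grad ?\<phi> z)"
    by (rule Bochner_Integration.integral_cong) (simp_all add: grad_def inner_sum_right dx_def)
  also have "\<dots> = 0"
    using sol bump_test_function[OF lr, of n "1::real"] unfolding distributional_solution_def Let_def by simp
  finally show "(LINT z|lebesgue_on Q. ?\<phi> z * divg u z) = 0" by simp
qed

text \<open>Testing with bumps in the coordinate direction \<open>c\<close> gives the equation in divergence form; the
  term with \<open>div u\<close> is then dropped by \<open>div_free\<close>.\<close>

lemma momentum:
  assumes z: "z \<in> Q" and c: "c \<in> Basis"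
  shows "dt u z \<bullet> c + (\<Sum>b\<in>Basis. (u z \<bullet> b) * (dx b u z \<bullet> c)) + dx c p z = \<nu> * (laplace u z \<bullet> c)"
proof -
  define R where "R z = dt u z \<bullet> c + (\<Sum>b\<in>Basis. (dx b u z \<bullet> b) * (u z \<bullet> c) + (u z \<bullet> b) * (dx b u z \<bullet> c))
      + dx c p z - \<nu> * (\<Sum>b\<in>Basis. dx b (dx b u) z \<bullet> c)" for z
  have "R z = 0"
  proof (rule fundamental_lemma_continuous[OF open_Q _ _ z])
    have "cont_ext Q X R"
      unfolding R_def
      by (intro cont_ext_add cont_ext_diff cont_ext_mult cont_ext_sum cont_ext_inner cont_ext_const
          cont_ext_flow c; assumption)
    then show "continuous_on Q R" by (rule cont_ext_continuous_on[OF _ Q_subset_X])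
    fix l r n assume lr: "cbox l r \<subseteq> Q"
    let ?f = "bump l r n" and ?uc = "\<lambda>z. u z \<bullet> c"
    have uc: "C1_ext Q X (\<lambda>z. u z \<bullet> b)" for b by (rule C1_ext_inner[OF u_C1 C1_ext_const])
    have pduc: "pd v (\<lambda>z. u z \<bullet> b) z = pd v u z \<bullet> b" if "z \<in> Q" for z v b
      using pd_inner(1)[OF differentiable_flow(1)[OF that] differentiable_const, of v b] by simp
    have dduc: "C1_ext Q X (pd (b, 0) ?uc)" if "b \<in> Basis" for b
      by (rule C1_ext_cong[OF open_Q _ C1_ext_inner[OF dx_u_C1[OF that] C1_ext_const[of _ _ c]]])
        (simp add: pduc dx_def)
    have pdduc: "pd (b, 0) (pd (b, 0) ?uc) z = dx b (dx b u) z \<bullet> c" if "z \<in> Q" "b \<in> Basis" for z b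
    proof -
      have "pd (b, 0) (pd (b, 0) ?uc) z = pd (b, 0) (\<lambda>z. dx b u z \<bullet> c) z"
        by (rule pd_cong[OF open_Q that(1)]) (simp add: pduc dx_def)
      then show ?thesis
        using pd_inner(1)[OF differentiable_flow(3)[OF that] differentiable_const, of "(b, 0)" c] by (simp add: dx_def)
    qed
    note It = bump_ibp[OF lr uc Basis_spacetime(2), of n c]
    note Ib = bump_ibp[OF lr C1_ext_mult[OF uc uc] Basis_spacetime(1), of _ n _ c]
    note Ip = bump_ibp[OF lr p_C1 Basis_spacetime(1)[OF c], of n]
    note Il = bump_ibp2[OF lr uc dduc Basis_spacetime(1), of _ n]
    have pdub: "pd (b, 0) (\<lambda>z. (u z \<bullet> b) * (u z \<bullet> c)) z = (dx b u z \<bullet> b) * (u z \<bullet> c) + (u z \<bullet> b) * (dx b u z \<bullet> c)"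
      if "z \<in> Q" for z b
      using pd_mult(1)[OF C1_ext_D(2)[OF uc[of b] that] C1_ext_D(2)[OF uc[of c] that], of "(b, 0)"]
      by (simp add: pduc[OF that] dx_def)
    define L where "L z = pd (0, 1) ?f z * ?uc z + (\<Sum>b\<in>Basis. pd (b, 0) ?f z * ((u z \<bullet> b) * ?uc z))
        + pd (c, 0) ?f z * p z + \<nu> * (\<Sum>b\<in>Basis. pd (b, 0) (pd (b, 0) ?f) z * ?uc z)" for z
    have test: "(\<lambda>z. ?f z *\<^sub>R c) \<in> test_functions Q" by (rule bump_test_function[OF lr])
    have fd: "?f differentiable (at z)" for z using C1_ext_D(2)[OF bump_C1_ext[of UNIV UNIV]] by simp
    have pdf: "pd v (\<lambda>z. ?f z *\<^sub>R c) = (\<lambda>z. pd v ?f z *\<^sub>R c)" for v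
      by (rule ext) (use pd_scaleR(1)[OF fd differentiable_const, where v=v] in simp)
    have fdd: "pd (b, 0) ?f differentiable (at z)" if "b \<in> Basis" for b z
    proof -
      have "smooth_upto UNIV UNIV ?f" unfolding smooth_upto_def by (simp add: bump_Ck)
      from smooth_upto_C1_ext_pd[OF this open_UNIV Basis_spacetime(1)[OF that]] show ?thesis
        by (rule C1_ext_D(2)) simp
    qed
    have pddf: "pd (b, 0) (\<lambda>z. pd (b, 0) ?f z *\<^sub>R c) z = pd (b, 0) (pd (b, 0) ?f) z *\<^sub>R c" if "b \<in> Basis" for b z
      using pd_scaleR(1)[OF fdd[OF that] differentiable_const, where v="(b, 0)"] by simp
    have cb: "(\<Sum>b\<in>Basis. (c \<bullet> b) * pd (b, 0) ?f z) = pd (c, 0) ?f z" for z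
    proof -
      have "(\<Sum>b\<in>Basis. (c \<bullet> b) * pd (b, 0) ?f z) = (\<Sum>b\<in>Basis. if b = c then pd (c, 0) ?f z else 0)"
        using c by (intro sum.cong) (auto simp: inner_Basis)
      then show ?thesis using c by simp
    qed
    have "(LINT z|lebesgue_on Q. L z) = (LINT z|lebesgue_on Q. u z \<bullet> dt (\<lambda>z. ?f z *\<^sub>R c) z
        + (\<Sum>b\<in>Basis. (u z \<bullet> b) * (u z \<bullet> dx b (\<lambda>z. ?f z *\<^sub>R c) z))
        + p z * divg (\<lambda>z. ?f z *\<^sub>R c) z + \<nu> * (u z \<bullet> laplace (\<lambda>z. ?f z *\<^sub>R c) z))"
      by (rule Bochner_Integration.integral_cong)
        (simp_all add: L_def dt_def dx_def divg_def laplace_def pdf pddf cb inner_sum_right ac_simps)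
    also have "\<dots> = 0" using sol test unfolding distributional_solution_def Let_def by blast
    finally have L0: "(LINT z|lebesgue_on Q. L z) = 0" .
    have "(LINT z|lebesgue_on Q. L z) = (LINT z|lebesgue_on Q. pd (0, 1) ?f z * ?uc z)
        + (\<Sum>b\<in>Basis. LINT z|lebesgue_on Q. pd (b, 0) ?f z * ((u z \<bullet> b) * ?uc z))
        + (LINT z|lebesgue_on Q. pd (c, 0) ?f z * p z)
        + \<nu> * (\<Sum>b\<in>Basis. LINT z|lebesgue_on Q. pd (b, 0) (pd (b, 0) ?f) z * ?uc z)"
      unfolding L_def using It(2) Ib(2) Ip(2) Il(2)
      by (simp add: Bochner_Integration.integral_sum)
    also have "\<dots> = - ((LINT z|lebesgue_on Q. ?f z * pd (0, 1) ?uc z)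
        + (\<Sum>b\<in>Basis. LINT z|lebesgue_on Q. ?f z * pd (b, 0) (\<lambda>z. (u z \<bullet> b) * ?uc z) z)
        + (LINT z|lebesgue_on Q. ?f z * pd (c, 0) p z)
        - \<nu> * (\<Sum>b\<in>Basis. LINT z|lebesgue_on Q. ?f z * pd (b, 0) (pd (b, 0) ?uc) z))"
      using It(1) Ib(1) Ip(1) Il(1) by (simp add: sum_negf)
    also have "\<dots> = - (LINT z|lebesgue_on Q. ?f z * pd (0, 1) ?uc z
        + (\<Sum>b\<in>Basis. ?f z * pd (b, 0) (\<lambda>z. (u z \<bullet> b) * ?uc z) z) + ?f z * pd (c, 0) p z
        - \<nu> * (\<Sum>b\<in>Basis. ?f z * pd (b, 0) (pd (b, 0) ?uc) z))"
      using It(3) Ib(3) Ip(3) Il(3) by (simp add: Bochner_Integration.integral_sum)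
    also have "(LINT z|lebesgue_on Q. ?f z * pd (0, 1) ?uc z
        + (\<Sum>b\<in>Basis. ?f z * pd (b, 0) (\<lambda>z. (u z \<bullet> b) * ?uc z) z) + ?f z * pd (c, 0) p z
        - \<nu> * (\<Sum>b\<in>Basis. ?f z * pd (b, 0) (pd (b, 0) ?uc) z)) = (LINT z|lebesgue_on Q. ?f z * R z)"
      by (rule Bochner_Integration.integral_cong)
        (simp_all add: R_def pduc pdub pdduc dt_def dx_def sum_distrib_left
          distrib_left right_diff_distrib mult.left_commute)
    finally show "(LINT z|lebesgue_on Q. ?f z * R z) = 0" using L0 by simp
  qed
  moreover have "(\<Sum>b\<in>Basis. (dx b u z \<bullet> b) * (u z \<bullet> c)) = 0"
    using div_free[OF z] by (simp add: divg_def sum_distrib_right[symmetric])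
  ultimately show ?thesis by (simp add: R_def sum.distrib laplace_def inner_sum_left)
qed

lemma energy_pointwise:
  assumes z: "z \<in> Q"
  shows "u z \<bullet> dt u z + (\<Sum>b\<in>Basis. (u z \<bullet> b) * (u z \<bullet> dx b u z + dx b p z)) = \<nu> * (u z \<bullet> laplace u z)"
proof -
  have "0 = (\<Sum>c\<in>Basis. (u z \<bullet> c) * (dt u z \<bullet> c + (\<Sum>b\<in>Basis. (u z \<bullet> b) * (dx b u z \<bullet> c)) + dx c p z - \<nu> * (laplace u z \<bullet> c)))"
    using momentum[OF z] by simp
  also have "\<dots> = (\<Sum>c\<in>Basis. (u z \<bullet> c) * (dt u z \<bullet> c))
      + (\<Sum>c\<in>Basis. \<Sum>b\<in>Basis. (u z \<bullet> b) * ((u z \<bullet> c) * (dx b u z \<bullet> c)))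
      + (\<Sum>c\<in>Basis. (u z \<bullet> c) * dx c p z) - \<nu> * (\<Sum>c\<in>Basis. (u z \<bullet> c) * (laplace u z \<bullet> c))"
    by (simp add: sum.distrib sum_subtractf sum_distrib_left distrib_left right_diff_distrib mult.left_commute)
  also have "(\<Sum>c\<in>Basis. \<Sum>b\<in>Basis. (u z \<bullet> b) * ((u z \<bullet> c) * (dx b u z \<bullet> c))) = (\<Sum>b\<in>Basis. (u z \<bullet> b) * (u z \<bullet> dx b u z))"
    by (subst sum.swap) (simp add: euclidean_inner[of "u z" "dx _ u z"] sum_distrib_left)
  finally show ?thesis
    by (simp add: euclidean_inner[of "u z" "dt u z"] euclidean_inner[of "u z" "laplace u z"] sum.distrib distrib_left)
qed


text \<open>No flux crosses the lateral boundary, where \<open>\<phi>\<close> may be nonzero: impermeability is inherited from the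
  zero trace.\<close>

lemma weak_div_free_upto_boundary:
  fixes \<phi> :: "'a \<times> real \<Rightarrow> real"
  assumes I: "{0<..<T} \<subseteq> I" "I \<subseteq> {0<..T}" and \<phi>: "C1_ext Q (closure \<Omega> \<times> I) \<phi>"
    and K: "compact K" "K \<subseteq> closure \<Omega> \<times> I" "\<forall>z\<in>Q - K. \<phi> z = 0"
  shows "(LINT z|lebesgue_on Q. u z \<bullet> grad \<phi> z) = 0"
proof -
  have u': "C1_ext Q (closure \<Omega> \<times> I) u" by (rule C1_ext_subset[OF u_C1]) (use I in auto)
  note ibp = spacetime_zero_trace_ibp[OF dom I(1) refl trace u' \<phi> K]

  have "(LINT z|lebesgue_on Q. u z \<bullet> grad \<phi> z) = (LINT z|lebesgue_on Q. (\<Sum>b\<in>Basis. (u z \<bullet> b) * dx b \<phi> z))"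
    by (rule Bochner_Integration.integral_cong) (simp_all add: grad_def inner_sum_right mult.commute)
  also have "\<dots> = (\<Sum>b\<in>Basis. LINT z|lebesgue_on Q. (u z \<bullet> b) * dx b \<phi> z)"
    using ibp(3) by (intro Bochner_Integration.integral_sum)
  also have "\<dots> = - (\<Sum>b\<in>Basis. LINT z|lebesgue_on Q. (dx b u z \<bullet> b) * \<phi> z)"
    unfolding sum_negf[symmetric]
  proof (rule sum.cong[OF refl])
    fix b :: 'a assume "b \<in> Basis"
    from ibp(1)[OF this, of b]
    show "(LINT z|lebesgue_on Q. (u z \<bullet> b) * dx b \<phi> z) = - (LINT z|lebesgue_on Q. (dx b u z \<bullet> b) * \<phi> z)"
      by linarith
  qed
  also have "\<dots> = - (LINT z|lebesgue_on Q. (\<Sum>b\<in>Basis. (dx b u z \<bullet> b) * \<phi> z))"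
    by (subst Bochner_Integration.integral_sum) (simp_all add: ibp(2))
  also have "(LINT z|lebesgue_on Q. (\<Sum>b\<in>Basis. (dx b u z \<bullet> b) * \<phi> z)) = (LINT z|lebesgue_on Q. 0)"
    using div_free by (intro Bochner_Integration.integral_cong) (auto simp: divg_def sum_distrib_right[symmetric])
  finally show ?thesis by simp
qed

text \<open>The equation of \<open>energy_pointwise\<close>, multiplied by \<open>\<phi>\<close> and integrated.  In each spatial integration by
  parts one component of \<open>u\<close> plays the role of the function with zero trace and all other factors
  form the multiplier.\<close>

lemma local_energy_identity:
  fixes \<phi> :: "'a \<times> real \<Rightarrow> real"
  assumes \<phi>: "\<phi> \<in> C1c Q X"
  shows "(LINT z|lebesgue_on Q. (norm (u z))\<^sup>2 / 2 * dt \<phi> z + ((norm (u z))\<^sup>2 / 2 + p z) * (u z \<bullet> grad \<phi> z))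
    = (LINT x|lebesgue_on \<Omega>. \<phi> (x, T) * (norm (u (x, T)))\<^sup>2) / 2
      + (LINT z|lebesgue_on Q. \<phi> z * (\<nu> * grad_norm_sq u z))
      + \<nu> * (LINT z|lebesgue_on Q. (\<Sum>b\<in>Basis. dx b \<phi> z * (u z \<bullet> dx b u z)))"
proof -
  have \<phi>Ck: "Ck 1 Q X \<phi>" and \<phi>s: "compact_support_in X \<phi>"
    using \<phi> unfolding C1c_def by blast+
  have \<phi>1: "C1_ext Q X \<phi>" and \<phi>c: "continuous_on X \<phi>"
    using C1_extI[OF \<phi>Ck] Ck_continuous[OF \<phi>Ck] .
  obtain K where K: "compact K" "K \<subseteq> X" and \<phi>K': "\<forall>z\<in>X - K. \<phi> z = 0"
    using \<phi>s unfolding compact_support_in_def by (elim exE conjE)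
  have \<phi>K: "\<phi> z = 0" if "z \<in> X - K" for z using \<phi>K' that by (rule bspec)
  have \<phi>0: "\<phi> z = 0" if "z \<in> Q - K" for z
    by (rule \<phi>K) (use Q_subset_X that in \<open>simp only: Diff_iff subset_iff simp_thms\<close>)
  have oK: "open (Q - K)" using open_Q K(1) compact_imp_closed by blast
  have d\<phi>0: "dx b \<phi> z = 0" "dt \<phi> z = 0" if "z \<in> Q - K" for z b
    unfolding dx_def dt_def by (rule pd_eq_0[OF oK that]; rule \<phi>0; assumption)+
  note ce\<phi> = C1_ext_D(1)[OF \<phi>1] C1_ext_D(3)[OF \<phi>1 Basis_spacetime(1), folded dx_def]
    C1_ext_D(3)[OF \<phi>1 Basis_spacetime(2), folded dt_def]
  note ce = cont_ext_flow ce\<phi>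
  have int: "integrable (lebesgue_on Q) f" if "cont_ext Q X f" "\<And>z. z \<in> Q - K \<Longrightarrow> f z = 0" for f :: "_ \<Rightarrow> real"
    by (rule integrable_cont_ext[OF open_Q Q_subset_X that(1) K that(2)])
  define e where "e z = (u z \<bullet> u z) / 2" for z
  have norm_e: "(norm (u z))\<^sup>2 / 2 = e z" for z unfolding e_def by (simp add: power2_norm_eq_inner)
  have e1: "C1_ext Q X e"
    unfolding e_def using C1_ext_mult[OF C1_ext_inner[OF u_C1 u_C1] C1_ext_const[of _ _ "1/2"]] by simp
  have pde: "pd v e z = u z \<bullet> pd v u z" if "z \<in> Q" for v z
  proof -
    have d: "u differentiable (at z)" by (rule differentiable_flow[OF that])
    have "pd v (\<lambda>z. (u z \<bullet> u z) / 2) z = (pd v (\<lambda>z. u z \<bullet> u z) z) / 2"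
      using pd_mult(1)[OF pd_inner(2)[OF d d] differentiable_const, of v "1/2"] by simp
    then show ?thesis
      using pd_inner(1)[OF d d, of v] unfolding e_def[abs_def] by (simp add: inner_commute[of "pd v u z"])
  qed
  have cee: "cont_ext Q X e" by (rule C1_ext_D[OF e1])
  define L where "L = lebesgue_on Q"

  \<comment> \<open>\<open>\<phi>\<close> vanishes near \<open>t = 0\<close>, so only the final time contributes a boundary term\<close>
  define A where "A z = \<phi> z * (u z \<bullet> dt u z)" for z
  define A' where "A' z = dt \<phi> z * e z" for z
  have iA: "integrable L A" "integrable L A'"
    unfolding L_def A_def A'_def by (rule int; (intro cont_ext_mult cont_ext_inner ce cee | simp add: \<phi>0 d\<phi>0))+
  have "continuous_on X (\<lambda>z. \<phi> z * e z)"
    unfolding e_def using \<phi>c smooth_u unfolding smooth_upto_def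
    by (intro continuous_intros) (auto intro: Ck_continuous)
  note time = spacetime_time_integral[OF dom T C1_ext_mult[OF \<phi>1 e1] this K]
  have "(LINT z|L. dt (\<lambda>z. \<phi> z * e z) z) = (LINT z|L. A z + A' z)"
    unfolding L_def
  proof (rule Bochner_Integration.integral_cong[OF refl])
    fix z assume "z \<in> space (lebesgue_on Q)"
    then have z: "z \<in> Q" by simp
    show "dt (\<lambda>z. \<phi> z * e z) z = A z + A' z"
      using pd_mult(1)[OF C1_ext_D(2)[OF \<phi>1 z] C1_ext_D(2)[OF e1 z], of "(0, 1)"]
      by (simp add: A_def A'_def dt_def pde[OF z])
  qed
  then have timeI: "(LINT z|L. A z) + (LINT z|L. A' z) = (LINT x|lebesgue_on \<Omega>. \<phi> (x, T) * e (x, T))"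
    using time(2) iA \<phi>K unfolding L_def by simp

  \<comment> \<open>kinetic energy and pressure are carried by the same divergence-free field, so \<open>\<phi> (e + p)\<close> can be
    used as a test function for incompressibility\<close>
  define B where "B b z = (u z \<bullet> b) * (\<phi> z * (u z \<bullet> dx b u z + dx b p z))" for b z
  define B' where "B' b z = (u z \<bullet> b) * (dx b \<phi> z * (e z + p z))" for b z
  have iB: "integrable L (B b)" "integrable L (B' b)" if "b \<in> Basis" for b
    unfolding L_def B_def B'_def
    by (rule int; (intro cont_ext_mult cont_ext_inner cont_ext_add ce cee cont_ext_const that | simp add: \<phi>0 d\<phi>0))+
  have ep: "C1_ext Q X (\<lambda>z. e z + p z)"
    unfolding C1_ext_def
  proof (intro conjI ballI)
    show "cont_ext Q X (\<lambda>z. e z + p z)" by (intro cont_ext_add cee ce)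
    show "(\<lambda>z. e z + p z) differentiable at z" if "z \<in> Q" for z
      by (intro differentiable_add C1_ext_D(2)[OF e1 that] C1_ext_D(2)[OF p_C1 that])
    show "cont_ext Q X (pd v (\<lambda>z. e z + p z))" if v: "v \<in> Basis" for v
    proof -
      have "pd v (\<lambda>z. e z + p z) z = pd v e z + pd v p z" if "z \<in> Q" for z
        by (rule pd_add[OF C1_ext_D(2)[OF e1 that] C1_ext_D(2)[OF p_C1 that]])
      with cont_ext_add[OF C1_ext_D(3)[OF e1 v] C1_ext_D(3)[OF p_C1 v]] show ?thesis
        using cont_ext_cong[of Q "pd v (\<lambda>z. e z + p z)" "\<lambda>z. pd v e z + pd v p z" X] by blast
    qed
  qed
  have "0 = (LINT z|L. u z \<bullet> grad (\<lambda>z. \<phi> z * (e z + p z)) z)"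
    unfolding L_def
    by (rule weak_div_free_upto_boundary[where I="{0<..T}" and K=K, symmetric])
      (use K \<phi>0 in \<open>auto intro!: C1_ext_mult[OF \<phi>1 ep]\<close>)
  also have "\<dots> = (LINT z|L. (\<Sum>b\<in>Basis. B b z + B' b z))"
    unfolding L_def
  proof (rule Bochner_Integration.integral_cong[OF refl])
    fix z assume "z \<in> space (lebesgue_on Q)"
    then have z: "z \<in> Q" by simp
    have "dx b (\<lambda>z. \<phi> z * (e z + p z)) z = \<phi> z * (u z \<bullet> dx b u z + dx b p z) + dx b \<phi> z * (e z + p z)" for b
      using pd_mult(1)[OF C1_ext_D(2)[OF \<phi>1 z] C1_ext_D(2)[OF ep z], of "(b, 0)"]
        pd_add[OF C1_ext_D(2)[OF e1 z] C1_ext_D(2)[OF p_C1 z], of "(b, 0)"]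
      by (simp add: dx_def pde[OF z])
    then show "u z \<bullet> grad (\<lambda>z. \<phi> z * (e z + p z)) z = (\<Sum>b\<in>Basis. B b z + B' b z)"
      by (simp add: grad_def inner_sum_right B_def B'_def algebra_simps)
  qed
  also have "\<dots> = (LINT z|L. (\<Sum>b\<in>Basis. B b z)) + (LINT z|L. (\<Sum>b\<in>Basis. B' b z))"
    using iB by (simp add: sum.distrib)
  finally have transp: "(LINT z|L. (\<Sum>b\<in>Basis. B b z)) = - (LINT z|L. (\<Sum>b\<in>Basis. B' b z))" by simp

  \<comment> \<open>only one derivative is moved: a second integration by parts would involve the boundary values of
    the gradient, which need not vanish\<close>
  define C where "C b z = \<phi> z * (u z \<bullet> dx b (dx b u) z)" for b z
  define C' where "C' b z = \<phi> z * (norm (dx b u z))\<^sup>2" for b z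
  define C'' where "C'' b z = dx b \<phi> z * (u z \<bullet> dx b u z)" for b z
  have iC: "integrable L (C b)" "integrable L (C' b)" "integrable L (C'' b)" if "b \<in> Basis" for b
    unfolding L_def C_def C'_def C''_def
    by (rule int; (intro cont_ext_mult cont_ext_inner cont_ext_power cont_ext_norm ce cee cont_ext_const that
          | simp add: \<phi>0 d\<phi>0))+
  have visc: "(LINT z|L. C' b z) = - (LINT z|L. C b z) - (LINT z|L. C'' b z)" if b: "b \<in> Basis" for b
  proof -
    have g: "C1_ext Q X (\<lambda>z. \<phi> z * (dx b u z \<bullet> c))" for c
      by (rule C1_ext_mult[OF \<phi>1 C1_ext_inner[OF dx_u_C1[OF b] C1_ext_const]])
    have g0: "\<forall>z\<in>Q - K. \<phi> z * (dx b u z \<bullet> c) = 0" for c using \<phi>0 by simp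

    have sub: "{0<..<T} \<subseteq> {0<..T}" by auto
    note ibp = spacetime_zero_trace_ibp[OF dom sub refl trace u_C1 g K g0 b]
    have "(LINT z|L. C' b z) = (LINT z|L. (\<Sum>c\<in>Basis. (dx b u z \<bullet> c) * (\<phi> z * (dx b u z \<bullet> c))))"
      unfolding L_def C'_def
      by (rule Bochner_Integration.integral_cong)
        (simp_all add: power2_norm_eq_inner euclidean_inner[of "dx b u _" "dx b u _"] sum_distrib_left mult.left_commute)
    also have "\<dots> = (\<Sum>c\<in>Basis. - (LINT z|L. (u z \<bullet> c) * dx b (\<lambda>z. \<phi> z * (dx b u z \<bullet> c)) z))"
      unfolding L_def by (subst Bochner_Integration.integral_sum) (simp_all add: ibp(1,2))
    also have "\<dots> = - (LINT z|L. (\<Sum>c\<in>Basis. (u z \<bullet> c) * dx b (\<lambda>z. \<phi> z * (dx b u z \<bullet> c)) z))"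
      unfolding L_def by (subst Bochner_Integration.integral_sum) (simp_all add: ibp(3) sum_negf)
    also have "(LINT z|L. (\<Sum>c\<in>Basis. (u z \<bullet> c) * dx b (\<lambda>z. \<phi> z * (dx b u z \<bullet> c)) z)) = (LINT z|L. C b z + C'' b z)"
      unfolding L_def
    proof (rule Bochner_Integration.integral_cong[OF refl])
      fix z assume "z \<in> space (lebesgue_on Q)"
      then have z: "z \<in> Q" by simp
      have "dx b (\<lambda>z. \<phi> z * (dx b u z \<bullet> c)) z = \<phi> z * (dx b (dx b u) z \<bullet> c) + dx b \<phi> z * (dx b u z \<bullet> c)" for c
        using pd_mult(1)[OF C1_ext_D(2)[OF \<phi>1 z] pd_inner(2)[OF differentiable_flow(3)[OF z b] differentiable_const[of c]], of "(b, 0)"]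
          pd_inner(1)[OF differentiable_flow(3)[OF z b] differentiable_const[of c], of "(b, 0)"]
        by (simp add: dx_def)
      then show "(\<Sum>c\<in>Basis. (u z \<bullet> c) * dx b (\<lambda>z. \<phi> z * (dx b u z \<bullet> c)) z) = C b z + C'' b z"
        by (simp add: C_def C''_def euclidean_inner[of "u z" "dx b u z"] euclidean_inner[of "u z" "dx b (dx b u) z"]
            sum_distrib_left sum.distrib[symmetric] algebra_simps)
    qed
    finally show ?thesis using iC[OF b] by simp
  qed

  have "(LINT z|L. A z + (\<Sum>b\<in>Basis. B b z) - \<nu> * (\<Sum>b\<in>Basis. C b z)) = (LINT z|L. 0)"
    unfolding L_def
  proof (rule Bochner_Integration.integral_cong[OF refl])
    fix z assume "z \<in> space (lebesgue_on Q)"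
    then have z: "z \<in> Q" by simp
    have "A z + (\<Sum>b\<in>Basis. B b z) - \<nu> * (\<Sum>b\<in>Basis. C b z)
      = \<phi> z * (u z \<bullet> dt u z + (\<Sum>b\<in>Basis. (u z \<bullet> b) * (u z \<bullet> dx b u z + dx b p z)) - \<nu> * (u z \<bullet> laplace u z))"
      by (simp add: A_def B_def C_def laplace_def inner_sum_right sum_distrib_left algebra_simps)
    then show "A z + (\<Sum>b\<in>Basis. B b z) - \<nu> * (\<Sum>b\<in>Basis. C b z) = 0"
      using energy_pointwise[OF z] by simp
  qed
  then have main: "(LINT z|L. A z) + (LINT z|L. (\<Sum>b\<in>Basis. B b z)) - \<nu> * (\<Sum>b\<in>Basis. LINT z|L. C b z) = 0"
    using iA iB iC by (simp add: Bochner_Integration.integral_sum)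
  have "(LINT z|L. (norm (u z))\<^sup>2 / 2 * dt \<phi> z + ((norm (u z))\<^sup>2 / 2 + p z) * (u z \<bullet> grad \<phi> z))
      = (LINT z|L. A' z + (\<Sum>b\<in>Basis. B' b z))"
    by (rule Bochner_Integration.integral_cong)
      (simp_all add: norm_e A'_def B'_def grad_def inner_sum_right sum_distrib_left mult.commute mult.left_commute)
  also have "\<dots> = (LINT z|L. A' z) + (LINT z|L. (\<Sum>b\<in>Basis. B' b z))"
    using iA iB by simp
  also have "\<dots> = (LINT x|lebesgue_on \<Omega>. \<phi> (x, T) * e (x, T)) - (LINT z|L. A z) - (LINT z|L. (\<Sum>b\<in>Basis. B b z))"
    using timeI transp by linarith
  also have "\<dots> = (LINT x|lebesgue_on \<Omega>. \<phi> (x, T) * e (x, T)) - \<nu> * (\<Sum>b\<in>Basis. LINT z|L. C b z)"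
    using main by linarith
  also have "(\<Sum>b\<in>Basis. LINT z|L. C b z) = - (\<Sum>b\<in>Basis. LINT z|L. C' b z) - (\<Sum>b\<in>Basis. LINT z|L. C'' b z)"
    using visc by (simp add: sum_subtractf[symmetric] sum_negf[symmetric])
  also have "(\<Sum>b\<in>Basis. LINT z|L. C' b z) = (LINT z|L. (\<Sum>b\<in>Basis. C' b z))"
    using iC by (simp add: Bochner_Integration.integral_sum)
  also have "(\<Sum>b\<in>Basis. LINT z|L. C'' b z) = (LINT z|L. (\<Sum>b\<in>Basis. C'' b z))"
    using iC by (simp add: Bochner_Integration.integral_sum)
  also have "(LINT x|lebesgue_on \<Omega>. \<phi> (x, T) * e (x, T)) = (LINT x|lebesgue_on \<Omega>. \<phi> (x, T) * (norm (u (x, T)))\<^sup>2) / 2"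
    by (simp add: norm_e[symmetric])
  also have "(LINT z|L. (\<Sum>b\<in>Basis. C'' b z)) = (LINT z|L. (\<Sum>b\<in>Basis. dx b \<phi> z * (u z \<bullet> dx b u z)))"
    by (simp add: C''_def)
  also have "(LINT z|L. (\<Sum>b\<in>Basis. C' b z)) = (LINT z|L. \<phi> z * grad_norm_sq u z)"
    by (simp add: C'_def grad_norm_sq_def sum_distrib_left)
  finally show ?thesis
    unfolding L_def by (simp add: mult.left_commute right_diff_distrib)
qed

end


section \<open>Products of weakly and strongly convergent sequences\<close>

text \<open>A form of Phillips' lemma.  If the diagonal stayed away from zero, one could choose indices
  such that in each chosen row the diagonal entry dominates both the earlier chosen columns (which
  tend to zero) and the tail of the row (which is summable); the sums over the set \<open>J\<close> of chosen columns
  would then not tend to zero.\<close>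

lemma gliding_hump:
  fixes a :: "nat \<Rightarrow> nat \<Rightarrow> real"
  assumes rows: "\<And>k. summable (\<lambda>j. \<bar>a k j\<bar>)"
    and subs: "\<And>J. (\<lambda>k. \<Sum>j. indicator J j * a k j) \<longlonglongrightarrow> 0"
  shows "(\<lambda>k. a k k) \<longlonglongrightarrow> 0"
proof (rule ccontr)
  assume "\<not> (\<lambda>k. a k k) \<longlonglongrightarrow> 0"
  then obtain d where d: "0 < d" "\<And>N. \<exists>k\<ge>N. d \<le> \<bar>a k k\<bar>"
    unfolding LIMSEQ_iff by (auto simp: not_less)
  have col: "(\<lambda>k. a k j) \<longlonglongrightarrow> 0" for j
  proof -
    have "(\<Sum>i. indicator {j} i * a k i) = a k j" for k
      by (subst suminf_finite[of "{j}"]) auto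
    then show ?thesis using subs[of "{j}"] by simp
  qed
  have "\<exists>m>n. d \<le> \<bar>a m m\<bar> \<and> (\<Sum>j\<le>n. \<bar>a m j\<bar>) < d / 4 \<and> (\<Sum>j. \<bar>a n (j + m)\<bar>) < d / 4" for n
  proof -
    have "(\<lambda>m. \<Sum>j\<le>n. \<bar>a m j\<bar>) \<longlonglongrightarrow> (\<Sum>j\<le>n. \<bar>0\<bar>)"
      by (intro tendsto_sum tendsto_rabs col)
    then have "eventually (\<lambda>m. (\<Sum>j\<le>n. \<bar>a m j\<bar>) < d / 4) sequentially"
      using d(1) by (intro order_tendstoD) auto
    then obtain N1 where N1: "\<And>m. N1 \<le> m \<Longrightarrow> (\<Sum>j\<le>n. \<bar>a m j\<bar>) < d / 4"
      unfolding eventually_sequentially by blast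
    obtain N2 where N2: "\<And>m. N2 \<le> m \<Longrightarrow> norm (\<Sum>j. \<bar>a n (j + m)\<bar>) < d / 4"
      using suminf_exist_split[OF _ rows[of n], of "d / 4"] d(1) by auto
    obtain m where m: "max (Suc n) (max N1 N2) \<le> m" "d \<le> \<bar>a m m\<bar>" using d(2) by blast
    show ?thesis
      using m N1[of m] N2[of m] by (intro exI[of _ m]) (auto simp: abs_less_iff)
  qed
  then obtain f where f: "\<And>n. n < f n" "\<And>n. d \<le> \<bar>a (f n) (f n)\<bar>"
    "\<And>n. (\<Sum>j\<le>n. \<bar>a (f n) j\<bar>) < d / 4" "\<And>n. (\<Sum>j. \<bar>a n (j + f n)\<bar>) < d / 4"
    by metis
  \<comment> \<open>the start \<open>0\<close> is arbitrary: from index \<open>1\<close> on all diagonal entries are large\<close>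
  define r where "r i = (f ^^ i) 0" for i
  have rS: "r (Suc i) = f (r i)" for i unfolding r_def by simp
  have mono: "strict_mono r" unfolding strict_mono_Suc_iff using rS f(1) by simp
  have hump: "d / 2 \<le> \<bar>\<Sum>j. indicator (range r) j * a (r (Suc i)) j\<bar>" for i
  proof -
    define k where "k = r (Suc i)"
    define g where "g j = indicator (range r) j * a k j" for j
    have gle: "\<bar>g j\<bar> \<le> \<bar>a k j\<bar>" for j unfolding g_def by (simp add: indicator_def)
    have sg: "summable g"
      by (rule summable_comparison_test'[OF rows[of k], of 0]) (use gle in simp)
    have k: "r i < k" "k < f k" unfolding k_def rS using f(1) by simp_all
    have g0: "g j = 0" if "r i < j" "j < f k" "j \<noteq> k" for j
    proof -
      have "j \<notin> range r"
      proof
        assume "j \<in> range r"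
        then obtain m where m: "j = r m" by blast
        have "r i < r m" "r m < r (Suc (Suc i))" "m \<noteq> Suc i"
          using that m by (auto simp: k_def rS)
        then have "i < m" "m < Suc (Suc i)" "m \<noteq> Suc i"
          using strict_mono_less[OF mono] by blast+
        then show False by linarith
      qed
      then show ?thesis by (simp add: g_def)
    qed
    have "(\<Sum>j<f k. g j) = (\<Sum>j\<in>insert k {..r i}. g j)"
      by (rule sum.mono_neutral_right) (use k g0 in \<open>auto simp: not_le\<close>)
    also have "\<dots> = a k k + (\<Sum>j\<le>r i. g j)"
      using k by (subst sum.insert) (auto simp: g_def k_def)
    finally have split: "suminf g = (\<Sum>j. g (j + f k)) + (a k k + (\<Sum>j\<le>r i. g j))"
      using suminf_split_initial_segment[OF sg, of "f k"] by simp
    have "\<bar>\<Sum>j\<le>r i. g j\<bar> \<le> (\<Sum>j\<le>r i. \<bar>a k j\<bar>)"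
      by (rule order_trans[OF sum_abs]) (intro sum_mono gle)
    also have "\<dots> < d / 4" using f(3)[of "r i"] by (simp add: k_def rS)
    finally have b1: "\<bar>\<Sum>j\<le>r i. g j\<bar> < d / 4" .
    have st: "summable (\<lambda>j. \<bar>a k (j + f k)\<bar>)"
      using summable_ignore_initial_segment[OF rows[of k], of "f k"] .
    have st': "summable (\<lambda>j. norm (g (j + f k)))"
      by (rule summable_comparison_test'[OF st, of 0]) (use gle in simp)
    have "\<bar>\<Sum>j. g (j + f k)\<bar> \<le> (\<Sum>j. \<bar>g (j + f k)\<bar>)"
      using summable_norm[OF st'] by simp
    also have "\<dots> \<le> (\<Sum>j. \<bar>a k (j + f k)\<bar>)"
      using st' st gle by (intro suminf_le) auto
    also have "\<dots> < d / 4" by (rule f(4))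
    finally have b2: "\<bar>\<Sum>j. g (j + f k)\<bar> < d / 4" .
    have "d \<le> \<bar>a k k\<bar>" using f(2) by (simp add: k_def rS)
    then have "d / 2 \<le> \<bar>suminf g\<bar>" unfolding split using b1 b2 by linarith
    then show ?thesis unfolding g_def k_def .
  qed
  have "eventually (\<lambda>k. \<bar>\<Sum>j. indicator (range r) j * a k j\<bar> < d / 2) sequentially"
    using tendsto_rabs[OF subs[of "range r"]] d(1) by (intro order_tendstoD) auto
  then obtain N where N: "\<And>k. N \<le> k \<Longrightarrow> \<bar>\<Sum>j. indicator (range r) j * a k j\<bar> < d / 2"
    unfolding eventually_sequentially by blast
  have "N \<le> r (Suc N)" using strict_mono_imp_increasing[OF mono, of "Suc N"] by simp
  from N[OF this] hump[of N] show False by simp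
qed

text \<open>This does the work of a uniform bound on \<open>q\<close>: since the sum of the \<open>|w j|\<close> is dominated by \<open>D\<close>, each
  subseries of the \<open>w j\<close> is an admissible test function for the weak convergence of \<open>q\<close>, which is what
  \<open>gliding_hump\<close> asks of the array of all products.\<close>

lemma weak_strong_product_tendsto_0:
  fixes q w :: "nat \<Rightarrow> 'x \<Rightarrow> real"
  assumes q[measurable]: "\<And>k. q k \<in> borel_measurable M" and w[measurable]: "\<And>j. w j \<in> borel_measurable M"
    and D[measurable]: "D \<in> borel_measurable M"
    and sumw: "\<And>n x. x \<in> space M \<Longrightarrow> (\<Sum>j<n. \<bar>w j x\<bar>) \<le> D x"
    and qD: "\<And>k. integrable M (\<lambda>x. \<bar>q k x\<bar> * D x)"
    and weak: "\<And>h. h \<in> borel_measurable M \<Longrightarrow> (\<And>x. x \<in> space M \<Longrightarrow> \<bar>h x\<bar> \<le> D x) \<Longrightarrow>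
      (\<lambda>k. LINT x|M. q k x * h x) \<longlonglongrightarrow> 0"
  shows "(\<lambda>k. LINT x|M. q k x * w k x) \<longlonglongrightarrow> 0"
proof -
  have Sw: "summable (\<lambda>j. \<bar>w j x\<bar>)" if "x \<in> space M" for x
    by (rule summableI_nonneg_bounded) (use sumw[OF that] in auto)
  have wD: "\<bar>w j x\<bar> \<le> D x" if "x \<in> space M" for j x
  proof -
    have "\<bar>w j x\<bar> \<le> (\<Sum>i<Suc j. \<bar>w i x\<bar>)" by (rule member_le_sum) auto
    then show ?thesis using sumw[OF that, of "Suc j"] by linarith
  qed
  have int: "integrable M (\<lambda>x. q k x * w j x)" for k j
    by (rule Bochner_Integration.integrable_bound[OF qD[of k]])
      (auto simp: abs_mult intro!: AE_I2 mult_left_mono order_trans[OF wD abs_ge_self])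
  define a where "a k j = (LINT x|M. q k x * w j x)" for k j
  define b where "b k j = (LINT x|M. \<bar>q k x * w j x\<bar>)" for k j
  have ab: "\<bar>a k j\<bar> \<le> b k j" for k j unfolding a_def b_def using integral_norm_bound[of M "\<lambda>x. q k x * w j x"] by simp
  have sb: "summable (b k)" for k
  proof (rule summableI_nonneg_bounded)
    show "0 \<le> b k j" for j unfolding b_def by simp
    fix n
    have "(\<Sum>j<n. b k j) = (LINT x|M. (\<Sum>j<n. \<bar>q k x * w j x\<bar>))"
      unfolding b_def using int by (subst Bochner_Integration.integral_sum) auto
    also have "\<dots> \<le> (LINT x|M. \<bar>q k x\<bar> * D x)"
    proof (rule integral_mono)
      show "integrable M (\<lambda>x. \<Sum>j<n. \<bar>q k x * w j x\<bar>)" using int by auto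
      show "(\<Sum>j<n. \<bar>q k x * w j x\<bar>) \<le> \<bar>q k x\<bar> * D x" if "x \<in> space M" for x
        using sumw[OF that, of n] by (simp add: abs_mult sum_distrib_left[symmetric] mult_left_mono)
    qed (rule qD)
    finally show "(\<Sum>j<n. b k j) \<le> (LINT x|M. \<bar>q k x\<bar> * D x)" .
  qed
  have "(\<lambda>k. a k k) \<longlonglongrightarrow> 0"
  proof (rule gliding_hump[of a])
    show "summable (\<lambda>j. \<bar>a k j\<bar>)" for k
      by (rule summable_comparison_test'[OF sb[of k], of 0]) (use ab in simp)
    fix J :: "nat set"
    define h where "h x = (\<Sum>j. indicator J j * w j x)" for x
    have hm: "h \<in> borel_measurable M" unfolding h_def by measurable
    have sJ: "summable (\<lambda>j. norm (indicator J j * w j x))" if "x \<in> space M" for x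
      by (rule summable_comparison_test'[OF Sw[OF that], of 0]) (simp add: indicator_def)
    have hD: "\<bar>h x\<bar> \<le> D x" if x: "x \<in> space M" for x
    proof -
      have "\<bar>h x\<bar> \<le> (\<Sum>j. norm (indicator J j * w j x))"
        unfolding h_def using summable_norm[OF sJ[OF x]] by simp
      also have "\<dots> \<le> (\<Sum>j. \<bar>w j x\<bar>)"
        by (rule suminf_le[OF _ sJ[OF x] Sw[OF x]]) (simp add: indicator_def)
      also have "\<dots> \<le> D x" by (rule suminf_le_const[OF Sw[OF x]]) (rule sumw[OF x])
      finally show ?thesis .
    qed
    have "(\<Sum>j. indicator J j * a k j) = (LINT x|M. q k x * h x)" for k
    proof -
      have i: "integrable M (\<lambda>x. indicator J j * (q k x * w j x))" for j by (rule integrable_mult_right[OF int])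
      have "(LINT x|M. (\<Sum>j. indicator J j * (q k x * w j x))) = (\<Sum>j. LINT x|M. indicator J j * (q k x * w j x))"
      proof (rule integral_suminf[OF i])
        show "AE x in M. summable (\<lambda>j. norm (indicator J j * (q k x * w j x)))"
        proof (rule AE_I2)
          fix x assume "x \<in> space M"
          from summable_mult[OF sJ[OF this], of "\<bar>q k x\<bar>"]
          show "summable (\<lambda>j. norm (indicator J j * (q k x * w j x)))"
            by (simp add: abs_mult mult.left_commute)
        qed
        show "summable (\<lambda>j. LINT x|M. norm (indicator J j * (q k x * w j x)))"
          by (rule summable_comparison_test'[OF sb[of k], of 0]) (simp add: b_def abs_mult indicator_def)
      qed
      moreover have "(\<Sum>j. indicator J j * (q k x * w j x)) = q k x * h x" if "x \<in> space M" for x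
        unfolding h_def using suminf_mult[OF summable_norm_cancel[OF sJ[OF that]], of "q k x"]
        by (simp add: mult.left_commute)
      then have "(LINT x|M. (\<Sum>j. indicator J j * (q k x * w j x))) = (LINT x|M. q k x * h x)"
        by (intro Bochner_Integration.integral_cong) auto
      ultimately show ?thesis unfolding a_def by simp
    qed
    then show "(\<lambda>k. \<Sum>j. indicator J j * a k j) \<longlonglongrightarrow> 0" using weak[OF hm hD] by simp
  qed
  then show ?thesis unfolding a_def .
qed

text \<open>Choose \<open>r\<close> such that the third moment of \<open>w (r k)\<close> is at most \<open>64\<^sup>-\<^sup>k\<close>.  Then \<open>S = \<Sum>k. 8\<^sup>k (w (r k))\<^sup>3\<close> is integrable, so
  \<open>w (r k) \<le> 2\<^sup>-\<^sup>k S\<^sup>1\<^sup>/\<^sup>3\<close> almost everywhere, and the sum of these bounds is \<open>2 S\<^sup>1\<^sup>/\<^sup>3\<close>.\<close>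

lemma summably_dominated_subsequence:
  fixes w :: "nat \<Rightarrow> 'x \<Rightarrow> real"
  assumes w[measurable]: "\<And>k. w k \<in> borel_measurable M" and nonneg: "\<And>k x. 0 \<le> w k x"
    and int: "\<And>k. integrable M (\<lambda>x. w k x ^ 3)" and lim: "(\<lambda>k. LINT x|M. w k x ^ 3) \<longlonglongrightarrow> 0"
  obtains r :: "nat \<Rightarrow> nat" and D where "strict_mono r" "D \<in> borel_measurable M" "\<And>x. 0 \<le> D x" "integrable M (\<lambda>x. D x ^ 3)"
    "AE x in M. \<forall>n. (\<Sum>k<n. w (r k) x) \<le> D x"
proof -
  have "\<exists>N. \<forall>n\<ge>N. (LINT x|M. w n x ^ 3) < (1 / 64) ^ k" for k :: nat
    using order_tendstoD(2)[OF lim, of "(1 / 64) ^ k"] unfolding eventually_sequentially by simp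
  then obtain N where N: "\<And>k n. N k \<le> n \<Longrightarrow> (LINT x|M. w n x ^ 3) < (1 / 64) ^ k" by metis
  define r where "r = rec_nat (N 0) (\<lambda>k m. max (Suc m) (N (Suc k)))"
  have rS: "r (Suc k) = max (Suc (r k)) (N (Suc k))" for k unfolding r_def by simp
  have mono: "strict_mono r" unfolding strict_mono_Suc_iff by (simp add: rS less_max_iff_disj)
  have "N k \<le> r k" for k by (cases k) (simp_all add: rS r_def)
  then have small: "(LINT x|M. w (r k) x ^ 3) \<le> (1 / 64) ^ k" for k using N less_imp_le by blast
  define f where "f x = (\<Sum>k. ennreal (8 ^ k * w (r k) x ^ 3))" for x
  have fm[measurable]: "f \<in> borel_measurable M" unfolding f_def by measurable
  have "(\<integral>\<^sup>+x. f x \<partial>M) = (\<Sum>k. \<integral>\<^sup>+x. ennreal (8 ^ k * w (r k) x ^ 3) \<partial>M)"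
    unfolding f_def by (rule nn_integral_suminf) measurable
  also have "\<dots> \<le> (\<Sum>k. ennreal ((1 / 8) ^ k))"
  proof (rule suminf_le)
    fix k
    have "(\<integral>\<^sup>+x. ennreal (8 ^ k * w (r k) x ^ 3) \<partial>M) = ennreal (8 ^ k * (LINT x|M. w (r k) x ^ 3))"
      using int[of "r k"] nonneg by (subst nn_integral_eq_integral) auto
    also have "8 ^ k * (LINT x|M. w (r k) x ^ 3) \<le> 8 ^ k * (1 / 64) ^ k"
      using small by (intro mult_left_mono) auto
    also have "8 ^ k * (1 / 64) ^ k = (1 / 8 :: real) ^ k" by (simp add: power_mult_distrib[symmetric])
    finally show "(\<integral>\<^sup>+x. ennreal (8 ^ k * w (r k) x ^ 3) \<partial>M) \<le> ennreal ((1 / 8) ^ k)"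
      by (simp add: ennreal_leI)
  qed auto
  also have "\<dots> < \<infinity>"
    by (subst suminf_ennreal2) (auto intro!: summable_geometric)
  finally have fin: "(\<integral>\<^sup>+x. f x \<partial>M) < \<infinity>" .
  then have aefin: "AE x in M. f x \<noteq> \<infinity>" by (intro nn_integral_PInf_AE fm) auto
  define S where "S x = enn2real (f x)" for x
  define D where "D x = 2 * root 3 (S x)" for x
  show ?thesis
  proof (rule that[of r D])
    show "D \<in> borel_measurable M" unfolding D_def S_def by measurable
    show "0 \<le> D x" for x unfolding D_def S_def by simp
    have "(\<integral>\<^sup>+x. ennreal (S x) \<partial>M) = (\<integral>\<^sup>+x. f x \<partial>M)"
      using aefin by (intro nn_integral_cong_AE) (auto simp: S_def less_top ennreal_enn2real_if)
    then have "integrable M S"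
      unfolding S_def using fin by (intro integrableI_nonneg) auto
    then show "integrable M (\<lambda>x. D x ^ 3)"
      unfolding D_def by (simp add: power_mult_distrib odd_real_root_pow)
    show "AE x in M. \<forall>n. (\<Sum>k<n. w (r k) x) \<le> D x"
      using aefin
    proof eventually_elim
      case (elim x)
      have le: "2 ^ k * w (r k) x \<le> root 3 (S x)" for k
      proof -
        have "ennreal (8 ^ k * w (r k) x ^ 3) \<le> f x"
          unfolding f_def using sum_le_suminf[OF summableI, of "{k}" "\<lambda>k. ennreal (8 ^ k * w (r k) x ^ 3)"] by simp
        then have "8 ^ k * w (r k) x ^ 3 \<le> S x"
          unfolding S_def using elim nonneg by (metis enn2real_ennreal enn2real_mono infinity_ennreal_def
              less_top mult_nonneg_nonneg zero_le_numeral zero_le_power)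
        moreover have "(2 ^ k * w (r k) x) ^ 3 = 8 ^ k * w (r k) x ^ 3"
          by (simp add: power_mult_distrib power_mult[symmetric] mult.commute[of k] power_mult)
        ultimately have "root 3 ((2 ^ k * w (r k) x) ^ 3) \<le> root 3 (S x)" by simp
        then show ?thesis by (simp add: odd_real_root_power_cancel)
      qed
      show ?case
      proof
        fix n
        have "(\<Sum>k<n. w (r k) x) \<le> (\<Sum>k<n. (1 / 2) ^ k * root 3 (S x))"
          using le by (intro sum_mono) (simp add: field_simps)
        also have "\<dots> = (\<Sum>k<n. (1 / 2) ^ k) * root 3 (S x)" by (simp add: sum_distrib_right)
        also have "\<dots> \<le> 2 * root 3 (S x)"
        proof (rule mult_right_mono)
          have "(\<Sum>k<n. (1 / 2 :: real) ^ k) \<le> (\<Sum>k. (1 / 2) ^ k)"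
            by (rule sum_le_suminf) (auto intro: summable_geometric)
          then show "(\<Sum>k<n. (1 / 2 :: real) ^ k) \<le> 2" by (simp add: suminf_geometric)
        qed (simp add: S_def)
        finally show "(\<Sum>k<n. w (r k) x) \<le> D x" unfolding D_def .
      qed
    qed
  qed (rule mono)
qed


text \<open>This follows from \<open>a b \<le> a\<^sup>3\<^sup>/\<^sup>2 + b\<^sup>3\<close>, according to which of \<open>b\<close> and \<open>\<surd>a\<close> is larger.\<close>

lemma Holder_three_halves:
  fixes f :: "'a::euclidean_space \<Rightarrow> real" and g :: "'a \<Rightarrow> real"
  assumes f: "f \<in> Lp (3/2) S" and g: "g \<in> borel_measurable (lebesgue_on S)"
    "integrable (lebesgue_on S) (\<lambda>x. \<bar>g x\<bar> ^ 3)"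
  shows "integrable (lebesgue_on S) (\<lambda>x. f x * g x)"
proof (rule Bochner_Integration.integrable_bound)
  show "integrable (lebesgue_on S) (\<lambda>x. \<bar>f x\<bar> powr (3/2) + \<bar>g x\<bar> ^ 3)"
    using f g(2) unfolding Lp_def by auto
  show "(\<lambda>x. f x * g x) \<in> borel_measurable (lebesgue_on S)" using f g(1) unfolding Lp_def by auto
  have "a * b \<le> a powr (3/2) + b ^ 3" if "0 \<le> a" "0 \<le> b" for a b :: real
  proof (cases "b \<le> a powr (1/2)")
    case True
    have "a * b \<le> a powr 1 * a powr (1/2)" using True that by (simp add: mult_left_mono)
    also have "\<dots> = a powr (3/2)" by (subst powr_add[symmetric]) simp
    finally show ?thesis using that by (simp add: add_increasing2)
  next
    case False
    have "a = (a powr (1/2))\<^sup>2" using that by (simp add: powr_half_sqrt)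
    also have "\<dots> \<le> b\<^sup>2" using False by (intro power_mono) auto
    finally have "a * b \<le> b\<^sup>2 * b" using that by (intro mult_right_mono) auto
    also have "\<dots> = b ^ 3" by (simp add: power2_eq_square power3_eq_cube)
    finally show ?thesis by (simp add: add_increasing)
  qed
  then show "AE x in lebesgue_on S. norm (f x * g x) \<le> norm (\<bar>f x\<bar> powr (3/2) + \<bar>g x\<bar> ^ 3)"
    by (intro AE_I2) (simp add: abs_mult order_trans[OF _ abs_ge_self])
qed

lemma Lp3_iff:
  "f \<in> Lp 3 S \<longleftrightarrow> f \<in> borel_measurable (lebesgue_on S) \<and> integrable (lebesgue_on S) (\<lambda>x. norm (f x) ^ 3)"
  unfolding Lp_def by (simp add: powr_numeral)

lemma tendsto_Lp3_sequence:
  fixes un :: "real \<Rightarrow> 'a::euclidean_space \<Rightarrow> 'b::euclidean_space"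
  assumes conv: "tendsto_Lp 3 S un u (at_right 0)" and P: "eventually P (at_right 0)"
  obtains \<nu> :: "nat \<Rightarrow> real" and D where "filterlim \<nu> (at_right 0) sequentially" "\<And>k. 0 < \<nu> k" "\<And>k. P (\<nu> k)"
    "\<And>k. un (\<nu> k) \<in> Lp 3 S" "D \<in> borel_measurable (lebesgue_on S)" "\<And>x. 0 \<le> D x"
    "integrable (lebesgue_on S) (\<lambda>x. D x ^ 3)"
    "AE x in lebesgue_on S. \<forall>n. (\<Sum>k<n. norm (un (\<nu> k) x - u x)) \<le> D x"
proof -
  define s where "s n = inverse (real (Suc n))" for n
  have s0: "0 < s n" for n unfolding s_def by simp
  have s: "filterlim s (at_right 0) sequentially"
    unfolding filterlim_at s_def using LIMSEQ_inverse_real_of_nat by (auto intro: always_eventually)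
  have "eventually (\<lambda>\<nu>. P \<nu> \<and> un \<nu> \<in> Lp 3 S) (at_right 0)"
    using conv P unfolding tendsto_Lp_def by (auto intro: eventually_conj)
  then have "eventually (\<lambda>n. P (s n) \<and> un (s n) \<in> Lp 3 S) sequentially"
    using s by (rule eventually_compose_filterlim)
  then obtain N where N: "\<And>n. N \<le> n \<Longrightarrow> P (s n) \<and> un (s n) \<in> Lp 3 S"
    unfolding eventually_sequentially by blast
  define t where "t n = s (n + N)" for n
  have t: "filterlim t (at_right 0) sequentially"
    unfolding t_def using filterlim_compose[OF s filterlim_add_const_nat_at_top[of N]] .
  have tN: "P (t n)" "un (t n) \<in> Lp 3 S" for n unfolding t_def using N[of "n + N"] by auto
  have u: "u \<in> Lp 3 S" using conv unfolding tendsto_Lp_def by blast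
  have w: "(\<lambda>x. un (t n) x - u x) \<in> Lp 3 S" for n by (rule Lp_diff[OF tN(2) u]) simp
  have lim: "(\<lambda>n. LINT x|lebesgue_on S. norm (un (t n) x - u x) ^ 3) \<longlonglongrightarrow> 0"
    using filterlim_compose[of "\<lambda>i. LINT x|lebesgue_on S. norm (un i x - u x) powr 3", OF _ t] conv
    unfolding tendsto_Lp_def by (simp add: powr_numeral)
  obtain r :: "nat \<Rightarrow> nat" and D where r: "strict_mono r" and D: "D \<in> borel_measurable (lebesgue_on S)" "\<And>x. 0 \<le> D x"
    "integrable (lebesgue_on S) (\<lambda>x. D x ^ 3)"
    "AE x in lebesgue_on S. \<forall>n. (\<Sum>k<n. norm (un (t (r k)) x - u x)) \<le> D x"
  proof (rule summably_dominated_subsequence[of "\<lambda>n x. norm (un (t n) x - u x)" "lebesgue_on S"])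
    show "(\<lambda>x. norm (un (t k) x - u x)) \<in> borel_measurable (lebesgue_on S)" for k
      using w[of k] unfolding Lp3_iff by auto
    show "integrable (lebesgue_on S) (\<lambda>x. norm (un (t k) x - u x) ^ 3)" for k
      using w[of k] unfolding Lp3_iff by auto
  qed (use lim in auto)
  show ?thesis
  proof (rule that[of "\<lambda>k. t (r k)" D])
    show "filterlim (\<lambda>k. t (r k)) (at_right 0) sequentially"
      using filterlim_compose[OF t filterlim_subseq[OF r]] .
  qed (use D tN s0 in \<open>auto simp: t_def\<close>)
qed

lemma integral_nonlinear_tendsto:
  fixes U :: "nat \<Rightarrow> 'x \<Rightarrow> 'b::euclidean_space" and \<Phi> :: "'x \<Rightarrow> 'b \<Rightarrow> real"
  assumes "finite_measure M"
    and U: "\<And>k. U k \<in> borel_measurable M" "u \<in> borel_measurable M"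
    and E: "integrable M (\<lambda>x. E x ^ 3)" "AE x in M. \<forall>k. norm (U k x) \<le> E x"
    and lim: "AE x in M. (\<lambda>k. U k x) \<longlonglongrightarrow> u x"
    and meas: "\<And>v. v \<in> borel_measurable M \<Longrightarrow> (\<lambda>x. \<Phi> x (v x)) \<in> borel_measurable M"
    and cont: "\<And>x. x \<in> space M \<Longrightarrow> continuous_on UNIV (\<Phi> x)"
    and bound: "\<And>x v. x \<in> space M \<Longrightarrow> \<bar>\<Phi> x v\<bar> \<le> C * (1 + norm v ^ 3)"
  shows "(\<lambda>k. LINT x|M. \<Phi> x (U k x)) \<longlonglongrightarrow> (LINT x|M. \<Phi> x (u x))"
    and "\<And>k. integrable M (\<lambda>x. \<Phi> x (U k x))" and "integrable M (\<lambda>x. \<Phi> x (u x))"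
proof -
  interpret finite_measure M by fact
  let ?W = "\<lambda>x. \<bar>C\<bar> * (1 + E x ^ 3)"
  have W: "integrable M ?W" using E(1) by auto
  have l: "AE x in M. (\<lambda>k. \<Phi> x (U k x)) \<longlonglongrightarrow> \<Phi> x (u x)"
    using lim AE_space
  proof eventually_elim
    case (elim x)
    then have "isCont (\<Phi> x) (u x)" using cont by (simp add: continuous_on_eq_continuous_at)
    then show ?case using elim(1) by (rule isCont_tendsto_compose)
  qed
  have b: "AE x in M. norm (\<Phi> x (U k x)) \<le> ?W x" for k
    using E(2) AE_space
  proof eventually_elim
    case (elim x)
    have "norm (\<Phi> x (U k x)) \<le> C * (1 + norm (U k x) ^ 3)" using bound[OF elim(2)] by simp
    also have "\<dots> \<le> \<bar>C\<bar> * (1 + E x ^ 3)"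
      using elim(1) by (intro mult_mono add_left_mono power_mono) auto
    finally show ?case .
  qed
  note dct = meas[OF U(2)] meas[OF U(1)] W l b
  show "(\<lambda>k. LINT x|M. \<Phi> x (U k x)) \<longlonglongrightarrow> (LINT x|M. \<Phi> x (u x))"
    and "\<And>k. integrable M (\<lambda>x. \<Phi> x (U k x))" and "integrable M (\<lambda>x. \<Phi> x (u x))"
    by (rule integral_dominated_convergence[OF dct] integrable_dominated_convergence2[OF dct]
        integrable_dominated_convergence[OF dct])+
qed


section \<open>Passing to the inviscid limit\<close>

text \<open>\<open>D\<close> dominates the sum of all increments \<open>|U k - u|\<close>; it provides almost everywhere convergence and
  an \<open>L\<^sup>3\<close> majorant for the velocities, and it is the bound required by
  \<open>weak_strong_product_tendsto_0\<close>.\<close>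

locale inviscid_sequence =
  fixes \<Omega> :: "'a::euclidean_space set" and T :: real
    and \<nu> :: "nat \<Rightarrow> real" and U :: "nat \<Rightarrow> 'a \<times> real \<Rightarrow> 'a" and P :: "nat \<Rightarrow> 'a \<times> real \<Rightarrow> real"
    and G :: "nat \<Rightarrow> real \<Rightarrow> 'a \<Rightarrow> 'a \<Rightarrow> 'a"
    and u :: "'a \<times> real \<Rightarrow> 'a" and p :: "'a \<times> real \<Rightarrow> real" and D :: "'a \<times> real \<Rightarrow> real"
  assumes dom: "open \<Omega>" "bounded \<Omega>" and T: "0 < T"
    and flow: "\<And>k. smooth_navier_stokes \<Omega> T (\<nu> k) (U k) (P k) (G k)"
    and \<nu>: "\<And>k. 0 < \<nu> k" "\<nu> \<longlonglongrightarrow> 0"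
    and L3: "\<And>k. U k \<in> Lp 3 (\<Omega> \<times> {0<..<T})" "u \<in> Lp 3 (\<Omega> \<times> {0<..<T})"
    and L32: "\<And>k. P k \<in> Lp (3/2) (\<Omega> \<times> {0<..<T})" "p \<in> Lp (3/2) (\<Omega> \<times> {0<..<T})"
    and weak: "\<And>h. h \<in> Lp 3 (\<Omega> \<times> {0<..<T}) \<Longrightarrow> (\<lambda>k. LINT z|lebesgue_on (\<Omega> \<times> {0<..<T}). P k z * h z)
        \<longlonglongrightarrow> (LINT z|lebesgue_on (\<Omega> \<times> {0<..<T}). p z * h z)"
    and D: "D \<in> borel_measurable (lebesgue_on (\<Omega> \<times> {0<..<T}))" "\<And>z. 0 \<le> D z"
      "integrable (lebesgue_on (\<Omega> \<times> {0<..<T})) (\<lambda>z. D z ^ 3)"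
      "AE z in lebesgue_on (\<Omega> \<times> {0<..<T}). \<forall>n. (\<Sum>k<n. norm (U k z - u z)) \<le> D z"
begin

abbreviation Q where "Q \<equiv> \<Omega> \<times> {0<..<T}"
abbreviation X where "X \<equiv> closure \<Omega> \<times> {0<..T}"

definition M where "M = lebesgue_on Q"
definition E where "E z = norm (u z) + D z"

lemma open_Q: "open Q" using dom by (simp add: open_Times)
lemma Q_subset_X: "Q \<subseteq> X" using closure_subset by fastforce
lemma space_M: "space M = Q" unfolding M_def by simp
lemma bounded_Q: "bounded Q" using dom by (simp add: bounded_Times)
lemma fin: "finite_measure M" unfolding M_def by (rule finite_measure_bounded_open[OF open_Q bounded_Q])

lemma meas: "U k \<in> borel_measurable M" "u \<in> borel_measurable M"
  "P k \<in> borel_measurable M" "p \<in> borel_measurable M" "D \<in> borel_measurable M"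
  "E \<in> borel_measurable M"
  using L3 L32 D(1) unfolding M_def Lp_def E_def[abs_def] by auto

lemma measurable_continuous: "continuous_on Q f \<Longrightarrow> f \<in> borel_measurable M"
  for f :: "'a \<times> real \<Rightarrow> 'b::euclidean_space"
  unfolding M_def by (rule continuous_on_measurable_lebesgue_on[OF open_Q])

lemma E_nonneg: "0 \<le> E z" unfolding E_def using D(2) by simp

lemma E_cubed: "integrable M (\<lambda>z. E z ^ 3)"
proof (rule Bochner_Integration.integrable_bound)
  show "integrable M (\<lambda>z. 8 * (norm (u z) ^ 3 + D z ^ 3))"
    using L3(2) D(3) unfolding M_def Lp3_iff by auto
  show "(\<lambda>z. E z ^ 3) \<in> borel_measurable M" using meas(6) by measurable
  have "(a + b) ^ 3 \<le> 8 * (a ^ 3 + b ^ 3)" if "0 \<le> a" "0 \<le> b" for a b :: real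
  proof -
    have "(a + b) ^ 3 \<le> (2 * max a b) ^ 3" using that by (intro power_mono) auto
    also have "\<dots> = 8 * max a b ^ 3" by (simp add: power_mult_distrib)
    also have "\<dots> \<le> 8 * (a ^ 3 + b ^ 3)" using that by (auto simp: max_def)
    finally show ?thesis .
  qed
  then show "AE z in M. norm (E z ^ 3) \<le> norm (8 * (norm (u z) ^ 3 + D z ^ 3))"
    unfolding E_def using D(2) by (intro AE_I2) (simp add: order_trans[OF _ abs_ge_self])
qed

lemma U_close: "AE z in M. \<forall>k. norm (U k z - u z) \<le> D z"
  using D(4) unfolding M_def
proof eventually_elim
  case (elim z)
  show ?case
  proof
    fix k
    have "norm (U k z - u z) \<le> (\<Sum>j<Suc k. norm (U j z - u z))" by (rule member_le_sum) auto
    then show "norm (U k z - u z) \<le> D z" using elim by (meson order_trans)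
  qed
qed

lemma U_bound: "AE z in M. \<forall>k. norm (U k z) \<le> E z"
  using U_close
proof eventually_elim
  case (elim z)
  have "norm (U k z) \<le> norm (u z) + norm (U k z - u z)" for k
    using norm_triangle_ineq[of "u z" "U k z - u z"] by simp
  then show ?case using elim unfolding E_def by (meson add_left_mono order_trans)
qed

lemma U_tendsto: "AE z in M. (\<lambda>k. U k z) \<longlonglongrightarrow> u z"
  using D(4) unfolding M_def
proof eventually_elim
  case (elim z)
  have "summable (\<lambda>k. norm (U k z - u z))"
    by (rule summableI_nonneg_bounded) (use elim in auto)
  then have "(\<lambda>k. U k z - u z) \<longlonglongrightarrow> 0"
    using summable_LIMSEQ_zero tendsto_norm_zero_iff by blast
  then show ?case by (rule LIM_zero_cancel)
qed

lemmas nonlinear = integral_nonlinear_tendsto[OF fin meas(1,2) E_cubed U_bound U_tendsto]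

lemma bounded_cubed:
  fixes h :: "'a \<times> real \<Rightarrow> real"
  assumes "h \<in> borel_measurable M" "\<And>z. z \<in> Q \<Longrightarrow> \<bar>h z\<bar> \<le> B * E z + B"
  shows "integrable M (\<lambda>z. \<bar>h z\<bar> ^ 3)"
proof (rule Bochner_Integration.integrable_bound)
  interpret finite_measure M by (rule fin)
  show "integrable M (\<lambda>z. 8 * \<bar>B\<bar> ^ 3 * (E z ^ 3 + 1))" using E_cubed by auto
  show "(\<lambda>z. \<bar>h z\<bar> ^ 3) \<in> borel_measurable M" using assms(1) by measurable
  show "AE z in M. norm (\<bar>h z\<bar> ^ 3) \<le> norm (8 * \<bar>B\<bar> ^ 3 * (E z ^ 3 + 1))"
  proof (rule AE_I2)
    fix z assume "z \<in> space M"
    then have "\<bar>h z\<bar> \<le> B * E z + B" using assms(2) space_M by blast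
    also have "\<dots> \<le> \<bar>B\<bar> * E z + \<bar>B\<bar>" using E_nonneg[of z] by (intro add_mono mult_right_mono) auto
    also have "\<dots> = \<bar>B\<bar> * (E z + 1)" by (simp add: distrib_left)
    also have "\<dots> \<le> \<bar>B\<bar> * (2 * max (E z) 1)" by (rule mult_left_mono) auto
    finally have "\<bar>h z\<bar> ^ 3 \<le> (\<bar>B\<bar> * (2 * max (E z) 1)) ^ 3" by (intro power_mono) auto
    also have "\<dots> = 8 * \<bar>B\<bar> ^ 3 * max (E z) 1 ^ 3" by (simp add: power_mult_distrib)
    also have "\<dots> \<le> 8 * \<bar>B\<bar> ^ 3 * (E z ^ 3 + 1)"
      using E_nonneg[of z] by (intro mult_left_mono) (auto simp: max_def)
    finally show "norm (\<bar>h z\<bar> ^ 3) \<le> norm (8 * \<bar>B\<bar> ^ 3 * (E z ^ 3 + 1))"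
      by (simp add: order_trans[OF _ abs_ge_self])
  qed
qed

lemma P_mult_integrable:
  assumes "h \<in> borel_measurable M" "\<And>z. z \<in> Q \<Longrightarrow> \<bar>h z\<bar> \<le> B * E z + B"
  shows "integrable M (\<lambda>z. P k z * h z)" "integrable M (\<lambda>z. p z * h z)"
  using Holder_three_halves[OF L32(1)] Holder_three_halves[OF L32(2)] bounded_cubed[OF assms] assms(1)
  unfolding M_def by auto

lemma P_weak:
  assumes "h \<in> borel_measurable M" "\<And>z. z \<in> Q \<Longrightarrow> \<bar>h z\<bar> \<le> B * E z + B"
  shows "(\<lambda>k. LINT z|M. P k z * h z) \<longlonglongrightarrow> (LINT z|M. p z * h z)"
  using weak[of h] bounded_cubed[OF assms] assms(1) unfolding M_def Lp3_iff by simp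

text \<open>With \<open>w k = (U k - u) \<bullet> g\<close>, the integrand is \<open>(P k - p) w k + p w k + P k (u \<bullet> g)\<close>.  The last
  two integrals converge by domination and by weak convergence; in the first, both factors move.\<close>

lemma pressure_work_tendsto:
  fixes g :: "'a \<times> real \<Rightarrow> 'a"
  assumes g: "g \<in> borel_measurable M" "\<And>z. z \<in> Q \<Longrightarrow> norm (g z) \<le> B"
  shows "(\<lambda>k. LINT z|M. P k z * (U k z \<bullet> g z)) \<longlonglongrightarrow> (LINT z|M. p z * (u z \<bullet> g z))"
    and "\<And>k. integrable M (\<lambda>z. P k z * (U k z \<bullet> g z))" and "integrable M (\<lambda>z. p z * (u z \<bullet> g z))"
proof -
  have inner_le: "\<bar>v \<bullet> g z\<bar> \<le> \<bar>B\<bar> * norm v" if "z \<in> Q" for v z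
  proof -
    have "\<bar>v \<bullet> g z\<bar> \<le> norm v * norm (g z)" by (rule Cauchy_Schwarz_ineq2)
    also have "\<dots> \<le> norm v * \<bar>B\<bar>" using g(2)[OF that] by (intro mult_left_mono) auto
    finally show ?thesis by (simp add: mult.commute)
  qed
  obtain N where N: "N \<in> null_sets M" "{z \<in> space M. \<not> (\<forall>n. (\<Sum>k<n. norm (U k z - u z)) \<le> D z)} \<subseteq> N"
    using D(4) unfolding M_def[symmetric] eventually_ae_filter by blast
  \<comment> \<open>off the null set \<open>N\<close> the sums are dominated everywhere, as the product lemma requires\<close>
  define w where "w k z = indicator (space M - N) z * ((U k z - u z) \<bullet> g z)" for k z
  have gN: "space M - N \<in> sets M" using N(1) by auto
  have wm: "w k \<in> borel_measurable M" for k
    unfolding w_def[abs_def] using meas g(1) gN by measurable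
  have ae: "AE z in M. z \<in> space M - N" using AE_not_in[OF N(1)] AE_space by eventually_elim simp
  have Um: "(\<lambda>z. U k z \<bullet> g z) \<in> borel_measurable M" "(\<lambda>z. u z \<bullet> g z) \<in> borel_measurable M" for k
    using meas g(1) by measurable
  have ub: "\<bar>u z \<bullet> g z\<bar> \<le> \<bar>B\<bar> * E z + \<bar>B\<bar>" if "z \<in> Q" for z
    using inner_le[OF that, of "u z"] mult_left_mono[of "norm (u z)" "E z" "\<bar>B\<bar>"] D(2)[of z] unfolding E_def by simp
  have Db: "\<bar>\<bar>B\<bar> * D z\<bar> \<le> \<bar>B\<bar> * E z + \<bar>B\<bar>" for z
    using mult_left_mono[of "D z" "E z" "\<bar>B\<bar>"] D(2)[of z] unfolding E_def by (simp add: abs_mult)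
  have Dm: "(\<lambda>z. \<bar>B\<bar> * D z) \<in> borel_measurable M" using meas(5) by measurable
  have wsum: "(\<Sum>j<n. \<bar>w j z\<bar>) \<le> \<bar>B\<bar> * D z" if "z \<in> space M" for n z
  proof (cases "z \<in> N")
    case True
    then show ?thesis using D(2)[of z] by (simp add: w_def)
  next
    case False
    have "(\<Sum>j<n. \<bar>w j z\<bar>) \<le> (\<Sum>j<n. \<bar>B\<bar> * norm (U j z - u z))"
      using inner_le that space_M by (intro sum_mono) (simp add: w_def indicator_def)
    also have "\<dots> = \<bar>B\<bar> * (\<Sum>j<n. norm (U j z - u z))" by (simp add: sum_distrib_left)
    also have "\<dots> \<le> \<bar>B\<bar> * D z" using False N(2) that by (intro mult_left_mono) auto
    finally show ?thesis .
  qed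
  have wb: "\<bar>w k z\<bar> \<le> \<bar>B\<bar> * D z" if "z \<in> Q" for k z
  proof -
    have "\<bar>w k z\<bar> \<le> (\<Sum>j<Suc k. \<bar>w j z\<bar>)" by (rule member_le_sum) auto
    also have "\<dots> \<le> \<bar>B\<bar> * D z" by (rule wsum) (simp add: that space_M)
    finally show ?thesis .
  qed
  have DE: "\<bar>B\<bar> * D z \<le> \<bar>B\<bar> * E z + \<bar>B\<bar>" for z using Db[of z] D(2)[of z] by (simp add: abs_mult)
  have wE: "\<bar>w k z\<bar> \<le> \<bar>B\<bar> * E z + \<bar>B\<bar>" if "z \<in> Q" for k z using wb[OF that, of k] DE[of z] by linarith
  note iu = P_mult_integrable[OF Um(2) ub]
  have iPw: "integrable M (\<lambda>z. P k z * w j z)" for k j by (rule P_mult_integrable(1)[OF wm wE])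
  have ipw: "integrable M (\<lambda>z. p z * w j z)" for j by (rule P_mult_integrable(2)[OF wm wE])
  have iqw: "integrable M (\<lambda>z. (P k z - p z) * w j z)" for k j
    unfolding left_diff_distrib by (rule Bochner_Integration.integrable_diff[OF iPw ipw])
  show "integrable M (\<lambda>z. p z * (u z \<bullet> g z))" by (rule iu(2))

  have 1: "(\<lambda>k. LINT z|M. (P k z - p z) * w k z) \<longlonglongrightarrow> 0"
  proof (rule weak_strong_product_tendsto_0[OF _ wm Dm wsum])
    show "(\<lambda>z. P k z - p z) \<in> borel_measurable M" for k using meas by measurable
    show "integrable M (\<lambda>z. \<bar>P k z - p z\<bar> * (\<bar>B\<bar> * D z))" for k
    proof -
      have "integrable M (\<lambda>z. (P k z - p z) * (\<bar>B\<bar> * D z))"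
        unfolding left_diff_distrib by (rule Bochner_Integration.integrable_diff[OF P_mult_integrable[OF Dm Db]])
      from integrable_norm[OF this] show ?thesis using D(2) by (simp add: abs_mult)
    qed
    fix h assume h: "h \<in> borel_measurable M" "\<And>z. z \<in> space M \<Longrightarrow> \<bar>h z\<bar> \<le> \<bar>B\<bar> * D z"
    have hE: "\<bar>h z\<bar> \<le> \<bar>B\<bar> * E z + \<bar>B\<bar>" if "z \<in> Q" for z
      using h(2)[of z] DE[of z] that space_M by simp
    show "(\<lambda>k. LINT z|M. (P k z - p z) * h z) \<longlonglongrightarrow> 0"
    proof -
      have "(LINT z|M. (P k z - p z) * h z) = (LINT z|M. P k z * h z) - (LINT z|M. p z * h z)" for k
        unfolding left_diff_distrib
        by (rule Bochner_Integration.integral_diff[OF P_mult_integrable[OF h(1) hE]])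
      then show ?thesis using LIM_zero[OF P_weak[OF h(1) hE]] by simp
    qed
  qed
  have 2: "(\<lambda>k. LINT z|M. p z * w k z) \<longlonglongrightarrow> (LINT z|M. 0)"
  proof (rule integral_dominated_convergence[where w="\<lambda>z. \<bar>p z * (\<bar>B\<bar> * D z)\<bar>"])
    show "integrable M (\<lambda>z. \<bar>p z * (\<bar>B\<bar> * D z)\<bar>)" using P_mult_integrable(2)[OF Dm Db] by (rule integrable_abs)
    show "(\<lambda>z. p z * w k z) \<in> borel_measurable M" for k using meas wm by measurable
    show "AE z in M. (\<lambda>k. p z * w k z) \<longlonglongrightarrow> 0"
      using U_tendsto
    proof eventually_elim
      case (elim z)
      have "(\<lambda>k. p z * (indicator (space M - N) z * ((U k z - u z) \<bullet> g z)))
          \<longlonglongrightarrow> p z * (indicator (space M - N) z * ((u z - u z) \<bullet> g z))"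
        by (intro tendsto_intros elim)
      then show ?case by (simp add: w_def)
    qed
    show "AE z in M. norm (p z * w k z) \<le> \<bar>p z * (\<bar>B\<bar> * D z)\<bar>" for k
      using wb space_M D(2) by (intro AE_I2) (simp add: abs_mult mult_left_mono)
  qed simp
  note 3 = P_weak[OF Um(2) ub]
  have eq: "AE z in M. P k z * (U k z \<bullet> g z) = (P k z - p z) * w k z + p z * w k z + P k z * (u z \<bullet> g z)" for k
    using ae by eventually_elim (simp add: w_def algebra_simps inner_diff_left)
  have ir: "integrable M (\<lambda>z. (P k z - p z) * w k z + p z * w k z + P k z * (u z \<bullet> g z))" for k
    by (intro Bochner_Integration.integrable_add iqw ipw iu(1))
  have mP: "(\<lambda>z. P k z * (U k z \<bullet> g z)) \<in> borel_measurable M" for k using meas Um by measurable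
  show "integrable M (\<lambda>z. P k z * (U k z \<bullet> g z))" for k
    by (rule integrable_cong_AE_imp[OF ir[of k] mP]) (use eq[of k] in \<open>simp add: eq_commute\<close>)
  have "(LINT z|M. P k z * (U k z \<bullet> g z)) = (LINT z|M. (P k z - p z) * w k z) + (LINT z|M. p z * w k z)
      + (LINT z|M. P k z * (u z \<bullet> g z))" for k
  proof -
    have "(LINT z|M. P k z * (U k z \<bullet> g z)) = (LINT z|M. (P k z - p z) * w k z + p z * w k z + P k z * (u z \<bullet> g z))"
      by (rule integral_cong_AE[OF mP borel_measurable_integrable[OF ir] eq])
    also have "\<dots> = (LINT z|M. (P k z - p z) * w k z) + (LINT z|M. p z * w k z) + (LINT z|M. P k z * (u z \<bullet> g z))"
      using iqw ipw iu(1) by simp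
    finally show ?thesis .
  qed
  then show "(\<lambda>k. LINT z|M. P k z * (U k z \<bullet> g z)) \<longlonglongrightarrow> (LINT z|M. p z * (u z \<bullet> g z))"
    using tendsto_add[OF tendsto_add[OF 1 2] 3] by simp
qed

end


lemma le_one_plus_cube:
  fixes s :: real
  assumes "0 \<le> s" shows "s \<le> 1 + s ^ 3" "s\<^sup>2 \<le> 1 + s ^ 3"
proof -
  have "s \<le> 1 + s ^ 3 \<and> s\<^sup>2 \<le> 1 + s ^ 3"
  proof (cases "s \<le> 1")
    case True
    then have "s\<^sup>2 \<le> 1" using assms by (simp add: power_le_one)
    moreover have "0 \<le> s ^ 3" using assms by simp
    ultimately show ?thesis using True by linarith
  next
    case False
    then have "s ^ 1 \<le> s ^ 3" "s\<^sup>2 \<le> s ^ 3" by (intro power_increasing; simp)+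
    then show ?thesis by simp
  qed
  then show "s \<le> 1 + s ^ 3" "s\<^sup>2 \<le> 1 + s ^ 3" by auto
qed

lemma supported_bounded:
  fixes f :: "'a::euclidean_space \<Rightarrow> 'b::real_normed_vector"
  assumes "cont_ext U X f" "compact K" "K \<subseteq> X" "\<forall>z\<in>U - K. f z = 0"
  obtains B where "0 \<le> B" "\<And>z. z \<in> U \<Longrightarrow> norm (f z) \<le> B"
proof -
  obtain B where B: "0 \<le> B" "\<And>z. z \<in> U \<Longrightarrow> z \<in> K \<Longrightarrow> norm (f z) \<le> B"
    using cont_ext_bounded[OF assms(1-3)] by blast
  have "norm (f z) \<le> B" if "z \<in> U" for z
  proof (cases "z \<in> K")
    case True
    then show ?thesis by (rule B(2)[OF that])
  next
    case False
    then have "f z = 0" using assms(4) that by blast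
    then show ?thesis using B(1) by simp
  qed
  with B(1) show ?thesis by (rule that)
qed

text \<open>A compact support turns continuous extendability of the derivatives into boundedness, so that they
  are admissible factors in all limits below.\<close>

lemma (in inviscid_sequence) supported_derivatives:
  fixes \<phi> :: "'a \<times> real \<Rightarrow> 'b::euclidean_space"
  assumes \<phi>: "C1_ext Q Y \<phi>" and QY: "Q \<subseteq> Y" and K: "compact K" "K \<subseteq> Y" "\<forall>z\<in>Q - K. \<phi> z = 0"
  obtains B where "0 \<le> B" "dt \<phi> \<in> borel_measurable M" "\<And>z. z \<in> Q \<Longrightarrow> norm (dt \<phi> z) \<le> B"
    "\<And>b. b \<in> Basis \<Longrightarrow> dx b \<phi> \<in> borel_measurable M" "\<And>b z. b \<in> Basis \<Longrightarrow> z \<in> Q \<Longrightarrow> norm (dx b \<phi> z) \<le> B"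
proof -
  have o: "open (Q - K)" using open_Q K(1) compact_imp_closed by blast
  have z0: "\<forall>z\<in>Q - K. pd v \<phi> z = 0" for v
  proof
    fix z assume "z \<in> Q - K"
    then show "pd v \<phi> z = 0" by (rule pd_eq_0[OF o]) (rule K(3)[rule_format])
  qed
  have "\<exists>B\<ge>0. \<forall>z\<in>Q. norm (pd v \<phi> z) \<le> B" if v: "v \<in> Basis" for v
  proof (rule supported_bounded[OF C1_ext_D(3)[OF \<phi> v] K(1,2) z0])
    fix B assume "0 \<le> B" "\<And>z. z \<in> Q \<Longrightarrow> norm (pd v \<phi> z) \<le> B"
    then show ?thesis by (intro exI[of _ B] conjI ballI)
  qed
  then have "\<forall>v\<in>Basis. \<exists>B. 0 \<le> B \<and> (\<forall>z\<in>Q. norm (pd v \<phi> z) \<le> B)" by blast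
  from bchoice[OF this] obtain B where B': "\<forall>v\<in>Basis. 0 \<le> B v \<and> (\<forall>z\<in>Q. norm (pd v \<phi> z) \<le> B v)" ..
  have B: "0 \<le> B v" "z \<in> Q \<Longrightarrow> norm (pd v \<phi> z) \<le> B v" if "v \<in> Basis" for v z
    using B'[rule_format, OF that] by (rule conjunct1, rule conjunct2[THEN bspec])
  have S: "norm (pd v \<phi> z) \<le> sum B Basis" if "v \<in> Basis" "z \<in> Q" for v z
  proof -
    have "B v \<le> sum B Basis" by (rule member_le_sum[OF that(1)]) (simp_all add: B(1))
    then show ?thesis using B(2)[OF that] by linarith
  qed
  have m: "pd v \<phi> \<in> borel_measurable M" if "v \<in> Basis" for v
    by (rule measurable_continuous[OF cont_ext_continuous_on[OF C1_ext_D(3)[OF \<phi> that] QY]])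
  show ?thesis
  proof (rule that[of "sum B Basis"])
    show "0 \<le> sum B Basis" by (intro sum_nonneg B)
    show "dt \<phi> \<in> borel_measurable M" "\<And>z. z \<in> Q \<Longrightarrow> norm (dt \<phi> z) \<le> sum B Basis"
      unfolding dt_def by (rule m[OF Basis_spacetime(2)] S[OF Basis_spacetime(2)]; assumption)+
    show "dx b \<phi> \<in> borel_measurable M" if "b \<in> Basis" for b
      unfolding dx_def by (rule m[OF Basis_spacetime(1)[OF that]])
    show "norm (dx b \<phi> z) \<le> sum B Basis" if "b \<in> Basis" "z \<in> Q" for b z
      unfolding dx_def by (rule S[OF Basis_spacetime(1)[OF that(1)] that(2)])
  qed
qed

lemma norm_grad_le:
  fixes \<phi> :: "'a::euclidean_space \<times> real \<Rightarrow> real"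
  assumes "\<And>b. b \<in> Basis \<Longrightarrow> norm (dx b \<phi> z) \<le> B"
  shows "norm (grad \<phi> z) \<le> real DIM('a) * B"
proof -
  have "norm (grad \<phi> z) \<le> (\<Sum>b\<in>(Basis::'a set). norm (dx b \<phi> z *\<^sub>R b))" unfolding grad_def by (rule norm_sum)
  also have "\<dots> \<le> (\<Sum>b\<in>(Basis::'a set). B)" using assms by (intro sum_mono) simp
  finally show ?thesis by simp
qed

lemma measurable_grad:
  fixes \<phi> :: "'a::euclidean_space \<times> real \<Rightarrow> real"
  assumes "\<And>b. b \<in> Basis \<Longrightarrow> dx b \<phi> \<in> borel_measurable N"
  shows "grad \<phi> \<in> borel_measurable N"
proof -
  have "grad \<phi> = (\<lambda>z. \<Sum>b\<in>Basis. dx b \<phi> z *\<^sub>R b)" by (rule ext) (rule grad_def)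
  then show ?thesis
    by (simp only:) (rule borel_measurable_sum, rule borel_measurable_scaleR, rule assms, assumption, rule borel_measurable_const)
qed

context inviscid_sequence
begin

lemma Lp_loc_integrable:
  fixes f :: "'a \<times> real \<Rightarrow> 'b::euclidean_space"
  assumes "integrable M f" shows "loc_integrable Q Y f"
  unfolding loc_integrable_def
proof (intro allI impI, elim conjE)
  fix K :: "('a \<times> real) set" assume "compact K"
  then have KQ: "K \<inter> Q \<in> sets lebesgue"
    by (intro sets.Int fmeasurableD[OF lmeasurable_compact] fmeasurableD[OF lmeasurable_open[OF bounded_Q open_Q]])
  show "integrable (lebesgue_on (K \<inter> Q)) f"
    by (rule integrable_lebesgue_on_subset[OF assms[unfolded M_def]
          fmeasurableD[OF lmeasurable_open[OF bounded_Q open_Q]] KQ Int_lower2])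
qed

lemma u_integrable: "integrable M u" "integrable M (\<lambda>z. (norm (u z))\<^sup>2)" "integrable M p"
proof -
  show "integrable M u" "integrable M p"
    unfolding M_def
    by (rule Lp_integrable[OF fin[unfolded M_def] L3(2)], simp, rule Lp_integrable[OF fin[unfolded M_def] L32(2)], simp)
  interpret finite_measure M by (rule fin)
  show "integrable M (\<lambda>z. (norm (u z))\<^sup>2)"
  proof (rule Bochner_Integration.integrable_bound)
    have "integrable M (\<lambda>z. norm (u z) ^ 3)" using L3(2) unfolding M_def Lp3_iff by (rule conjunct2)
    then show "integrable M (\<lambda>z. 1 + norm (u z) ^ 3)" by (intro Bochner_Integration.integrable_add) simp_all
    have "norm ((norm (u z))\<^sup>2) \<le> norm (1 + norm (u z) ^ 3)" for z
      using le_one_plus_cube(2)[of "norm (u z)"] by simp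
    then show "AE z in M. norm ((norm (u z))\<^sup>2) \<le> norm (1 + norm (u z) ^ 3)" by (intro AE_I2)
    show "(\<lambda>z. (norm (u z))\<^sup>2) \<in> borel_measurable M"
      by (rule borel_measurable_power[OF measurable_compose[OF meas(2) borel_measurable_norm]])
  qed
qed

lemma weak_div_free_limit:
  assumes \<phi>: "C1_ext Q Y (\<phi> :: 'a \<times> real \<Rightarrow> real)" and QY: "Q \<subseteq> Y"
    and K: "compact K" "K \<subseteq> Y" "\<forall>z\<in>Q - K. \<phi> z = 0"
    and zero: "\<And>k. (LINT z|lebesgue_on Q. U k z \<bullet> grad \<phi> z) = 0"
  shows "(LINT z|lebesgue_on Q. u z \<bullet> grad \<phi> z) = 0"
proof -
  obtain B where B: "0 \<le> B" "\<And>b. b \<in> Basis \<Longrightarrow> dx b \<phi> \<in> borel_measurable M"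
      "\<And>b z. b \<in> Basis \<Longrightarrow> z \<in> Q \<Longrightarrow> norm (dx b \<phi> z) \<le> B"
    by (rule supported_derivatives[OF \<phi> QY K]) (rule that)
  have gm: "grad \<phi> \<in> borel_measurable M" by (rule measurable_grad[OF B(2)])
  have gb: "norm (grad \<phi> z) \<le> real DIM('a) * B" if "z \<in> Q" for z by (rule norm_grad_le[OF B(3)[OF _ that]])
  have "(\<lambda>k. LINT z|M. U k z \<bullet> grad \<phi> z) \<longlonglongrightarrow> (LINT z|M. u z \<bullet> grad \<phi> z)"
  proof (rule nonlinear(1)[where C="real DIM('a) * B"])
    show "(\<lambda>z. v z \<bullet> grad \<phi> z) \<in> borel_measurable M" if "v \<in> borel_measurable M" for v
      using that gm by measurable
    show "continuous_on UNIV (\<lambda>v. v \<bullet> grad \<phi> z)" for z by (intro continuous_intros)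
    show "\<bar>v \<bullet> grad \<phi> z\<bar> \<le> real DIM('a) * B * (1 + norm v ^ 3)" if "z \<in> space M" for z v
    proof -
      have "\<bar>v \<bullet> grad \<phi> z\<bar> \<le> norm v * norm (grad \<phi> z)" by (rule Cauchy_Schwarz_ineq2)
      also have "\<dots> \<le> (1 + norm v ^ 3) * (real DIM('a) * B)"
        using gb[of z] that space_M le_one_plus_cube(1)[of "norm v"] by (intro mult_mono) auto
      finally show ?thesis by (simp add: mult.commute)
    qed
  qed
  then show ?thesis using zero unfolding M_def by (simp add: LIMSEQ_const_iff)
qed

text \<open>The convective term is quadratic in the velocity and the pressure enters linearly, so both converge
  directly; the viscous term is \<open>\<nu> k\<close> times a convergent sequence.\<close>

lemma momentum_limit:
  assumes \<phi>: "\<phi> \<in> test_functions Q"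
  shows "(LINT z|lebesgue_on Q. u z \<bullet> dt \<phi> z + (\<Sum>b\<in>Basis. (u z \<bullet> b) * (u z \<bullet> dx b \<phi> z)) + p z * divg \<phi> z) = 0"
proof -
  have s: "smooth_upto Q Q \<phi>" and "compact_support_in Q \<phi>" using \<phi> unfolding test_functions_def by auto
  then obtain K where K: "compact K" "K \<subseteq> Q" "\<forall>z\<in>Q - K. \<phi> z = 0" unfolding compact_support_in_def by auto
  have o: "open (Q - K)" using open_Q K(1) compact_imp_closed by blast
  obtain B where B: "0 \<le> B" "dt \<phi> \<in> borel_measurable M" "\<And>z. z \<in> Q \<Longrightarrow> norm (dt \<phi> z) \<le> B"
      "\<And>b. b \<in> Basis \<Longrightarrow> dx b \<phi> \<in> borel_measurable M" "\<And>b z. b \<in> Basis \<Longrightarrow> z \<in> Q \<Longrightarrow> norm (dx b \<phi> z) \<le> B"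
    by (rule supported_derivatives[OF smooth_upto_C1_ext[OF s] order_refl K]) (rule that)
  have "\<exists>B\<ge>0. dx b (dx b \<phi>) \<in> borel_measurable M \<and> (\<forall>z\<in>Q. norm (dx b (dx b \<phi>) z) \<le> B)" if b: "b \<in> Basis" for b
  proof -
    have c: "C1_ext Q Q (dx b \<phi>)"
      unfolding dx_def by (rule smooth_upto_C1_ext_pd[OF s open_Q Basis_spacetime(1)[OF b]])
    have "\<forall>z\<in>Q - K. dx b \<phi> z = 0"
    proof
      fix z assume "z \<in> Q - K"
      then show "dx b \<phi> z = 0" unfolding dx_def by (rule pd_eq_0[OF o]) (rule K(3)[rule_format])
    qed
    note z0 = this
    show ?thesis
    proof (rule supported_derivatives[OF c order_refl K(1,2) z0])
      fix B
      assume *: "0 \<le> B" "\<And>b'. b' \<in> Basis \<Longrightarrow> dx b' (dx b \<phi>) \<in> borel_measurable M"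
        "\<And>b' z. b' \<in> Basis \<Longrightarrow> z \<in> Q \<Longrightarrow> norm (dx b' (dx b \<phi>) z) \<le> B"
      show ?thesis by (intro exI[of _ B] conjI ballI *(1) *(2)[OF b] *(3)[OF b])
    qed
  qed
  then have "\<exists>C. \<forall>b\<in>Basis. 0 \<le> C b \<and> dx b (dx b \<phi>) \<in> borel_measurable M \<and> (\<forall>z\<in>Q. norm (dx b (dx b \<phi>) z) \<le> C b)"
    by (intro bchoice) simp
  then obtain C where C': "\<forall>b\<in>Basis. 0 \<le> C b \<and> dx b (dx b \<phi>) \<in> borel_measurable M \<and> (\<forall>z\<in>Q. norm (dx b (dx b \<phi>) z) \<le> C b)" ..
  have C: "0 \<le> C b" "dx b (dx b \<phi>) \<in> borel_measurable M" "z \<in> Q \<Longrightarrow> norm (dx b (dx b \<phi>) z) \<le> C b"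
    if "b \<in> Basis" for b z
    using C'[rule_format, OF that] by (rule conjunct1, rule conjunct2[THEN conjunct1], rule conjunct2[THEN conjunct2, THEN bspec])
  have lm: "laplace \<phi> \<in> borel_measurable M"
    unfolding laplace_def[abs_def] by (intro borel_measurable_sum C(2))
  have lb: "norm (laplace \<phi> z) \<le> sum C Basis" if "z \<in> Q" for z
    unfolding laplace_def by (rule order_trans[OF norm_sum]) (intro sum_mono C(3) that)
  have dm: "divg \<phi> \<in> borel_measurable M"
    unfolding divg_def[abs_def] using B(4) by (intro borel_measurable_sum borel_measurable_inner) auto
  have db: "\<bar>divg \<phi> z\<bar> \<le> (real DIM('a) * B) * E z + real DIM('a) * B" if "z \<in> Q" for z
  proof -
    have "\<bar>divg \<phi> z\<bar> \<le> (\<Sum>b\<in>(Basis::'a set). \<bar>dx b \<phi> z \<bullet> b\<bar>)" unfolding divg_def by (rule sum_abs)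
    also have "\<dots> \<le> (\<Sum>b\<in>(Basis::'a set). B)"
    proof (rule sum_mono)
      fix b :: 'a assume b: "b \<in> Basis"
      then show "\<bar>dx b \<phi> z \<bullet> b\<bar> \<le> B" using B(5)[OF b that] Basis_le_norm[OF b, of "dx b \<phi> z"] by linarith
    qed
    finally show ?thesis using E_nonneg[of z] B(1) by (simp add: add_increasing)
  qed
  define N where "N z v = v \<bullet> dt \<phi> z + (\<Sum>b\<in>Basis. (v \<bullet> b) * (v \<bullet> dx b \<phi> z))" for z v
  have Nm: "(\<lambda>z. N z (v z)) \<in> borel_measurable M" if "v \<in> borel_measurable M" for v
    unfolding N_def using that B(2,4) by (intro borel_measurable_add borel_measurable_sum borel_measurable_times
        borel_measurable_inner) auto
  have Nc: "continuous_on UNIV (N z)" for z unfolding N_def[abs_def] by (intro continuous_intros)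
  have Nb: "\<bar>N z v\<bar> \<le> (B + real DIM('a) * B) * (1 + norm v ^ 3)" if "z \<in> space M" for z v
  proof -
    have z: "z \<in> Q" using that space_M by simp
    have "\<bar>v \<bullet> dt \<phi> z\<bar> \<le> norm v * norm (dt \<phi> z)" by (rule Cauchy_Schwarz_ineq2)
    also have "\<dots> \<le> (1 + norm v ^ 3) * B"
      using B(3)[OF z] le_one_plus_cube(1)[of "norm v"] by (intro mult_mono) auto
    finally have 1: "\<bar>v \<bullet> dt \<phi> z\<bar> \<le> (1 + norm v ^ 3) * B" .
    have "\<bar>(v \<bullet> b) * (v \<bullet> dx b \<phi> z)\<bar> \<le> (1 + norm v ^ 3) * B" if b: "b \<in> Basis" for b
    proof -
      have "\<bar>(v \<bullet> b) * (v \<bullet> dx b \<phi> z)\<bar> \<le> norm v * (norm v * norm (dx b \<phi> z))"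
        unfolding abs_mult using Basis_le_norm[OF b, of v] Cauchy_Schwarz_ineq2 by (intro mult_mono) auto
      also have "\<dots> = (norm v)\<^sup>2 * norm (dx b \<phi> z)" by (simp add: power2_eq_square)
      also have "\<dots> \<le> (1 + norm v ^ 3) * B"
        using B(5)[OF b z] le_one_plus_cube(2)[of "norm v"] by (intro mult_mono) auto
      finally show ?thesis .
    qed
    then have "\<bar>\<Sum>b\<in>Basis. (v \<bullet> b) * (v \<bullet> dx b \<phi> z)\<bar> \<le> (\<Sum>b\<in>(Basis::'a set). (1 + norm v ^ 3) * B)"
      by (intro order_trans[OF sum_abs] sum_mono)
    then have 2: "\<bar>\<Sum>b\<in>Basis. (v \<bullet> b) * (v \<bullet> dx b \<phi> z)\<bar> \<le> real DIM('a) * ((1 + norm v ^ 3) * B)" by simp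
    have "\<bar>N z v\<bar> \<le> (1 + norm v ^ 3) * B + real DIM('a) * ((1 + norm v ^ 3) * B)"
      unfolding N_def by (rule order_trans[OF abs_triangle_ineq add_mono[OF 1 2]])
    then show ?thesis by (simp add: algebra_simps)
  qed
  note nl = nonlinear[OF Nm Nc Nb]
  have Lc: "continuous_on UNIV (\<lambda>v. v \<bullet> laplace \<phi> z)" for z by (intro continuous_intros)
  have Lm: "(\<lambda>z. v z \<bullet> laplace \<phi> z) \<in> borel_measurable M" if "v \<in> borel_measurable M" for v
    using that lm by measurable
  have Lb: "\<bar>v \<bullet> laplace \<phi> z\<bar> \<le> sum C Basis * (1 + norm v ^ 3)" if "z \<in> space M" for z v
  proof -
    have "\<bar>v \<bullet> laplace \<phi> z\<bar> \<le> norm v * norm (laplace \<phi> z)" by (rule Cauchy_Schwarz_ineq2)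
    also have "\<dots> \<le> (1 + norm v ^ 3) * sum C Basis"
      using lb[of z] that space_M le_one_plus_cube(1)[of "norm v"] by (intro mult_mono) auto
    finally show ?thesis by (simp add: mult.commute)
  qed
  note lap = nonlinear[OF Lm Lc Lb]
  note ip = P_mult_integrable[OF dm db]
  have "(\<lambda>k. (LINT z|M. N z (U k z)) + (LINT z|M. P k z * divg \<phi> z) + \<nu> k * (LINT z|M. U k z \<bullet> laplace \<phi> z))
     \<longlonglongrightarrow> (LINT z|M. N z (u z)) + (LINT z|M. p z * divg \<phi> z) + 0 * (LINT z|M. u z \<bullet> laplace \<phi> z)"
    by (intro tendsto_add tendsto_mult nl(1) lap(1) P_weak[OF dm db] \<nu>(2))
  moreover have "(LINT z|M. N z (U k z)) + (LINT z|M. P k z * divg \<phi> z) + \<nu> k * (LINT z|M. U k z \<bullet> laplace \<phi> z) = 0" for k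
  proof -
    have "(LINT z|M. N z (U k z) + P k z * divg \<phi> z + \<nu> k * (U k z \<bullet> laplace \<phi> z)) = 0"
      using smooth_navier_stokes.sol[OF flow[of k], unfolded distributional_solution_def Let_def,
          THEN conjunct2, THEN conjunct2, THEN conjunct2, THEN conjunct1, THEN bspec, OF \<phi>]
      unfolding N_def M_def .
    then show ?thesis using nl(2)[of k] lap(2)[of k] ip(1)[of k] by simp
  qed
  ultimately have "(LINT z|M. N z (u z)) + (LINT z|M. p z * divg \<phi> z) = 0" by (simp add: LIMSEQ_const_iff)
  then have "(LINT z|M. N z (u z) + p z * divg \<phi> z) = 0" using nl(3) ip(2) by simp
  then show ?thesis unfolding N_def M_def .
qed

lemma euler_limit: "euler_weak_solution \<Omega> T u p"
  unfolding euler_weak_solution_def distributional_solution_def Let_def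
proof (intro conjI ballI)
  show "loc_integrable Q Q u" "loc_integrable Q Q (\<lambda>z. (norm (u z))\<^sup>2)" "loc_integrable Q Q p"
    "loc_integrable Q (closure \<Omega> \<times> {0<..<T}) u"
    by (rule Lp_loc_integrable[OF u_integrable(1)] Lp_loc_integrable[OF u_integrable(2)]
        Lp_loc_integrable[OF u_integrable(3)])+
  show "(LINT z|lebesgue_on Q. u z \<bullet> dt \<phi> z + (\<Sum>b\<in>Basis. (u z \<bullet> b) * (u z \<bullet> dx b \<phi> z))
      + p z * divg \<phi> z + 0 * (u z \<bullet> laplace \<phi> z)) = 0" if "\<phi> \<in> test_functions Q" for \<phi>
    using momentum_limit[OF that] by simp
  have sub: "{0<..<T} \<subseteq> {0<..<T}" "{0<..<T} \<subseteq> {0<..T}" by auto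
  show "(LINT z|lebesgue_on Q. u z \<bullet> grad \<phi> z) = 0" if \<phi>: "\<phi> \<in> C1c Q (closure \<Omega> \<times> {0<..<T})" for \<phi>
  proof -
    obtain K where K: "compact K" "K \<subseteq> closure \<Omega> \<times> {0<..<T}" "\<forall>z\<in>closure \<Omega> \<times> {0<..<T} - K. \<phi> z = 0"
      using \<phi> unfolding C1c_def compact_support_in_def by auto
    have K': "\<forall>z\<in>Q - K. \<phi> z = 0"
    proof
      fix z assume "z \<in> Q - K"
      then have "z \<in> closure \<Omega> \<times> {0<..<T} - K"
        using subsetD[OF Sigma_mono[OF closure_subset order_refl]] by blast
      then show "\<phi> z = 0" by (rule K(3)[rule_format])
    qed
    have c: "C1_ext Q (closure \<Omega> \<times> {0<..<T}) \<phi>" using \<phi> by (intro C1_extI) (simp add: C1c_def)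
    have QY: "Q \<subseteq> closure \<Omega> \<times> {0<..<T}" by (rule Sigma_mono[OF closure_subset order_refl])
    show ?thesis
      by (rule weak_div_free_limit[OF c QY K(1,2) K'
            smooth_navier_stokes.weak_div_free_upto_boundary[OF flow sub c K(1,2) K']])
  qed
  show "(LINT z|lebesgue_on Q. u z \<bullet> grad \<phi> z) = 0" if \<phi>: "\<phi> \<in> test_functions Q" for \<phi>
  proof -
    obtain K where K: "compact K" "K \<subseteq> Q" "\<forall>z\<in>Q - K. \<phi> z = 0"
      using \<phi> unfolding test_functions_def compact_support_in_def by auto
    have c: "C1_ext Q Q \<phi>" using \<phi> unfolding test_functions_def by (intro smooth_upto_C1_ext) simp
    have "(LINT z|lebesgue_on Q. U k z \<bullet> grad \<phi> z) = 0" for k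
      by (rule smooth_navier_stokes.sol[OF flow[of k], unfolded distributional_solution_def Let_def,
          THEN conjunct2, THEN conjunct2, THEN conjunct2, THEN conjunct2, THEN bspec, OF \<phi>])
    then show ?thesis by (rule weak_div_free_limit[OF c order_refl K])
  qed
qed

end


context inviscid_sequence
begin

text \<open>The viscous flux, although not sign-definite, vanishes in the limit: by Young's inequality it is
  at most \<open>sqrt \<nu>\<close> times energy plus dissipation.\<close>

lemma viscous_flux_tendsto_0:
  assumes \<phi>: "\<phi> \<in> C1c Q X"
    and diss: "\<And>\<eta>. continuous_on X \<eta> \<Longrightarrow> compact_support_in X \<eta> \<Longrightarrow>
      convergent (\<lambda>k. LINT z|lebesgue_on Q. \<eta> z * (\<nu> k * grad_norm_sq (U k) z))"
  shows "(\<lambda>k. \<nu> k * (LINT z|lebesgue_on Q. (\<Sum>b\<in>Basis. dx b \<phi> z * (U k z \<bullet> dx b (U k) z)))) \<longlonglongrightarrow> 0"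
proof -
  have \<phi>1: "C1_ext Q X \<phi>" using \<phi> by (intro C1_extI) (simp add: C1c_def)
  obtain K where K: "compact K" "K \<subseteq> X" "\<forall>z\<in>X - K. \<phi> z = 0"
    using \<phi> unfolding C1c_def compact_support_in_def by auto
  have K': "\<forall>z\<in>Q - K. \<phi> z = 0"
  proof
    fix z assume "z \<in> Q - K"
    then have "z \<in> X - K" using subsetD[OF Q_subset_X] by simp
    then show "\<phi> z = 0" by (rule K(3)[rule_format])
  qed
  have o: "open (Q - K)" using open_Q K(1) compact_imp_closed by blast
  have d0: "dx b \<phi> z = 0" if "z \<in> Q - K" for b z
    unfolding dx_def by (rule pd_eq_0[OF o that]) (rule K'[rule_format])
  obtain B where B: "0 \<le> B" "\<And>b z. b \<in> Basis \<Longrightarrow> z \<in> Q \<Longrightarrow> norm (dx b \<phi> z) \<le> B"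
    by (rule supported_derivatives[OF \<phi>1 Q_subset_X K(1,2) K']) (rule that)
  obtain a where a: "0 < a" "a < T" "\<And>x t. (x, t) \<in> K \<Longrightarrow> a < t"
    by (rule compact_in_positive_time[OF K(1,2) T]) (rule that)
  \<comment> \<open>a cutoff that equals \<open>1\<close> on \<open>K\<close> and is itself admissible in the convergence of the dissipation;
    it bounds the dissipation on \<open>K\<close> uniformly in \<open>k\<close>\<close>
  define \<eta> :: "'a \<times> real \<Rightarrow> real" where "\<eta> z = min 1 (max 0 (2 * snd z / a - 1))" for z
  have \<eta>: "0 \<le> \<eta> z" "\<eta> z \<le> 1" for z unfolding \<eta>_def by auto
  have \<eta>1: "\<eta> z = 1" if "z \<in> K" for z
  proof -
    have "a < snd z" using a(3)[of "fst z" "snd z"] that by simp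
    then have "1 \<le> 2 * snd z / a - 1" using a(1) by (simp add: field_simps)
    then show ?thesis unfolding \<eta>_def by simp
  qed
  define K2 where "K2 = closure \<Omega> \<times> {a / 2..T}"
  have K2: "compact K2" "K2 \<subseteq> X"
    using dom a(1) unfolding K2_def by (auto intro!: compact_Times simp: compact_closure)
  have \<eta>0: "\<eta> z = 0" if "z \<in> X - K2" for z
  proof -
    have "snd z < a / 2" using that unfolding K2_def by (cases z) auto
    then have "2 * snd z / a - 1 \<le> 0" using a(1) by (simp add: field_simps)
    then show ?thesis unfolding \<eta>_def by simp
  qed
  have \<eta>c: "continuous_on Y \<eta>" for Y unfolding \<eta>_def using a(1) by (intro continuous_intros) simp
  have \<eta>s: "compact_support_in X \<eta>" unfolding compact_support_in_def using K2 \<eta>0 by blast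
  define e where "e k = (LINT z|M. \<eta> z * (norm (U k z))\<^sup>2)" for k
  define d where "d k = (LINT z|M. \<eta> z * (\<nu> k * grad_norm_sq (U k) z))" for k
  have "convergent e"
  proof -
    have "e \<longlonglongrightarrow> (LINT z|M. \<eta> z * (norm (u z))\<^sup>2)"
      unfolding e_def
    proof (rule nonlinear(1)[where C=1])
      show "(\<lambda>z. \<eta> z * (norm (v z))\<^sup>2) \<in> borel_measurable M" if "v \<in> borel_measurable M" for v
        by (intro borel_measurable_times borel_measurable_power measurable_continuous \<eta>c
            measurable_compose[OF that borel_measurable_norm])
      show "continuous_on UNIV (\<lambda>v. \<eta> z * (norm v)\<^sup>2)" for z by (intro continuous_intros)
      show "\<bar>\<eta> z * (norm v)\<^sup>2\<bar> \<le> 1 * (1 + norm v ^ 3)" for z v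
      proof -
        have "\<bar>\<eta> z * (norm v)\<^sup>2\<bar> \<le> 1 * (norm v)\<^sup>2"
          using \<eta>[of z] by (simp add: abs_mult mult_left_le_one_le)
        then show ?thesis using le_one_plus_cube(2)[of "norm v"] by simp
      qed
    qed
    then show ?thesis by (rule convergentI)
  qed
  moreover have "convergent d" unfolding d_def M_def by (rule diss[OF \<eta>c \<eta>s])
  ultimately obtain l m where "e \<longlonglongrightarrow> l" "d \<longlonglongrightarrow> m" unfolding convergent_def by blast
  then have "(\<lambda>k. B * sqrt (\<nu> k) / 2 * (real DIM('a) * e k + d k)) \<longlonglongrightarrow> B * sqrt 0 / 2 * (real DIM('a) * l + m)"
    by (intro tendsto_intros \<nu>(2)) simp_all
  then have bnd: "(\<lambda>k. B * sqrt (\<nu> k) / 2 * (real DIM('a) * e k + d k)) \<longlonglongrightarrow> 0" by simp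
  show ?thesis
  proof (rule Lim_null_comparison[OF always_eventually bnd, rule_format])
    fix k
    interpret F: smooth_navier_stokes \<Omega> T "\<nu> k" "U k" "P k" "G k" by (rule flow)
    let ?f = "\<lambda>z. (\<Sum>b\<in>Basis. dx b \<phi> z * (U k z \<bullet> dx b (U k) z))"
    have ce: "cont_ext Q X \<eta>" by (rule cont_extI[OF \<eta>c])
    have i: "integrable M f" if "cont_ext Q X f" "\<And>z. z \<in> Q - K2 \<Longrightarrow> f z = 0" for f :: "'a \<times> real \<Rightarrow> real"
      unfolding M_def by (rule integrable_cont_ext[OF open_Q Q_subset_X that(1) K2 that(2)])
    have \<eta>0': "\<eta> z = 0" if "z \<in> Q - K2" for z using \<eta>0[of z] subsetD[OF Q_subset_X, of z] that by simp
    have i1: "integrable M (\<lambda>z. \<eta> z * (norm (U k z))\<^sup>2)"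
      by (rule i) (intro cont_ext_mult cont_ext_power cont_ext_norm F.cont_ext_flow ce, simp add: \<eta>0')
    have gn: "cont_ext Q X (grad_norm_sq (U k))"
      unfolding grad_norm_sq_def[abs_def] by (intro cont_ext_sum cont_ext_power cont_ext_norm F.cont_ext_flow)
    have i2: "integrable M (\<lambda>z. \<eta> z * (\<nu> k * grad_norm_sq (U k) z))"
      by (rule i) (intro cont_ext_mult cont_ext_const gn ce, simp add: \<eta>0')
    have K_K2: "z \<in> K2" if "z \<in> K" for z
      using a(3)[of "fst z" "snd z"] K(2) that a(1) unfolding K2_def by (cases z) auto
    have i3: "integrable M ?f"
    proof (rule i)
      show "cont_ext Q X ?f"
        by (intro cont_ext_sum cont_ext_mult cont_ext_inner F.cont_ext_flow
            C1_ext_D(3)[OF \<phi>1 Basis_spacetime(1), folded dx_def])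
      show "?f z = 0" if "z \<in> Q - K2" for z
      proof -
        have "z \<in> Q - K" using that K_K2 by blast
        then show ?thesis by (simp add: d0)
      qed
    qed
    have young: "\<nu> k * (s * r) \<le> sqrt (\<nu> k) / 2 * (s\<^sup>2 + \<nu> k * r\<^sup>2)" for s r
    proof -
      define m where "m = sqrt (\<nu> k)"
      have m: "0 \<le> m" "\<nu> k = m\<^sup>2" unfolding m_def using \<nu>(1)[of k] by auto
      have "0 \<le> m / 2 * (s - m * r)\<^sup>2" using m(1) by simp
      then show ?thesis unfolding m_def[symmetric]
        by (subst m(2)) (simp add: m(2) m(1) power2_eq_square algebra_simps)
    qed
    have pt: "norm (\<nu> k * ?f z) \<le> B * sqrt (\<nu> k) / 2
        * (real DIM('a) * (\<eta> z * (norm (U k z))\<^sup>2) + \<eta> z * (\<nu> k * grad_norm_sq (U k) z))" if z: "z \<in> Q" for z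
    proof (cases "z \<in> K")
      case False
      then have "?f z = 0" using d0[of z] z by simp
      moreover have "0 \<le> grad_norm_sq (U k) z" unfolding grad_norm_sq_def by (intro sum_nonneg) simp
      ultimately show ?thesis using B(1) \<nu>(1)[of k] \<eta>(1)[of z]
        by (simp add: mult_nonneg_nonneg add_nonneg_nonneg)
    next
      case True
      have "norm (\<nu> k * ?f z) \<le> \<nu> k * (\<Sum>b\<in>Basis. norm (dx b \<phi> z * (U k z \<bullet> dx b (U k) z)))"
        using \<nu>(1)[of k] norm_sum[of "\<lambda>b. dx b \<phi> z * (U k z \<bullet> dx b (U k) z)" Basis]
        by (simp add: abs_mult mult_left_mono)
      also have "\<dots> \<le> (\<Sum>b\<in>(Basis::'a set). B * (sqrt (\<nu> k) / 2 * ((norm (U k z))\<^sup>2 + \<nu> k * (norm (dx b (U k) z))\<^sup>2)))"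
        unfolding sum_distrib_left
      proof (rule sum_mono)
        fix b :: 'a assume b: "b \<in> Basis"
        have "norm (dx b \<phi> z * (U k z \<bullet> dx b (U k) z)) \<le> B * (norm (U k z) * norm (dx b (U k) z))"
          unfolding norm_mult using B(1) B(2)[OF b z] Cauchy_Schwarz_ineq2[of "U k z" "dx b (U k) z"]
          by (intro mult_mono) auto
        then have "\<nu> k * norm (dx b \<phi> z * (U k z \<bullet> dx b (U k) z)) \<le> \<nu> k * (B * (norm (U k z) * norm (dx b (U k) z)))"
          using \<nu>(1)[of k] by (intro mult_left_mono) auto
        also have "\<dots> = B * (\<nu> k * (norm (U k z) * norm (dx b (U k) z)))" by simp
        also have "\<dots> \<le> B * (sqrt (\<nu> k) / 2 * ((norm (U k z))\<^sup>2 + \<nu> k * (norm (dx b (U k) z))\<^sup>2))"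
          by (rule mult_left_mono[OF young B(1)])
        finally show "\<nu> k * norm (dx b \<phi> z * (U k z \<bullet> dx b (U k) z))
            \<le> B * (sqrt (\<nu> k) / 2 * ((norm (U k z))\<^sup>2 + \<nu> k * (norm (dx b (U k) z))\<^sup>2))" .
      qed
      also have "\<dots> = B * sqrt (\<nu> k) / 2
          * (real DIM('a) * (\<eta> z * (norm (U k z))\<^sup>2) + \<eta> z * (\<nu> k * grad_norm_sq (U k) z))"
        unfolding \<eta>1[OF True] grad_norm_sq_def
        by (simp add: sum.distrib sum_distrib_left sum_divide_distrib distrib_left ac_simps)
      finally show ?thesis .
    qed
    have "norm (\<nu> k * (LINT z|M. ?f z)) = norm (LINT z|M. \<nu> k * ?f z)" by simp
    also have "\<dots> \<le> (LINT z|M. norm (\<nu> k * ?f z))" by (rule integral_norm_bound)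
    also have "\<dots> \<le> (LINT z|M. B * sqrt (\<nu> k) / 2
        * (real DIM('a) * (\<eta> z * (norm (U k z))\<^sup>2) + \<eta> z * (\<nu> k * grad_norm_sq (U k) z)))"
      by (rule integral_mono)
        (use i1 i2 i3 pt space_M in \<open>auto intro!: integrable_norm integrable_mult_right Bochner_Integration.integrable_add\<close>)
    also have "\<dots> = B * sqrt (\<nu> k) / 2 * (real DIM('a) * e k + d k)"
      unfolding e_def d_def using i1 i2 by simp
    finally show "norm (\<nu> k * (LINT z|lebesgue_on Q. ?f z)) \<le> B * sqrt (\<nu> k) / 2 * (real DIM('a) * e k + d k)"
      unfolding M_def .
  qed
qed

lemma energy_balance_limit:
  assumes \<phi>: "\<phi> \<in> C1c Q X"
    and diss: "\<And>\<eta>. continuous_on X \<eta> \<Longrightarrow> compact_support_in X \<eta> \<Longrightarrow>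
      (\<lambda>k. LINT z|lebesgue_on Q. \<eta> z * (\<nu> k * grad_norm_sq (U k) z)) \<longlonglongrightarrow> (LINT z|\<mu>. \<eta> z)"
    and final: "\<And>\<eta>. continuous_on (closure \<Omega>) \<eta> \<Longrightarrow>
      (\<lambda>k. LINT x|lebesgue_on \<Omega>. \<eta> x * (norm (U k (x, T)))\<^sup>2) \<longlonglongrightarrow> (LINT x|lam. \<eta> x)"
  shows "(LINT z|lebesgue_on Q. (norm (u z))\<^sup>2 / 2 * dt \<phi> z + ((norm (u z))\<^sup>2 / 2 + p z) * (u z \<bullet> grad \<phi> z))
    = (LINT x|lam. \<phi> (x, T)) / 2 + (LINT z|\<mu>. \<phi> z)"
proof -
  have \<phi>Ck: "Ck 1 Q X \<phi>" and \<phi>s: "compact_support_in X \<phi>" using \<phi> unfolding C1c_def by simp_all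
  note \<phi>1 = C1_extI[OF \<phi>Ck] and \<phi>c = Ck_continuous[OF \<phi>Ck]
  obtain K where K: "compact K" "K \<subseteq> X" "\<forall>z\<in>X - K. \<phi> z = 0"
    using \<phi>s unfolding compact_support_in_def by auto
  have K': "\<forall>z\<in>Q - K. \<phi> z = 0"
  proof
    fix z assume "z \<in> Q - K"
    then have "z \<in> X - K" using subsetD[OF Q_subset_X] by simp
    then show "\<phi> z = 0" by (rule K(3)[rule_format])
  qed
  obtain B where B: "0 \<le> B" "dt \<phi> \<in> borel_measurable M" "\<And>z. z \<in> Q \<Longrightarrow> norm (dt \<phi> z) \<le> B"
      "\<And>b. b \<in> Basis \<Longrightarrow> dx b \<phi> \<in> borel_measurable M" "\<And>b z. b \<in> Basis \<Longrightarrow> z \<in> Q \<Longrightarrow> norm (dx b \<phi> z) \<le> B"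
    by (rule supported_derivatives[OF \<phi>1 Q_subset_X K(1,2) K']) (rule that)
  define C where "C = real DIM('a) * B"
  have gm: "grad \<phi> \<in> borel_measurable M" by (rule measurable_grad[OF B(4)])
  have gb: "norm (grad \<phi> z) \<le> C" if "z \<in> Q" for z unfolding C_def by (rule norm_grad_le[OF B(5)[OF _ that]])
  define N where "N z v = (norm v)\<^sup>2 / 2 * dt \<phi> z + (norm v)\<^sup>2 / 2 * (v \<bullet> grad \<phi> z)" for z v
  have Nm: "(\<lambda>z. N z (v z)) \<in> borel_measurable M" if "v \<in> borel_measurable M" for v
    unfolding N_def using that B(2) gm by measurable
  have Nc: "continuous_on UNIV (N z)" for z unfolding N_def[abs_def] by (intro continuous_intros) simp_all
  have Nb: "\<bar>N z v\<bar> \<le> (B + C) * (1 + norm v ^ 3)" if "z \<in> space M" for z v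
  proof -
    have z: "z \<in> Q" using that space_M by simp
    have C0: "0 \<le> C" unfolding C_def using B(1) by simp
    have "\<bar>(norm v)\<^sup>2 / 2 * dt \<phi> z\<bar> \<le> (1 + norm v ^ 3) * B"
    proof -
      have "(norm v)\<^sup>2 / 2 \<le> 1 + norm v ^ 3"
        using le_one_plus_cube(2)[OF norm_ge_zero, of v] zero_le_power2[of "norm v"] by linarith
      then show ?thesis unfolding abs_mult using B(3)[OF z] by (intro mult_mono) auto
    qed
    moreover have "\<bar>(norm v)\<^sup>2 / 2 * (v \<bullet> grad \<phi> z)\<bar> \<le> (1 + norm v ^ 3) * C"
    proof -
      have "\<bar>(norm v)\<^sup>2 / 2 * (v \<bullet> grad \<phi> z)\<bar> \<le> (norm v)\<^sup>2 * (norm v * norm (grad \<phi> z))"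
        unfolding abs_mult using Cauchy_Schwarz_ineq2[of v "grad \<phi> z"] by (intro mult_mono) auto
      also have "\<dots> = norm v ^ 3 * norm (grad \<phi> z)" by (simp add: power2_eq_square power3_eq_cube)
      also have "\<dots> \<le> (1 + norm v ^ 3) * C" using gb[OF z] by (intro mult_mono) auto
      finally show ?thesis .
    qed
    ultimately have "\<bar>N z v\<bar> \<le> (1 + norm v ^ 3) * B + (1 + norm v ^ 3) * C"
      unfolding N_def by linarith
    then show ?thesis by (simp add: algebra_simps)
  qed
  note nl = nonlinear[OF Nm Nc Nb] and pw = pressure_work_tendsto[OF gm gb]
  let ?R = "\<lambda>k. (LINT x|lebesgue_on \<Omega>. \<phi> (x, T) * (norm (U k (x, T)))\<^sup>2) / 2
      + (LINT z|lebesgue_on Q. \<phi> z * (\<nu> k * grad_norm_sq (U k) z))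
      + \<nu> k * (LINT z|lebesgue_on Q. (\<Sum>b\<in>Basis. dx b \<phi> z * (U k z \<bullet> dx b (U k) z)))"
  have eq: "(LINT z|M. N z (U k z)) + (LINT z|M. P k z * (U k z \<bullet> grad \<phi> z)) = ?R k" for k
  proof -
    have "(LINT z|M. N z (U k z)) + (LINT z|M. P k z * (U k z \<bullet> grad \<phi> z))
        = (LINT z|M. N z (U k z) + P k z * (U k z \<bullet> grad \<phi> z))"
      using nl(2)[of k] pw(2)[of k] by simp
    also have "\<dots> = (LINT z|lebesgue_on Q. (norm (U k z))\<^sup>2 / 2 * dt \<phi> z + ((norm (U k z))\<^sup>2 / 2 + P k z) * (U k z \<bullet> grad \<phi> z))"
      unfolding M_def N_def by (simp add: distrib_right add.assoc)
    finally show ?thesis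
      by (simp only: smooth_navier_stokes.local_energy_identity[OF flow[of k] \<phi>])
  qed
  have "(\<lambda>k. (LINT z|M. N z (U k z)) + (LINT z|M. P k z * (U k z \<bullet> grad \<phi> z)))
      \<longlonglongrightarrow> (LINT z|M. N z (u z)) + (LINT z|M. p z * (u z \<bullet> grad \<phi> z))"
    by (rule tendsto_add[OF nl(1) pw(1)])
  moreover have "?R \<longlonglongrightarrow> (LINT x|lam. \<phi> (x, T)) / 2 + (LINT z|\<mu>. \<phi> z) + 0"
  proof (intro tendsto_add tendsto_divide tendsto_const final diss \<phi>c \<phi>s)
    show "continuous_on (closure \<Omega>) (\<lambda>x. \<phi> (x, T))"
      by (rule continuous_on_compose2[OF \<phi>c]) (use T in \<open>auto intro!: continuous_intros\<close>)
    show "(\<lambda>k. \<nu> k * (LINT z|lebesgue_on Q. (\<Sum>b\<in>Basis. dx b \<phi> z * (U k z \<bullet> dx b (U k) z)))) \<longlonglongrightarrow> 0"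
      by (rule viscous_flux_tendsto_0[OF \<phi>]) (rule convergentI[OF diss])
  qed simp
  ultimately have "(LINT z|M. N z (u z)) + (LINT z|M. p z * (u z \<bullet> grad \<phi> z))
      = (LINT x|lam. \<phi> (x, T)) / 2 + (LINT z|\<mu>. \<phi> z)"
    unfolding eq by (simp add: LIMSEQ_unique)
  moreover have "(LINT z|M. N z (u z)) + (LINT z|M. p z * (u z \<bullet> grad \<phi> z))
      = (LINT z|lebesgue_on Q. (norm (u z))\<^sup>2 / 2 * dt \<phi> z + ((norm (u z))\<^sup>2 / 2 + p z) * (u z \<bullet> grad \<phi> z))"
  proof -
    have "(LINT z|M. N z (u z)) + (LINT z|M. p z * (u z \<bullet> grad \<phi> z)) = (LINT z|M. N z (u z) + p z * (u z \<bullet> grad \<phi> z))"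
      using nl(3) pw(3) by simp
    also have "\<dots> = (LINT z|lebesgue_on Q. (norm (u z))\<^sup>2 / 2 * dt \<phi> z + ((norm (u z))\<^sup>2 / 2 + p z) * (u z \<bullet> grad \<phi> z))"
      unfolding M_def N_def by (simp add: distrib_right add.assoc)
    finally show ?thesis .
  qed
  ultimately show ?thesis by simp
qed

end


section \<open>Measures determined by continuously differentiable functions\<close>

definition add_measure :: "'x measure \<Rightarrow> 'x measure \<Rightarrow> 'x measure" where
  "add_measure M N = measure_of (space M) (sets M) (\<lambda>A. emeasure M A + emeasure N A)"

lemma sets_add_measure [simp]: "sets (add_measure M N) = sets M"
  and space_add_measure [simp]: "space (add_measure M N) = space M"
  unfolding add_measure_def by (simp_all add: sets.space_closed)

lemma emeasure_add_measure:
  assumes "sets N = sets M" "A \<in> sets M"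
  shows "emeasure (add_measure M N) A = emeasure M A + emeasure N A"
proof (rule emeasure_measure_of[OF add_measure_def])
  show "sets M \<subseteq> Pow (space M)" by (rule sets.space_closed)
  show "A \<in> sets (add_measure M N)" using assms by simp
  show "positive (sets (add_measure M N)) (\<lambda>A. emeasure M A + emeasure N A)" by (simp add: positive_def)
  show "countably_additive (sets (add_measure M N)) (\<lambda>A. emeasure M A + emeasure N A)"
  proof (rule countably_additiveI)
    fix F :: "nat \<Rightarrow> _" assume F: "range F \<subseteq> sets (add_measure M N)" "disjoint_family F"
    have "(\<Sum>i. emeasure M (F i) + emeasure N (F i)) = (\<Sum>i. emeasure M (F i)) + (\<Sum>i. emeasure N (F i))"
      by (rule suminf_add[symmetric]) auto
    also have "\<dots> = emeasure M (\<Union>i. F i) + emeasure N (\<Union>i. F i)"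
      using F assms(1) by (simp add: suminf_emeasure)
    finally show "(\<Sum>i. emeasure M (F i) + emeasure N (F i)) = emeasure M (\<Union>i. F i) + emeasure N (\<Union>i. F i)" .
  qed
qed

lemma nn_integral_add_measure:
  assumes S: "sets N = sets M" and f: "f \<in> borel_measurable M"
  shows "(\<integral>\<^sup>+x. f x \<partial>add_measure M N) = (\<integral>\<^sup>+x. f x \<partial>M) + (\<integral>\<^sup>+x. f x \<partial>N)"
proof -
  have tA: "borel_measurable (add_measure M N) = borel_measurable M"
    by (rule measurable_cong_sets) simp_all
  have tN: "borel_measurable N = borel_measurable M"
    by (rule measurable_cong_sets) (simp_all add: S)
  show ?thesis using f
  proof (induction rule: borel_measurable_induct)
    case (cong f g)
    have "space N = space M" using S by (rule sets_eq_imp_space_eq)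
    then have "integral\<^sup>N M f = integral\<^sup>N M g" "integral\<^sup>N N f = integral\<^sup>N N g"
      "integral\<^sup>N (add_measure M N) f = integral\<^sup>N (add_measure M N) g"
      using cong(3) by (auto intro!: nn_integral_cong)
    with cong(4) show ?case by simp
  next
    case (set A)
    then show ?case using S by (simp add: emeasure_add_measure)
  next
    case (mult u c)
    have "u \<in> borel_measurable (add_measure M N)" "u \<in> borel_measurable N"
      unfolding tA tN using mult by blast+
    with mult show ?case by (simp add: nn_integral_cmult distrib_left)
  next
    case (add u v)
    have "u \<in> borel_measurable (add_measure M N)" "u \<in> borel_measurable N"
      "v \<in> borel_measurable (add_measure M N)" "v \<in> borel_measurable N"
      unfolding tA tN using add by blast+
    with add show ?case by (simp add: nn_integral_add ac_simps)
  next
    case (seq F)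
    have m: "F i \<in> borel_measurable (add_measure M N)" "F i \<in> borel_measurable N" for i
      unfolding tA tN using seq by blast+
    have s: "(SUP i. F i) = (\<lambda>x. SUP i. F i x)" by (rule ext) (simp add: image_comp)
    have "(\<integral>\<^sup>+x. (SUP i. F i x) \<partial>add_measure M N) = (SUP i. integral\<^sup>N (add_measure M N) (F i))"
      by (rule nn_integral_monotone_convergence_SUP[OF seq(3) m(1)])
    also have "\<dots> = (SUP i. integral\<^sup>N M (F i) + integral\<^sup>N N (F i))" using seq by simp
    also have "\<dots> = (SUP i. integral\<^sup>N M (F i)) + (SUP i. integral\<^sup>N N (F i))"
      using seq(3) by (intro ennreal_SUP_add) (auto simp: mono_def incseq_def le_fun_def intro!: nn_integral_mono)
    also have "(SUP i. integral\<^sup>N M (F i)) = (\<integral>\<^sup>+x. (SUP i. F i x) \<partial>M)"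
      by (rule nn_integral_monotone_convergence_SUP[symmetric, OF seq(3,1)])
    also have "(SUP i. integral\<^sup>N N (F i)) = (\<integral>\<^sup>+x. (SUP i. F i x) \<partial>N)"
      by (rule nn_integral_monotone_convergence_SUP[symmetric, OF seq(3) m(2)])
    finally show ?case unfolding s .
  qed
qed

lemma integral_add_measure:
  fixes f :: "'x \<Rightarrow> real"
  assumes S: "sets N = sets M" and f: "integrable M f" "integrable N f"
  shows "integral\<^sup>L (add_measure M N) f = integral\<^sup>L M f + integral\<^sup>L N f"
proof -
  have m: "f \<in> borel_measurable M" using f(1) by auto
  then have mA: "f \<in> borel_measurable (add_measure M N)"
    using measurable_cong_sets[OF sets_add_measure refl] by auto
  have p: "(\<integral>\<^sup>+x. ennreal (f x) \<partial>add_measure M N) = (\<integral>\<^sup>+x. ennreal (f x) \<partial>M) + (\<integral>\<^sup>+x. ennreal (f x) \<partial>N)"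
    and n: "(\<integral>\<^sup>+x. ennreal (- f x) \<partial>add_measure M N) = (\<integral>\<^sup>+x. ennreal (- f x) \<partial>M) + (\<integral>\<^sup>+x. ennreal (- f x) \<partial>N)"
    using m by (auto intro!: nn_integral_add_measure[OF S])
  have fin: "(\<integral>\<^sup>+x. ennreal (f x) \<partial>M) \<noteq> \<infinity>" "(\<integral>\<^sup>+x. ennreal (f x) \<partial>N) \<noteq> \<infinity>"
    "(\<integral>\<^sup>+x. ennreal (- f x) \<partial>M) \<noteq> \<infinity>" "(\<integral>\<^sup>+x. ennreal (- f x) \<partial>N) \<noteq> \<infinity>"
    using f unfolding real_integrable_def by auto
  have iA: "integrable (add_measure M N) f"
    unfolding real_integrable_def p n using mA fin by simp
  show ?thesis
    unfolding real_lebesgue_integral_def[OF iA] real_lebesgue_integral_def[OF f(1)]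
      real_lebesgue_integral_def[OF f(2)] p n
    using fin by (simp add: enn2real_plus less_top)
qed

text \<open>On \<open>X\<close>, which omits the initial time, the bumps over boxes in positive time have compact support,
  so their integrals determine the measure of every such box.\<close>

lemma dissipation_box_measure:
  fixes \<Omega> :: "'a::euclidean_space set" and T :: real
  defines "X \<equiv> closure \<Omega> \<times> {0<..T}"
  assumes \<Omega>: "bounded \<Omega>" and m: "borel_measure_on X m" "locally_finite_on X m" and l: "0 < snd l"
  shows "(\<lambda>n. LINT z|m. bump l r n z) \<longlonglongrightarrow> measure m (box l r \<inter> X)"
    and "emeasure m (box l r \<inter> X) \<noteq> \<infinity>"
    and "bump l r n \<in> C1c (\<Omega> \<times> {0<..<T}) X"
proof -
  have sm: "sets m = sets (restrict_space borel X)" using m(1) unfolding borel_measure_on_def .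
  have sp: "space m = X" using sets_eq_imp_space_eq[OF sm] by (simp add: space_restrict_space)
  have eq: "cbox l r \<inter> X = cbox l r \<inter> (closure \<Omega> \<times> {snd l..T})"
    using l by (cases l; cases r) (auto simp: X_def cbox_Pair_eq)
  have cpt: "compact (cbox l r \<inter> X)"
    unfolding eq using \<Omega> by (intro compact_Int compact_cbox compact_Times) (simp_all add: compact_closure)
  have bX: "X \<in> sets borel" unfolding X_def by (intro borel_Times) auto
  have box: "box l r \<inter> X \<in> sets m" "cbox l r \<inter> X \<in> sets m"
    unfolding sm using bX by (auto simp: sets_restrict_space_iff)
  have cfin: "emeasure m (cbox l r \<inter> X) < \<infinity>" using m(2) cpt unfolding locally_finite_on_def by blast
  have sub: "box l r \<inter> X \<subseteq> cbox l r \<inter> X" using box_subset_cbox by blast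
  show fin: "emeasure m (box l r \<inter> X) \<noteq> \<infinity>" using emeasure_mono[OF sub box(2)] cfin by (auto simp: top_unique)
  show "bump l r n \<in> C1c (\<Omega> \<times> {0<..<T}) X"
    unfolding C1c_def using bump_Ck bump_compact_support[OF cpt] by blast
  have bm: "bump l r n \<in> borel_measurable m" for n
  proof -
    have "bump l r n \<in> borel_measurable borel" by (intro borel_measurable_continuous_onI bump_continuous)
    then show ?thesis using measurable_restrict_space1 measurable_cong_sets[OF sm refl] by blast
  qed
  have "(\<lambda>n. LINT z|m. bump l r n z) \<longlonglongrightarrow> (LINT z|m. indicator (box l r \<inter> X) z)"
  proof (rule integral_dominated_convergence[where w="indicator (cbox l r \<inter> X)"])
    show "integrable m (indicator (cbox l r \<inter> X) :: _ \<Rightarrow> real)"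
      by (rule integrable_real_indicator[OF box(2) cfin])
    show "AE z in m. (\<lambda>n. bump l r n z) \<longlonglongrightarrow> indicator (box l r \<inter> X) z"
      using bump_tendsto[of l r] sp by (intro AE_I2) (simp add: indicator_inter_arith)
    show "AE z in m. norm (bump l r n z) \<le> indicator (cbox l r \<inter> X) z" for n
    proof (rule AE_I2)
      fix z assume "z \<in> space m"
      then show "norm (bump l r n z) \<le> indicator (cbox l r \<inter> X) z"
        using bump_bounds[of l r n z] bump_eq_0[of z l r n] box_subset_cbox[of l r] sp
        by (cases "z \<in> box l r") (auto simp: indicator_def)
    qed
  qed (use bm box in auto)
  then show "(\<lambda>n. LINT z|m. bump l r n z) \<longlonglongrightarrow> measure m (box l r \<inter> X)"
    using box(1) by simp
qed

lemma mem_box_spacetime: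
  "z \<in> box l r \<longleftrightarrow> fst z \<in> box (fst l) (fst r) \<and> snd l < snd z \<and> snd z < snd r"
  for z l r :: "'a::euclidean_space \<times> real"
  by (cases z; cases l; cases r) (auto simp: mem_box Basis_prod_def ball_Un)

text \<open>The boxes with positive lower time do not generate all Borel sets of space-time, so both measures
  are first restricted to times after \<open>s > 0\<close>, where every box becomes one of these; then \<open>s\<close> tends to
  \<open>0\<close>.\<close>

lemma measure_determined_by_C1c:
  fixes \<Omega> :: "'a::euclidean_space set" and T :: real
  defines "X \<equiv> closure \<Omega> \<times> {0<..T}"
  assumes \<Omega>: "bounded \<Omega>"
    and m: "borel_measure_on X m" "locally_finite_on X m" and m': "borel_measure_on X m'" "locally_finite_on X m'"
    and eq: "\<And>\<phi> :: 'a \<times> real \<Rightarrow> real. \<phi> \<in> C1c (\<Omega> \<times> {0<..<T}) X \<Longrightarrow> (LINT z|m. \<phi> z) = (LINT z|m'. \<phi> z)"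
    and A: "A \<in> sets (restrict_space borel X)"
  shows "emeasure m A = emeasure m' A"
proof -
  have boxes: "emeasure m (box l r \<inter> X) = emeasure m' (box l r \<inter> X)" if l: "0 < snd l" for l r
  proof -
    note b = dissipation_box_measure[OF \<Omega> m[unfolded X_def] l, of r, folded X_def]
      and b' = dissipation_box_measure[OF \<Omega> m'[unfolded X_def] l, of r, folded X_def]
    have "measure m (box l r \<inter> X) = measure m' (box l r \<inter> X)"
      using LIMSEQ_unique[OF b(1)] b'(1) eq[OF b(3)] by simp
    then show ?thesis using b(2) b'(2) by (simp add: emeasure_eq_ennreal_measure)
  qed
  have bX: "X \<in> sets borel" unfolding X_def by (intro borel_Times) auto
  define H where "H s = {z::'a \<times> real. s < snd z}" for s
  have oH: "open (H s)" for s
    unfolding H_def by (intro open_Collect_less continuous_intros)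
  have XH: "X \<inter> H s \<in> sets borel" for s using bX oH by auto
  define R where "R \<mu> s = distr (restrict_space \<mu> (X \<inter> H s)) borel id" for \<mu> :: "('a \<times> real) measure" and s
  have Rem: "emeasure (R \<mu> s) B = emeasure \<mu> (B \<inter> X \<inter> H s)"
    if \<mu>: "borel_measure_on X \<mu>" and B: "B \<in> sets borel" for \<mu> s B
  proof -
    have S: "sets \<mu> = sets (restrict_space borel X)" using \<mu> unfolding borel_measure_on_def .
    have sp: "space \<mu> = X" using sets_eq_imp_space_eq[OF S] by (simp add: space_restrict_space)
    have in\<mu>: "Y \<in> sets \<mu>" if "Y \<in> sets borel" "Y \<subseteq> X" for Y
      unfolding S using bX that by (simp add: sets_restrict_space_iff)
    have XHm: "X \<inter> H s \<in> sets \<mu>" by (rule in\<mu>[OF XH]) simp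
    have idm: "id \<in> measurable (restrict_space \<mu> (X \<inter> H s)) borel"
    proof (rule measurableI)
      fix Y :: "('a \<times> real) set" assume Y: "Y \<in> sets borel"
      have "Y \<inter> (X \<inter> H s) \<in> sets \<mu>" by (rule in\<mu>) (use Y XH in auto)
      then show "id -` Y \<inter> space (restrict_space \<mu> (X \<inter> H s)) \<in> sets (restrict_space \<mu> (X \<inter> H s))"
      proof (subst sets_restrict_space_iff)
        show "(X \<inter> H s) \<inter> space \<mu> \<in> sets \<mu>" using XHm sp by (simp add: Int_absorb2)
        have "id -` Y \<inter> space (restrict_space \<mu> (X \<inter> H s)) = Y \<inter> (X \<inter> H s)"
          using sp by (auto simp: space_restrict_space)
        then show "id -` Y \<inter> space (restrict_space \<mu> (X \<inter> H s)) \<subseteq> X \<inter> H s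
            \<and> id -` Y \<inter> space (restrict_space \<mu> (X \<inter> H s)) \<in> sets \<mu>"
          using \<open>Y \<inter> (X \<inter> H s) \<in> sets \<mu>\<close> by auto
      qed
    qed simp
    have "emeasure (R \<mu> s) B = emeasure (restrict_space \<mu> (X \<inter> H s)) (B \<inter> (X \<inter> H s))"
      unfolding R_def using B idm sp by (subst emeasure_distr) (auto simp: space_restrict_space Int_ac)
    also have "\<dots> = emeasure \<mu> (B \<inter> (X \<inter> H s))"
      using XHm sp by (intro emeasure_restrict_space) (auto simp: Int_absorb2)
    finally show ?thesis by (simp add: Int_assoc)
  qed
  have Req: "R m s = R m' s" if s: "0 < s" for s
  proof (rule measure_eqI_boxes)
    fix l r :: "'a \<times> real"
    define l' where "l' = (fst l, max (snd l) s)"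
    have l': "0 < snd l'" using s unfolding l'_def by simp
    have bx: "box l r \<inter> X \<inter> H s = box l' r \<inter> X"
      unfolding l'_def H_def by (auto simp: mem_box_spacetime)
    show "emeasure (R m s) (box l r) = emeasure (R m' s) (box l r)"
      using boxes[OF l', of r] by (simp add: Rem m(1) m'(1) bx)
    show "emeasure (R m s) (box l r) \<noteq> \<infinity>"
      using dissipation_box_measure(2)[OF \<Omega> m[unfolded X_def] l', of r, folded X_def] by (simp add: Rem m(1) bx)
  qed (simp_all add: R_def)
  have AX: "A \<subseteq> X" and Ab: "A \<in> sets borel" using A bX by (auto simp: sets_restrict_space_iff)
  have AH: "A \<inter> H s \<in> sets (restrict_space borel X)" for s
    using bX Ab AX oH[of s] by (auto simp: sets_restrict_space_iff)
  define F where "F n = A \<inter> H (inverse (real (Suc n)))" for n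
  have "emeasure m (F n) = emeasure m' (F n)" for n
  proof -
    have Fn: "F n = A \<inter> X \<inter> H (inverse (real (Suc n)))" using AX unfolding F_def by blast
    have "0 < inverse (real (Suc n))" by simp
    from Req[OF this] show ?thesis
      unfolding Fn Rem[OF m(1) Ab, symmetric] Rem[OF m'(1) Ab, symmetric] by (rule arg_cong)
  qed
  moreover have "incseq F"
  proof (rule incseq_SucI)
    fix n
    have "inverse (real (Suc (Suc n))) \<le> inverse (real (Suc n))" by (intro le_imp_inverse_le) simp_all
    then have "H (inverse (real (Suc n))) \<subseteq> H (inverse (real (Suc (Suc n))))"
      unfolding H_def by (intro Collect_mono impI) (rule order.strict_trans1)
    then show "F n \<subseteq> F (Suc n)" unfolding F_def by blast
  qed
  moreover have "(\<Union>n. F n) = A"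
  proof
    show "A \<subseteq> (\<Union>n. F n)"
    proof
      fix z assume z: "z \<in> A"
      then have "0 < snd z" using AX unfolding X_def by auto
      then obtain n where "inverse (real (Suc n)) < snd z" using reals_Archimedean by blast
      then show "z \<in> (\<Union>n. F n)" using z unfolding F_def H_def by blast
    qed
  qed (auto simp: F_def)
  moreover have "range F \<subseteq> sets m" "range F \<subseteq> sets m'"
    using AH m(1) m'(1) unfolding F_def borel_measure_on_def by auto
  ultimately show ?thesis
    using SUP_emeasure_incseq[of F m] SUP_emeasure_incseq[of F m'] by simp
qed


section \<open>The dissipation measure of the inviscid limit\<close>

lemma ennreal_half: "(1/2 :: ennreal) = ennreal (1/2)" "(1/2 :: ennreal) \<noteq> top"
proof -
  show h: "(1/2 :: ennreal) = ennreal (1/2)" using divide_ennreal[of 1 2] by simp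
  show "(1/2 :: ennreal) \<noteq> top" unfolding h by (rule ennreal_neq_top)
qed

lemma integral_scale_measure_half:
  fixes f :: "'x \<Rightarrow> real"
  assumes f: "integrable M f"
  shows "integrable (scale_measure (1/2) M) f" "integral\<^sup>L (scale_measure (1/2) M) f = integral\<^sup>L M f / 2"
proof -
  have "f \<in> borel_measurable M" using f by auto
  then have m: "f \<in> borel_measurable (scale_measure (1/2) M)"
    unfolding measurable_cong_sets[OF sets_scale_measure refl] .
  have p: "(\<integral>\<^sup>+x. ennreal (f x) \<partial>scale_measure (1/2) M) = (1/2) * (\<integral>\<^sup>+x. ennreal (f x) \<partial>M)"
    and n: "(\<integral>\<^sup>+x. ennreal (- f x) \<partial>scale_measure (1/2) M) = (1/2) * (\<integral>\<^sup>+x. ennreal (- f x) \<partial>M)"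
    using f by (auto intro!: nn_integral_scale_measure)

  have t: "(1/2 :: ennreal) * I \<noteq> \<infinity>" if "I \<noteq> \<infinity>" for I
    using that ennreal_half(2) by (auto simp: ennreal_mult_eq_top_iff)
  show i: "integrable (scale_measure (1/2) M) f"
    using f m t unfolding real_integrable_def p n by blast
  have e: "enn2real ((1/2) * I) = enn2real I / 2" for I
  proof -
    have "enn2real (1/2 :: ennreal) = 1/2" unfolding ennreal_half(1) by (rule enn2real_ennreal) simp
    then show ?thesis unfolding enn2real_mult by simp
  qed
  show "integral\<^sup>L (scale_measure (1/2) M) f = integral\<^sup>L M f / 2"
    unfolding real_lebesgue_integral_def[OF i] real_lebesgue_integral_def[OF f] p n e
    by (simp only: diff_divide_distrib)
qed

lemma emeasure_pair_return:
  assumes T: "T \<in> space N" and A: "A \<in> sets (M \<Otimes>\<^sub>M N)"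
  shows "emeasure (M \<Otimes>\<^sub>M return N T) A = emeasure M {x \<in> space M. (x, T) \<in> A}"
proof -
  interpret N: prob_space "return N T" by (rule prob_space_return[OF T])
  have S: "sets (M \<Otimes>\<^sub>M return N T) = sets (M \<Otimes>\<^sub>M N)" by (intro sets_pair_measure_cong) auto
  have mT: "{x \<in> space M. (x, T) \<in> A} \<in> sets M"
  proof -
    have "(\<lambda>x. (x, T)) -` A \<inter> space M \<in> sets M" using A T by measurable
    then show ?thesis by (simp add: vimage_def Int_def conj_commute)
  qed
  have "emeasure (M \<Otimes>\<^sub>M return N T) A = (\<integral>\<^sup>+x. emeasure (return N T) (Pair x -` A) \<partial>M)"
    by (rule N.emeasure_pair_measure_alt) (simp add: S A)
  also have "\<dots> = (\<integral>\<^sup>+x. indicator {x \<in> space M. (x, T) \<in> A} x \<partial>M)"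
  proof (rule nn_integral_cong)
    fix x assume "x \<in> space M"
    moreover have "Pair x -` A \<in> sets N" by (rule sets_Pair1[OF A])
    ultimately show "emeasure (return N T) (Pair x -` A) = indicator {x \<in> space M. (x, T) \<in> A} x"
      by (simp add: indicator_def)
  qed
  also have "\<dots> = emeasure M {x \<in> space M. (x, T) \<in> A}" using mT by (rule nn_integral_indicator)
  finally show ?thesis .
qed

text \<open>\<open>add_measure \<mu> (final_slice \<dots>)\<close> is the measure of the conclusion, realised on the space-time
  \<open>closure \<Omega> \<times> (0,T]\<close>: the second summand is half of \<open>lam\<close> carried by the slice \<open>t = T\<close>.\<close>

definition final_slice :: "'a::euclidean_space set \<Rightarrow> real \<Rightarrow> 'a measure \<Rightarrow> ('a \<times> real) measure" where
  "final_slice A T lam = distr (scale_measure (1/2) lam) (restrict_space borel (A \<times> {0<..T})) (\<lambda>x. (x, T))"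

lemma final_slice:
  fixes \<Omega> :: "'a::euclidean_space set" and T :: real
  defines "X \<equiv> closure \<Omega> \<times> {0<..T}"
  assumes T: "0 < T" and lam: "borel_measure_on (closure \<Omega>) lam" "finite_measure lam" and \<Omega>: "bounded \<Omega>"
  shows "sets (final_slice (closure \<Omega>) T lam) = sets (restrict_space borel X)"
    and "A \<in> sets (restrict_space borel X) \<Longrightarrow> emeasure (final_slice (closure \<Omega>) T lam) A
      = emeasure (scale_measure (1/2) lam \<Otimes>\<^sub>M return (restrict_space borel {0..T}) T) A"
    and "finite_measure (final_slice (closure \<Omega>) T lam)"
    and "continuous_on X f \<Longrightarrow> integrable (final_slice (closure \<Omega>) T lam) (f :: 'a \<times> real \<Rightarrow> real)"
    and "continuous_on X f \<Longrightarrow> (LINT z|final_slice (closure \<Omega>) T lam. f z) = (LINT x|lam. f (x, T)) / 2"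
proof -
  have sl: "sets lam = sets (restrict_space borel (closure \<Omega>))" using lam(1) unfolding borel_measure_on_def .
  have spl: "space lam = closure \<Omega>" using sets_eq_imp_space_eq[OF sl] by (simp add: space_restrict_space)
  let ?h = "scale_measure (1/2) lam"
  have sph: "space ?h = closure \<Omega>" by (simp add: space_scale_measure spl)
  show S: "sets (final_slice (closure \<Omega>) T lam) = sets (restrict_space borel X)"
    unfolding final_slice_def X_def by simp
  have bX: "X \<in> sets borel" unfolding X_def by (intro borel_Times) auto
  have "(\<lambda>x. (x, T)) \<in> measurable (restrict_space borel (closure \<Omega>)) (restrict_space borel X)"
  proof (rule measurable_restrict_space2)
    show "(\<lambda>x. (x, T)) \<in> space (restrict_space borel (closure \<Omega>)) \<rightarrow> X"
      using T by (auto simp: X_def space_restrict_space)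
    show "(\<lambda>x. (x, T)) \<in> measurable (restrict_space borel (closure \<Omega>)) borel"
      by (rule measurable_restrict_space1) (intro borel_measurable_continuous_onI continuous_intros)
  qed
  then have m: "(\<lambda>x. (x, T)) \<in> measurable ?h (restrict_space borel X)"
    using sl by (simp cong: measurable_cong_sets)
  have em: "emeasure (final_slice (closure \<Omega>) T lam) A = emeasure ?h {x \<in> space ?h. (x, T) \<in> A}"
    if "A \<in> sets (restrict_space borel X)" for A
  proof -
    have "(\<lambda>x. (x, T)) -` A \<inter> space ?h = {x \<in> space ?h. (x, T) \<in> A}" by auto
    then show ?thesis unfolding final_slice_def using m that by (simp add: emeasure_distr X_def)
  qed
  show "emeasure (final_slice (closure \<Omega>) T lam) A
      = emeasure (?h \<Otimes>\<^sub>M return (restrict_space borel {0..T}) T) A" if A: "A \<in> sets (restrict_space borel X)"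
  proof -
    have AX: "A \<subseteq> X" "A \<in> sets borel" using A bX by (auto simp: sets_restrict_space_iff)
    let ?P = "?h \<Otimes>\<^sub>M restrict_space borel {0..T}"
    have 1: "fst \<in> measurable ?P borel"
    proof -
      have "(\<lambda>x. x) \<in> measurable (restrict_space borel (closure \<Omega>)) borel"
        by (rule measurable_restrict_space1) simp
      then have "(\<lambda>x. x) \<in> measurable ?h borel" using sl by (simp cong: measurable_cong_sets)
      then show ?thesis by (rule measurable_compose[OF measurable_fst])
    qed
    have 2: "snd \<in> measurable ?P borel"
    proof -
      have "(\<lambda>x. x) \<in> measurable (restrict_space borel {0..T}) borel"
        by (rule measurable_restrict_space1) simp
      then show ?thesis by (rule measurable_compose[OF measurable_snd])
    qed
    have "(\<lambda>z. (fst z, snd z)) \<in> measurable ?P (borel \<Otimes>\<^sub>M borel)" by (rule measurable_Pair[OF 1 2])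
    then have "(\<lambda>z. z) \<in> measurable ?P borel" by (simp add: borel_prod)
    from measurable_sets[OF this AX(2)] have "A \<inter> space ?P \<in> sets ?P" by simp
    moreover have "A \<inter> space ?P = A"
      using AX(1) sph by (auto simp: X_def space_pair_measure space_restrict_space)
    ultimately have "A \<in> sets ?P" by simp
    then have "emeasure (?h \<Otimes>\<^sub>M return (restrict_space borel {0..T}) T) A = emeasure ?h {x \<in> space ?h. (x, T) \<in> A}"
      using T by (intro emeasure_pair_return) (auto simp: space_restrict_space)
    then show ?thesis using em[OF A] by simp
  qed
  interpret L: finite_measure lam by (rule lam(2))
  have hf: "finite_measure ?h"
    by (rule finite_measureI) (simp add: space_scale_measure ennreal_mult_eq_top_iff L.emeasure_finite ennreal_half(2))
  show "finite_measure (final_slice (closure \<Omega>) T lam)"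
    unfolding final_slice_def using finite_measure.finite_measure_distr[OF hf m[unfolded X_def]] .
  assume f: "continuous_on X f"
  have fm: "f \<in> borel_measurable (restrict_space borel X)" by (rule borel_measurable_continuous_on_restrict[OF f])
  have fT: "continuous_on (closure \<Omega>) (\<lambda>x. f (x, T))"
    by (rule continuous_on_compose2[OF f]) (use T in \<open>auto simp: X_def intro!: continuous_intros\<close>)
  have "compact ((\<lambda>x. f (x, T)) ` closure \<Omega>)"
    using \<Omega> by (intro compact_continuous_image[OF fT]) (simp add: compact_closure)
  from compact_imp_bounded[OF this, unfolded bounded_iff]
  obtain B where "\<forall>y\<in>(\<lambda>x. f (x, T)) ` closure \<Omega>. norm y \<le> B" ..
  then have B: "norm (f (x, T)) \<le> B" if "x \<in> closure \<Omega>" for x using that by blast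
  have fTm: "(\<lambda>x. f (x, T)) \<in> borel_measurable lam"
    unfolding measurable_cong_sets[OF sl refl] by (rule borel_measurable_continuous_on_restrict[OF fT])
  have iT: "integrable lam (\<lambda>x. f (x, T))"
    by (rule L.integrable_const_bound[OF AE_I2 fTm], rule B) (simp add: spl)
  show "integrable (final_slice (closure \<Omega>) T lam) f"
    unfolding final_slice_def
    using integrable_distr_eq[OF m fm] integral_scale_measure_half(1)[OF iT] by (simp add: X_def)
  show "(LINT z|final_slice (closure \<Omega>) T lam. f z) = (LINT x|lam. f (x, T)) / 2"
    unfolding final_slice_def
    using integral_distr[OF m fm] integral_scale_measure_half(2)[OF iT] by (simp add: X_def)
qed

lemma integrable_compact_support_finite:
  fixes f :: "'a::euclidean_space \<Rightarrow> real"
  assumes m: "borel_measure_on X m" "finite_measure m" and f: "continuous_on X f" "compact_support_in X f"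
  shows "integrable m f"
proof -
  interpret finite_measure m by (rule m(2))
  have S: "sets m = sets (restrict_space borel X)" using m(1) unfolding borel_measure_on_def .
  have sp: "space m = X" using sets_eq_imp_space_eq[OF S] by (simp add: space_restrict_space)
  have fm: "f \<in> borel_measurable m"
    unfolding measurable_cong_sets[OF S refl] by (rule borel_measurable_continuous_on_restrict[OF f(1)])
  obtain K where K: "compact K" "K \<subseteq> X" "\<forall>x\<in>X - K. f x = 0" using f(2) unfolding compact_support_in_def by blast
  have "compact (f ` K)" by (rule compact_continuous_image[OF continuous_on_subset[OF f(1) K(2)] K(1)])
  from compact_imp_bounded[OF this, unfolded bounded_iff] obtain B where "\<forall>y\<in>f ` K. norm y \<le> B" ..
  then have B: "norm (f x) \<le> B" if "x \<in> K" for x using that by blast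
  show ?thesis
  proof (rule integrable_const_bound[OF AE_I2 fm])
    fix x assume "x \<in> space m"
    then have "x \<in> K \<or> f x = 0" using K(3) sp by blast
    then show "norm (f x) \<le> \<bar>B\<bar>" using B[of x] by auto
  qed
qed

lemma locally_finite_on_finite_measure: "finite_measure m \<Longrightarrow> locally_finite_on X m"
  unfolding locally_finite_on_def using finite_measure.emeasure_finite by (auto simp: less_top)

theorem propositionA1:
  fixes \<Omega> :: "'a::euclidean_space set" and T :: real
    and un :: "real \<Rightarrow> 'a \<times> real \<Rightarrow> 'a" and pn :: "real \<Rightarrow> 'a \<times> real \<Rightarrow> real"
    and u :: "'a \<times> real \<Rightarrow> 'a" and p :: "'a \<times> real \<Rightarrow> real"
    and \<mu> :: "('a \<times> real) measure" and lam :: "'a measure"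
  assumes "2 \<le> DIM('a)"
    and "smooth_bounded_domain \<Omega>"
    and "0 < T"
    and "\<And>\<nu>. 0 < \<nu> \<Longrightarrow> leray_hopf \<Omega> T \<nu> (un \<nu>) (pn \<nu>)"
    and "\<And>\<nu>. 0 < \<nu> \<Longrightarrow> smooth_upto (\<Omega> \<times> {0<..<T}) (closure \<Omega> \<times> {0<..T}) (un \<nu>)"
    and "\<And>\<nu>. 0 < \<nu> \<Longrightarrow> smooth_upto (\<Omega> \<times> {0<..<T}) (closure \<Omega> \<times> {0<..T}) (pn \<nu>)"
    and "tendsto_Lp 3 (\<Omega> \<times> {0<..<T}) un u (at_right 0)"
    and "weak_tendsto_Lp (3/2) (\<Omega> \<times> {0<..<T}) pn p (at_right 0)"
    and "borel_measure_on (closure \<Omega> \<times> {0<..T}) \<mu>" and "finite_measure \<mu>"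
    and "tendsto_measures (\<Omega> \<times> {0<..<T}) (closure \<Omega> \<times> {0<..T})
           (\<lambda>\<nu> z. \<nu> * grad_norm_sq (un \<nu>) z) \<mu> (at_right 0)"
    and "borel_measure_on (closure \<Omega>) lam" and "finite_measure lam"
    and "tendsto_measures \<Omega> (closure \<Omega>) (\<lambda>\<nu> x. (norm (un \<nu> (x, T)))\<^sup>2) lam (at_right 0)"
  shows "euler_weak_solution \<Omega> T u p \<and>
    (\<exists>\<epsilon>. boundary_extendable_dissipation \<Omega> T u p \<epsilon>) \<and>
    (\<forall>\<epsilon>. boundary_extendable_dissipation \<Omega> T u p \<epsilon> \<longrightarrow>
       (\<forall>A \<in> sets (restrict_space borel (closure \<Omega> \<times> {0<..T})).
          emeasure \<epsilon> A = emeasure \<mu> A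
            + emeasure (scale_measure (1/2) lam \<Otimes>\<^sub>M return (restrict_space borel {0..T}) T) A))"
proof -
  note leray = assms(4) and smooth = assms(5,6) and strong = assms(7) and weak = assms(8)
    and mu = assms(9,10) and mu_lim = assms(11) and lam = assms(12,13) and lam_lim = assms(14)
  note domain = assms(2)[unfolded smooth_bounded_domain_def]
  have dom: "open \<Omega>" "bounded \<Omega>"
    by (rule domain[THEN conjunct1], rule domain[THEN conjunct2, THEN conjunct2, THEN conjunct2, THEN conjunct1])
  have T: "0 < T" by (rule assms(3))
  define Q where "Q = \<Omega> \<times> {0<..<T}"
  define X where "X = closure \<Omega> \<times> {0<..T}"

  have pL: "eventually (\<lambda>\<nu>. pn \<nu> \<in> Lp (3/2) Q) (at_right 0)"
    using weak unfolding weak_tendsto_Lp_def Q_def by (elim conjE)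
  obtain \<nu> D where \<nu>: "filterlim \<nu> (at_right 0) sequentially" "\<And>k. 0 < \<nu> k" "\<And>k. pn (\<nu> k) \<in> Lp (3/2) Q"
    "\<And>k. un (\<nu> k) \<in> Lp 3 Q" and D: "D \<in> borel_measurable (lebesgue_on Q)" "\<And>z. 0 \<le> D z"
    "integrable (lebesgue_on Q) (\<lambda>z. D z ^ 3)"
    "AE z in lebesgue_on Q. \<forall>n. (\<Sum>k<n. norm (un (\<nu> k) z - u z)) \<le> D z"
    by (rule tendsto_Lp3_sequence[OF strong[folded Q_def] pL]) (rule that)
  have "\<exists>G. AE t in lebesgue_on {0<..<T}. H1_zero_trace \<Omega> (\<lambda>x. un (\<nu> k) (x, t)) (G t)" for k
  proof -
    obtain G where "AE t in lebesgue_on {0<..<T}. H1_zero_trace \<Omega> (\<lambda>x. un (\<nu> k) (x, t)) (\<lambda>b x. G b (x, t))"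
      using leray[OF \<nu>(2)[of k]] unfolding leray_hopf_def by (elim conjE exE) (rule that)
    then show ?thesis by (intro exI[of _ "\<lambda>t b x. G b (x, t)"])
  qed
  then have "\<forall>k. \<exists>G. AE t in lebesgue_on {0<..<T}. H1_zero_trace \<Omega> (\<lambda>x. un (\<nu> k) (x, t)) (G t)" ..
  from choice[OF this] obtain G where
    G: "\<forall>k. AE t in lebesgue_on {0<..<T}. H1_zero_trace \<Omega> (\<lambda>x. un (\<nu> k) (x, t)) (G k t)" ..
  interpret S: inviscid_sequence \<Omega> T \<nu> "\<lambda>k. un (\<nu> k)" "\<lambda>k. pn (\<nu> k)" G u p D
  proof
    show "smooth_upto (\<Omega> \<times> {0<..<T}) (closure \<Omega> \<times> {0<..T}) (un (\<nu> k))"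
      "smooth_upto (\<Omega> \<times> {0<..<T}) (closure \<Omega> \<times> {0<..T}) (pn (\<nu> k))" for k
      by (rule smooth(1)[OF \<nu>(2)], rule smooth(2)[OF \<nu>(2)])
    show "distributional_solution \<Omega> T (\<nu> k) (un (\<nu> k)) (pn (\<nu> k))" for k
      using leray[OF \<nu>(2)[of k]] unfolding leray_hopf_def by (rule conjunct1)
    show "\<nu> \<longlonglongrightarrow> 0" using \<nu>(1) by (simp add: filterlim_at)
    show "u \<in> Lp 3 (\<Omega> \<times> {0<..<T})" using strong unfolding tendsto_Lp_def by (rule conjunct1)
    show "p \<in> Lp (3/2) (\<Omega> \<times> {0<..<T})" using weak unfolding weak_tendsto_Lp_def by (rule conjunct1)
    show "(\<lambda>k. LINT z|lebesgue_on (\<Omega> \<times> {0<..<T}). pn (\<nu> k) z * h z)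
        \<longlonglongrightarrow> (LINT z|lebesgue_on (\<Omega> \<times> {0<..<T}). p z * h z)" if "h \<in> Lp 3 (\<Omega> \<times> {0<..<T})" for h
    proof -
      have "((\<lambda>\<nu>. LINT z|lebesgue_on (\<Omega> \<times> {0<..<T}). pn \<nu> z \<bullet> h z)
          \<longlongrightarrow> (LINT z|lebesgue_on (\<Omega> \<times> {0<..<T}). p z \<bullet> h z)) (at_right 0)"
        using weak that unfolding weak_tendsto_Lp_def by simp
      from filterlim_compose[OF this \<nu>(1)] show ?thesis by simp
    qed
  qed (use dom T \<nu>(2) G \<nu>(3,4)[unfolded Q_def] D[unfolded Q_def] in simp_all)
  have euler: "euler_weak_solution \<Omega> T u p" by (rule S.euler_limit)

  have balance: "(LINT z|lebesgue_on Q. (norm (u z))\<^sup>2 / 2 * dt \<phi> z + ((norm (u z))\<^sup>2 / 2 + p z) * (u z \<bullet> grad \<phi> z))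
    = (LINT x|lam. \<phi> (x, T)) / 2 + (LINT z|\<mu>. \<phi> z)" if "\<phi> \<in> C1c Q X" for \<phi>
    unfolding Q_def
  proof (rule S.energy_balance_limit)
    show "\<phi> \<in> C1c (\<Omega> \<times> {0<..<T}) (closure \<Omega> \<times> {0<..T})" using that unfolding Q_def X_def .
    show "(\<lambda>k. LINT z|lebesgue_on (\<Omega> \<times> {0<..<T}). \<eta> z * (\<nu> k * grad_norm_sq (un (\<nu> k)) z)) \<longlonglongrightarrow> (LINT z|\<mu>. \<eta> z)"
      if "continuous_on (closure \<Omega> \<times> {0<..T}) \<eta>" "compact_support_in (closure \<Omega> \<times> {0<..T}) \<eta>" for \<eta>
    proof -
      have "((\<lambda>\<nu>. LINT z|lebesgue_on (\<Omega> \<times> {0<..<T}). \<eta> z * (\<nu> * grad_norm_sq (un \<nu>) z)) \<longlongrightarrow> (LINT z|\<mu>. \<eta> z)) (at_right 0)"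
        by (rule mu_lim[unfolded tendsto_measures_def, THEN spec, THEN mp, OF conjI[OF that]])
      from filterlim_compose[OF this \<nu>(1)] show ?thesis .
    qed
    show "(\<lambda>k. LINT x|lebesgue_on \<Omega>. \<eta> x * (norm (un (\<nu> k) (x, T)))\<^sup>2) \<longlonglongrightarrow> (LINT x|lam. \<eta> x)"
      if "continuous_on (closure \<Omega>) \<eta>" for \<eta>
    proof -
      have "compact_support_in (closure \<Omega>) \<eta>"
        unfolding compact_support_in_def using dom by (intro exI[of _ "closure \<Omega>"]) (simp add: compact_closure)
      then have "((\<lambda>\<nu>. LINT x|lebesgue_on \<Omega>. \<eta> x * (norm (un \<nu> (x, T)))\<^sup>2) \<longlongrightarrow> (LINT x|lam. \<eta> x)) (at_right 0)"
        by (intro lam_lim[unfolded tendsto_measures_def, THEN spec, THEN mp] conjI that)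
      from filterlim_compose[OF this \<nu>(1)] show ?thesis .
    qed
  qed

  define \<epsilon>0 where "\<epsilon>0 = add_measure \<mu> (final_slice (closure \<Omega>) T lam)"
  note fs = final_slice[OF T lam dom(2), folded X_def]
  have smu: "sets \<mu> = sets (restrict_space borel X)" using mu(1) unfolding borel_measure_on_def X_def .
  have sfs: "sets (final_slice (closure \<Omega>) T lam) = sets \<mu>" unfolding smu by (rule fs(1))
  have em0: "emeasure \<epsilon>0 A = emeasure \<mu> A + emeasure (scale_measure (1/2) lam \<Otimes>\<^sub>M return (restrict_space borel {0..T}) T) A"
    if "A \<in> sets (restrict_space borel X)" for A
    unfolding \<epsilon>0_def using emeasure_add_measure[OF sfs, of A] fs(2)[OF that] that smu by simp
  have b0: "borel_measure_on X \<epsilon>0" unfolding borel_measure_on_def \<epsilon>0_def by (simp add: smu)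
  have fin0: "finite_measure \<epsilon>0"
  proof (rule finite_measureI)
    have "space \<mu> \<in> sets \<mu>" by auto
    then show "emeasure \<epsilon>0 (space \<epsilon>0) \<noteq> \<infinity>"
      unfolding \<epsilon>0_def using emeasure_add_measure[OF sfs, of "space \<mu>"]
        finite_measure.emeasure_finite[OF mu(2)] finite_measure.emeasure_finite[OF fs(3)] by simp
  qed
  have int0: "(LINT z|\<epsilon>0. \<phi> z) = (LINT x|lam. \<phi> (x, T)) / 2 + (LINT z|\<mu>. \<phi> z)"
    if \<phi>: "\<phi> \<in> C1c Q X" for \<phi> :: "'a \<times> real \<Rightarrow> real"
  proof -
    have c: "continuous_on X \<phi>" and s: "compact_support_in X \<phi>"
      using \<phi> Ck_continuous[of 1 Q X \<phi>] unfolding C1c_def by simp_all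
    have "integrable \<mu> \<phi>" by (rule integrable_compact_support_finite[OF mu(1)[folded X_def] mu(2) c s])
    from integral_add_measure[OF sfs this fs(4)[OF c]] show ?thesis
      unfolding \<epsilon>0_def fs(5)[OF c] by simp
  qed
  have "boundary_extendable_dissipation \<Omega> T u p \<epsilon>0"
    unfolding boundary_extendable_dissipation_def Let_def Q_def[symmetric] X_def[symmetric]
  proof (intro conjI ballI)
    show "u \<in> Lp 3 Q" "p \<in> Lp (3/2) Q" unfolding Q_def by (rule S.L3(2), rule S.L32(2))
    show "(LINT z|lebesgue_on Q. (norm (u z))\<^sup>2 / 2 * dt \<phi> z + ((norm (u z))\<^sup>2 / 2 + p z) * (u z \<bullet> grad \<phi> z))
        = (LINT z|\<epsilon>0. \<phi> z)" if "\<phi> \<in> C1c Q X" for \<phi>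
      unfolding balance[OF that] int0[OF that] ..
  qed (rule euler b0 locally_finite_on_finite_measure[OF fin0])+
  moreover have "emeasure \<epsilon> A = emeasure \<mu> A
      + emeasure (scale_measure (1/2) lam \<Otimes>\<^sub>M return (restrict_space borel {0..T}) T) A"
    if \<epsilon>: "boundary_extendable_dissipation \<Omega> T u p \<epsilon>" and A: "A \<in> sets (restrict_space borel X)" for \<epsilon> A
  proof -
    note \<epsilon>' = \<epsilon>[unfolded boundary_extendable_dissipation_def Let_def, folded Q_def X_def]
    have e: "borel_measure_on X \<epsilon>" "locally_finite_on X \<epsilon>" using \<epsilon>' by simp_all
    have bal: "(LINT z|lebesgue_on Q. (norm (u z))\<^sup>2 / 2 * dt \<phi> z + ((norm (u z))\<^sup>2 / 2 + p z) * (u z \<bullet> grad \<phi> z))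
        = (LINT z|\<epsilon>. \<phi> z)" if "\<phi> \<in> C1c Q X" for \<phi>
      using \<epsilon>'[THEN conjunct2, THEN conjunct2, THEN conjunct2, THEN conjunct2, THEN conjunct2] that by (rule bspec)
    have "emeasure \<epsilon> A = emeasure \<epsilon>0 A"
    proof (rule measure_determined_by_C1c[OF dom(2) e[unfolded X_def] b0[unfolded X_def]
          locally_finite_on_finite_measure[OF fin0] _ A[unfolded X_def]])
      show "(LINT z|\<epsilon>. \<phi> z) = (LINT z|\<epsilon>0. \<phi> z)"
        if "\<phi> \<in> C1c (\<Omega> \<times> {0<..<T}) (closure \<Omega> \<times> {0<..T})" for \<phi> :: "'a \<times> real \<Rightarrow> real"
        using bal[of \<phi>] balance[of \<phi>] int0[of \<phi>] that unfolding Q_def X_def by simp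
    qed
    then show ?thesis using em0[OF A] by simp
  qed
  ultimately show ?thesis using euler unfolding X_def[symmetric] by (intro conjI exI allI impI ballI)
qed

end
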